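(* Let $G$ be a group and suppose $R$ is a $G$-ring. Then there is a weak $G$-equivalence $$\mathrm{Cat}(\widetilde G,\mathrm{iso}\,\mathscr{F}(R))\longrightarrow\mathrm{Cat}(\widetilde G,\mathscr{GL}(R)).$$
   Context: A $G$-ring is a ring $R$ with a left action of $G$ by ring automorphisms $r\mapsto{}^g r$. A $G$-category is a category with strict action of $G$ by functors. $\widetilde G$ is the category with object set $G$ and exactly one morphism between any two objects, with $G$ acting by left translation on objects. $\mathrm{Cat}(\widetilde G,\mathscr{C})$ is the $G$-category of all functors $\widetilde G\to\mathscr{C}$ and natural transformations, with $G$ acting by conjugation. $\mathscr{F}(R)$ is the category of finitely generated free (left) $R$-modules with $G$-action: $gM$ is the abelian group $M$ with scalar multiplication $r\cdot_g m={}^{g}r\,m$, and $gf=f$ on underlying abelian groups; $\mathrm{iso}\,\mathscr{F}(R)$ is its subcategory of isomorphisms. $\mathscr{GL}(R)=\coprod_{n\ge0}GL_n(R)$ is the category with objects the based free modules $R^n$ ($n\ge0$), with $\mathrm{Mor}(R^n,R^n)=GL_n(R)$ and no morphisms $R^n\to R^m$ for $n\ne m$, with $G$ acting trivially on objects and entrywise on matrices. A functor $F:\mathscr{C}\to\mathscr{D}$ between $G$-categories is a weak $G$-equivalence if it induces a weak $G$-equivalence $BF:B\mathscr{C}\to B\mathscr{D}$ on classifying spaces, i.e. $(BF)^H:(B\mathscr{C})^H\to(B\mathscr{D})^H$ is a weak homotopy equivalence for all subgroups $H\subseteq G$. When classifying spaces are taken, non-small categories are tacitly replaced by small models.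
   Formalization: R is assumed to have invariant basis number (otherwise the claim fails on path components), and G acts on free modules by letting r act on gM as the inverse of g applied to r, since the formula with g itself gives a right action. *)

theory Defs
  imports
    "HOL-Analysis.Analysis"
    "HOL-Algebra.Group"
    "HOL-Algebra.Module"
    "HOL-Homology.Simplices"
    "Jordan_Normal_Form.Matrix"
begin

section \<open>Categories and functors\<close>

text \<open>
  Arrows carry their source and target. \<open>Cmp C g f\<close> is the composite
  \<open>g\<close> after \<open>f\<close>; its value is irrelevant unless \<open>Src C g = Tgt C f\<close>.
\<close>

record ('o, 'a) cat =
  Obj :: "'o set"
  Arr :: "'a set"
  Src :: "'a \<Rightarrow> 'o"
  Tgt :: "'a \<Rightarrow> 'o"
  Idt :: "'o \<Rightarrow> 'a"
  Cmp :: "'a \<Rightarrow> 'a \<Rightarrow> 'a"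

locale category =
  fixes C :: "('o, 'a, 'z) cat_scheme"
  assumes src_closed: "f \<in> Arr C \<Longrightarrow> Src C f \<in> Obj C"
    and tgt_closed: "f \<in> Arr C \<Longrightarrow> Tgt C f \<in> Obj C"
    and idt: "x \<in> Obj C \<Longrightarrow> Idt C x \<in> Arr C \<and> Src C (Idt C x) = x \<and> Tgt C (Idt C x) = x"
    and cmp: "\<lbrakk>f \<in> Arr C; g \<in> Arr C; Tgt C f = Src C g\<rbrakk>
        \<Longrightarrow> Cmp C g f \<in> Arr C \<and> Src C (Cmp C g f) = Src C f \<and> Tgt C (Cmp C g f) = Tgt C g"
    and cmp_idt_right: "f \<in> Arr C \<Longrightarrow> Cmp C f (Idt C (Src C f)) = f"
    and cmp_idt_left: "f \<in> Arr C \<Longrightarrow> Cmp C (Idt C (Tgt C f)) f = f"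
    and cmp_assoc: "\<lbrakk>f \<in> Arr C; g \<in> Arr C; h \<in> Arr C; Tgt C f = Src C g; Tgt C g = Src C h\<rbrakk>
        \<Longrightarrow> Cmp C h (Cmp C g f) = Cmp C (Cmp C h g) f"

text \<open>
  Both components of a functor are required to be extensional, so that equality in HOL is
  equality of functors.
\<close>

record ('o, 'a, 'p, 'b) fctr =
  omap :: "'o \<Rightarrow> 'p"
  amap :: "'a \<Rightarrow> 'b"

definition is_functor ::
  "('o, 'a, 'y) cat_scheme \<Rightarrow> ('p, 'b, 'z) cat_scheme \<Rightarrow> ('o, 'a, 'p, 'b) fctr \<Rightarrow> bool" where
  "is_functor C D F \<longleftrightarrow>
     omap F \<in> Obj C \<rightarrow>\<^sub>E Obj D \<and> amap F \<in> Arr C \<rightarrow>\<^sub>E Arr D \<and>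
     (\<forall>f\<in>Arr C. Src D (amap F f) = omap F (Src C f) \<and> Tgt D (amap F f) = omap F (Tgt C f)) \<and>
     (\<forall>x\<in>Obj C. amap F (Idt C x) = Idt D (omap F x)) \<and>
     (\<forall>f\<in>Arr C. \<forall>g\<in>Arr C. Tgt C f = Src C g \<longrightarrow>
        amap F (Cmp C g f) = Cmp D (amap F g) (amap F f))"

definition id_fctr :: "('o, 'a, 'z) cat_scheme \<Rightarrow> ('o, 'a, 'o, 'a) fctr" where
  "id_fctr C = \<lparr>omap = \<lambda>x\<in>Obj C. x, amap = \<lambda>f\<in>Arr C. f\<rparr>"

text \<open>\<open>comp_fctr C F' F\<close> is \<open>F'\<close> after \<open>F\<close>, where \<open>C\<close> is the domain of \<open>F\<close>.\<close>

definition comp_fctr ::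
  "('o, 'a, 'z) cat_scheme \<Rightarrow> ('p, 'b, 'q, 'c) fctr \<Rightarrow> ('o, 'a, 'p, 'b) fctr
     \<Rightarrow> ('o, 'a, 'q, 'c) fctr" where
  "comp_fctr C F' F =
     \<lparr>omap = \<lambda>x\<in>Obj C. omap F' (omap F x), amap = \<lambda>f\<in>Arr C. amap F' (amap F f)\<rparr>"

definition nat_trans ::
  "('o, 'a, 'y) cat_scheme \<Rightarrow> ('p, 'b, 'z) cat_scheme
     \<Rightarrow> ('o, 'a, 'p, 'b) fctr \<Rightarrow> ('o, 'a, 'p, 'b) fctr \<Rightarrow> ('o \<Rightarrow> 'b) \<Rightarrow> bool" where
  "nat_trans C D F F' \<eta> \<longleftrightarrow>
     \<eta> \<in> Obj C \<rightarrow>\<^sub>E Arr D \<and>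
     (\<forall>x\<in>Obj C. Src D (\<eta> x) = omap F x \<and> Tgt D (\<eta> x) = omap F' x) \<and>
     (\<forall>f\<in>Arr C. Cmp D (\<eta> (Tgt C f)) (amap F f) = Cmp D (amap F' f) (\<eta> (Src C f)))"


section \<open>Categories with a strict action of a group\<close>

record ('g, 'o, 'a) gcat = "('o, 'a) cat" +
  gact :: "'g \<Rightarrow> ('o, 'a, 'o, 'a) fctr"

locale gcategory = group G + category C
  for G :: "('g, 'x) monoid_scheme" (structure) and C :: "('g, 'o, 'a, 'z) gcat_scheme" +
  assumes gact_functor: "g \<in> carrier G \<Longrightarrow> is_functor C C (gact C g)"
    and gact_one: "gact C \<one> = id_fctr C"
    and gact_mult: "\<lbrakk>g \<in> carrier G; h \<in> carrier G\<rbrakk>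
        \<Longrightarrow> gact C (g \<otimes> h) = comp_fctr C (gact C g) (gact C h)"

locale equivariant_functor = C: gcategory G C + D: gcategory G D
  for G :: "('g, 'x) monoid_scheme" (structure)
    and C :: "('g, 'o, 'a, 'y) gcat_scheme" and D :: "('g, 'p, 'b, 'z) gcat_scheme" +
  fixes F :: "('o, 'a, 'p, 'b) fctr"
  assumes is_functor: "is_functor C D F"
    and equivariant: "g \<in> carrier G \<Longrightarrow> comp_fctr C F (gact C g) = comp_fctr C (gact D g) F"

definition translation_gcat :: "('g, 'x) monoid_scheme \<Rightarrow> ('g, 'g, 'g \<times> 'g) gcat" where
  "translation_gcat G =
     \<lparr>Obj = carrier G, Arr = carrier G \<times> carrier G, Src = fst, Tgt = snd,
      Idt = \<lambda>x. (x, x), Cmp = \<lambda>(_, z) (x, _). (x, z),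
      gact = \<lambda>g. \<lparr>omap = \<lambda>x\<in>carrier G. g \<otimes>\<^bsub>G\<^esub> x,
                   amap = \<lambda>(x, y)\<in>carrier G \<times> carrier G. (g \<otimes>\<^bsub>G\<^esub> x, g \<otimes>\<^bsub>G\<^esub> y)\<rparr>\<rparr>"

text \<open>
  The functor category, with \<open>G\<close> acting by conjugation:
  \<open>(g F) x = g (F (inv g x))\<close> and \<open>(g \<eta>) x = g (\<eta> (inv g x))\<close>.
\<close>

definition conj_fctr ::
  "('g, 'x) monoid_scheme \<Rightarrow> ('g, 'o, 'a, 'y) gcat_scheme \<Rightarrow> ('g, 'p, 'b, 'z) gcat_scheme
     \<Rightarrow> 'g \<Rightarrow> ('o, 'a, 'p, 'b) fctr \<Rightarrow> ('o, 'a, 'p, 'b) fctr" where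
  "conj_fctr G C D g F =
     comp_fctr C (gact D g) (comp_fctr C F (gact C (inv\<^bsub>G\<^esub> g)))"

definition Cat_gcat ::
  "('g, 'x) monoid_scheme \<Rightarrow> ('g, 'o, 'a, 'y) gcat_scheme \<Rightarrow> ('g, 'p, 'b, 'z) gcat_scheme
     \<Rightarrow> ('g, ('o, 'a, 'p, 'b) fctr,
          ('o, 'a, 'p, 'b) fctr \<times> ('o, 'a, 'p, 'b) fctr \<times> ('o \<Rightarrow> 'b)) gcat" where
  "Cat_gcat G C D =
     (let Ob = {F. is_functor C D F};
          Ar = {(F, F', \<eta>). is_functor C D F \<and> is_functor C D F' \<and> nat_trans C D F F' \<eta>}
      in \<lparr>Obj = Ob, Arr = Ar, Src = \<lambda>(F, _, _). F, Tgt = \<lambda>(_, F', _). F',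
          Idt = \<lambda>F. (F, F, \<lambda>x\<in>Obj C. Idt D (omap F x)),
          Cmp = \<lambda>(_, F'', \<eta>') (F, _, \<eta>). (F, F'', \<lambda>x\<in>Obj C. Cmp D (\<eta>' x) (\<eta> x)),
          gact = \<lambda>g. \<lparr>omap = \<lambda>F\<in>Ob. conj_fctr G C D g F,
                       amap = \<lambda>(F, F', \<eta>)\<in>Ar. (conj_fctr G C D g F, conj_fctr G C D g F',
                         \<lambda>x\<in>Obj C. amap (gact D g) (\<eta> (omap (gact C (inv\<^bsub>G\<^esub> g)) x)))\<rparr>\<rparr>)"


section \<open>Classifying spaces\<close>

text \<open>The poset \<open>[n] = {0 < \<dots> < n}\<close> as a category; \<open>n\<close>-simplices of the nerve are functors on it.\<close>

definition ord_cat :: "nat \<Rightarrow> (nat, nat \<times> nat) cat" where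
  "ord_cat n = \<lparr>Obj = {..n}, Arr = {(i, j). i \<le> j \<and> j \<le> n}, Src = fst, Tgt = snd,
     Idt = \<lambda>i. (i, i), Cmp = \<lambda>(_, k) (i, _). (i, k)\<rparr>"

definition ord_fctr :: "nat \<Rightarrow> (nat \<Rightarrow> nat) \<Rightarrow> (nat, nat \<times> nat, nat, nat \<times> nat) fctr" where
  "ord_fctr m \<alpha> =
     \<lparr>omap = restrict \<alpha> (Obj (ord_cat m)), amap = restrict (map_prod \<alpha> \<alpha>) (Arr (ord_cat m))\<rparr>"

type_synonym ('o, 'a) simplices = "(nat \<times> (nat, nat \<times> nat, 'o, 'a) fctr) \<times> (nat \<Rightarrow> real)"

definition nerve :: "('o, 'a, 'z) cat_scheme \<Rightarrow> nat \<Rightarrow> (nat, nat \<times> nat, 'o, 'a) fctr set" where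
  "nerve C n = {\<sigma>. is_functor (ord_cat n) C \<sigma>}"

definition simplex_space :: "('o, 'a, 'z) cat_scheme \<Rightarrow> ('o, 'a) simplices topology" where
  "simplex_space C =
     sum_topology (\<lambda>(n, \<sigma>). subtopology (powertop_real UNIV) (standard_simplex n))
       (SIGMA n:UNIV. nerve C n)"

definition simplex_push :: "nat \<Rightarrow> (nat \<Rightarrow> nat) \<Rightarrow> (nat \<Rightarrow> real) \<Rightarrow> nat \<Rightarrow> real" where
  "simplex_push m \<alpha> t = (\<lambda>j. \<Sum>i\<in>{i\<in>{..m}. \<alpha> i = j}. t i)"

definition glue :: "('o, 'a, 'z) cat_scheme \<Rightarrow> ('o, 'a) simplices rel" where
  "glue C = {(((m, comp_fctr (ord_cat m) \<sigma> (ord_fctr m \<alpha>)), t), ((n, \<sigma>), simplex_push m \<alpha> t))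
     | m n \<alpha> \<sigma> t. mono_on {..m} \<alpha> \<and> \<alpha> \<in> {..m} \<rightarrow> {..n} \<and>
         \<sigma> \<in> nerve C n \<and> t \<in> standard_simplex m}"

definition realization_rel :: "('o, 'a, 'z) cat_scheme \<Rightarrow> ('o, 'a) simplices rel" where
  "realization_rel C = (glue C \<union> (glue C)\<inverse>)\<^sup>*"

lemma equiv_realization_rel: "equiv UNIV (realization_rel C)"
  unfolding realization_rel_def equiv_def
  by (intro conjI refl_rtrancl sym_rtrancl trans_rtrancl) (auto simp: sym_def)

definition quotient_topology :: "'p topology \<Rightarrow> 'p rel \<Rightarrow> 'p set topology" where
  "quotient_topology X r = topology (\<lambda>U. U \<subseteq> topspace X // r \<and> openin X (\<Union>U))"

lemma openin_quotient_topology: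
  assumes "equiv UNIV r"
  shows "openin (quotient_topology X r) U \<longleftrightarrow> U \<subseteq> topspace X // r \<and> openin X (\<Union>U)"
proof -
  have disj: "c = d" if "c \<in> topspace X // r" "d \<in> topspace X // r" "x \<in> c" "x \<in> d" for x c d
  proof -
    have "c \<in> UNIV // r" "d \<in> UNIV // r" using that by (auto elim!: quotientE intro: quotientI)
    then show ?thesis using quotient_disj[OF assms, of c d] that by auto
  qed
  have "istopology (\<lambda>U. U \<subseteq> topspace X // r \<and> openin X (\<Union>U))"
    unfolding istopology_def
  proof (intro conjI allI impI)
    fix S T assume ST: "S \<subseteq> topspace X // r \<and> openin X (\<Union>S)" "T \<subseteq> topspace X // r \<and> openin X (\<Union>T)"
    have "\<Union>S \<inter> \<Union>T \<subseteq> \<Union>(S \<inter> T)"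
    proof
      fix x assume "x \<in> \<Union>S \<inter> \<Union>T"
      then obtain c d where "c \<in> S" "x \<in> c" "d \<in> T" "x \<in> d" by blast
      with disj[of c d x] ST show "x \<in> \<Union>(S \<inter> T)" by blast
    qed
    then have "\<Union>(S \<inter> T) = \<Union>S \<inter> \<Union>T" by blast
    with ST show "openin X (\<Union>(S \<inter> T))" by (metis openin_Int)
    show "S \<inter> T \<subseteq> topspace X // r" using ST by blast
  next
    fix K assume K: "\<forall>k\<in>K. k \<subseteq> topspace X // r \<and> openin X (\<Union>k)"
    then show "\<Union>K \<subseteq> topspace X // r" by blast
    have "openin X (\<Union>(Union ` K))" using K by (intro openin_Union) blast
    moreover have "\<Union>(\<Union>K) = \<Union>(Union ` K)" by blast
    ultimately show "openin X (\<Union>(\<Union>K))" by simp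
  qed
  then show ?thesis unfolding quotient_topology_def by simp
qed

text \<open>
  The classifying space is the geometric realization of the nerve, that is, the quotient of
  the disjoint union of all \<open>\<Delta>\<^sup>n \<times> {\<sigma>}\<close> by \<open>(\<alpha>\<^sup>* \<sigma>, t) \<sim> (\<sigma>, \<alpha>\<^sub>* t)\<close>
  for monotone \<open>\<alpha>\<close>. Its points are equivalence classes.
\<close>

definition classifying_space :: "('o, 'a, 'z) cat_scheme \<Rightarrow> ('o, 'a) simplices set topology" where
  "classifying_space C = quotient_topology (simplex_space C) (realization_rel C)"

definition classifying_map ::
  "('p, 'b, 'z) cat_scheme \<Rightarrow> ('o, 'a, 'p, 'b) fctr
     \<Rightarrow> ('o, 'a) simplices set \<Rightarrow> ('p, 'b) simplices set" where
  "classifying_map D F c =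
     realization_rel D `` ((\<lambda>((n, \<sigma>), t). ((n, comp_fctr (ord_cat n) F \<sigma>), t)) ` c)"

definition fixed_classifying_space ::
  "('g, 'o, 'a, 'z) gcat_scheme \<Rightarrow> 'g set \<Rightarrow> ('o, 'a) simplices set topology" where
  "fixed_classifying_space C H =
     subtopology (classifying_space C) {c. \<forall>h\<in>H. classifying_map C (gact C h) c = c}"


section \<open>Weak equivalences\<close>

definition cube :: "nat \<Rightarrow> (nat \<Rightarrow> real) topology" where
  "cube n = product_topology (\<lambda>_. top_of_set {0..1}) {..<n}"

definition cube_boundary :: "nat \<Rightarrow> (nat \<Rightarrow> real) set" where
  "cube_boundary n = {s \<in> topspace (cube n). \<exists>i<n. s i = 0 \<or> s i = 1}"

definition based_cubes :: "nat \<Rightarrow> 'p topology \<Rightarrow> 'p \<Rightarrow> ((nat \<Rightarrow> real) \<Rightarrow> 'p) set" where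
  "based_cubes n X x = {f. continuous_map (cube n) X f \<and> f ` cube_boundary n \<subseteq> {x}}"

definition based_homotopy_rel :: "nat \<Rightarrow> 'p topology \<Rightarrow> 'p \<Rightarrow> ((nat \<Rightarrow> real) \<Rightarrow> 'p) rel" where
  "based_homotopy_rel n X x =
     {(f, f'). f \<in> based_cubes n X x \<and> f' \<in> based_cubes n X x \<and>
        homotopic_with (\<lambda>h. h ` cube_boundary n \<subseteq> {x}) (cube n) X f f'}"

definition homotopy_group :: "nat \<Rightarrow> 'p topology \<Rightarrow> 'p \<Rightarrow> ((nat \<Rightarrow> real) \<Rightarrow> 'p) set set" where
  "homotopy_group n X x = based_cubes n X x // based_homotopy_rel n X x"

text \<open>
  The maps induced on homotopy groups are automatically homomorphisms, so that they are
  isomorphisms precisely if they are bijective; hence the group structure is not needed here.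
\<close>

definition weak_homotopy_equivalence :: "'p topology \<Rightarrow> 'q topology \<Rightarrow> ('p \<Rightarrow> 'q) \<Rightarrow> bool" where
  "weak_homotopy_equivalence X Y \<phi> \<longleftrightarrow>
     continuous_map X Y \<phi> \<and>
     bij_betw (\<lambda>c. \<Union>x\<in>c. path_component_of_set Y (\<phi> x))
       (path_components_of X) (path_components_of Y) \<and>
     (\<forall>x\<in>topspace X. \<forall>n\<ge>1.
        bij_betw (\<lambda>c. based_homotopy_rel n Y (\<phi> x) `` ((\<lambda>f. \<phi> \<circ> f) ` c))
          (homotopy_group n X x) (homotopy_group n Y (\<phi> x)))"

definition weak_G_equivalence ::
  "('g, 'x) monoid_scheme \<Rightarrow> ('g, 'o, 'a, 'y) gcat_scheme \<Rightarrow> ('g, 'p, 'b, 'z) gcat_scheme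
     \<Rightarrow> ('o, 'a, 'p, 'b) fctr \<Rightarrow> bool" where
  "weak_G_equivalence G C D F \<longleftrightarrow>
     equivariant_functor G C D F \<and>
     (\<forall>H. subgroup H G \<longrightarrow>
        weak_homotopy_equivalence (fixed_classifying_space C H) (fixed_classifying_space D H)
          (classifying_map D F))"


section \<open>Rings with group action, free modules and general linear groups\<close>

locale g_ring = group G for G :: "('g, 'x) monoid_scheme" (structure) +
  fixes act :: "'g \<Rightarrow> 'r::ring_1 \<Rightarrow> 'r"
  assumes act_bij: "g \<in> carrier G \<Longrightarrow> bij (act g)"
    and act_add: "g \<in> carrier G \<Longrightarrow> act g (r + s) = act g r + act g s"
    and act_times: "g \<in> carrier G \<Longrightarrow> act g (r * s) = act g r * act g s"
    and act_1: "g \<in> carrier G \<Longrightarrow> act g 1 = 1"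
    and act_one: "act \<one> r = r"
    and act_mult: "\<lbrakk>g \<in> carrier G; h \<in> carrier G\<rbrakk> \<Longrightarrow> act (g \<otimes> h) r = act g (act h r)"

text \<open>
  The module locales of the libraries need commutative scalars. Only the record type of
  HOL-Algebra is used, whose fields \<open>mult\<close> and \<open>one\<close> are meaningless for a module.
\<close>

locale left_module = abelian_group M for M :: "('r::ring_1, 'm) module" (structure) +
  assumes smult_closed: "m \<in> carrier M \<Longrightarrow> r \<odot> m \<in> carrier M"
    and smult_l_distr: "m \<in> carrier M \<Longrightarrow> (r + s) \<odot> m = r \<odot> m \<oplus> s \<odot> m"
    and smult_r_distr: "\<lbrakk>m \<in> carrier M; m' \<in> carrier M\<rbrakk> \<Longrightarrow> r \<odot> (m \<oplus> m') = r \<odot> m \<oplus> r \<odot> m'"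
    and smult_assoc: "m \<in> carrier M \<Longrightarrow> (r * s) \<odot> m = r \<odot> (s \<odot> m)"
    and smult_one: "m \<in> carrier M \<Longrightarrow> 1 \<odot> m = m"

definition is_basis :: "('r::ring_1, 'm) module \<Rightarrow> 'm set \<Rightarrow> bool" where
  "is_basis M B \<longleftrightarrow> finite B \<and> B \<subseteq> carrier M \<and>
     (\<forall>m\<in>carrier M. \<exists>!c. c \<in> B \<rightarrow>\<^sub>E UNIV \<and> m = (\<Oplus>\<^bsub>M\<^esub>b\<in>B. c b \<odot>\<^bsub>M\<^esub> b))"

text \<open>
  The record \<open>M\<close> with all its irrelevant parts set to \<open>undefined\<close>. Records fixed by this
  operation are determined by the module they represent.
\<close>

definition strip_module :: "('r, 'm) module \<Rightarrow> ('r, 'm) module" where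
  "strip_module M =
     \<lparr>carrier = carrier M, mult = undefined, one = undefined, zero = \<zero>\<^bsub>M\<^esub>,
      add = \<lambda>m\<in>carrier M. \<lambda>m'\<in>carrier M. m \<oplus>\<^bsub>M\<^esub> m',
      smult = \<lambda>r. \<lambda>m\<in>carrier M. r \<odot>\<^bsub>M\<^esub> m\<rparr>"

definition fg_free_modules :: "('r::ring_1, 'm) module set" where
  "fg_free_modules = {M. left_module M \<and> strip_module M = M \<and> (\<exists>B. is_basis M B)}"

definition module_isos :: "('r::ring_1, 'm) module \<Rightarrow> ('r, 'm) module \<Rightarrow> ('m \<Rightarrow> 'm) set" where
  "module_isos M N =
     {f \<in> extensional (carrier M). bij_betw f (carrier M) (carrier N) \<and>
        (\<forall>m\<in>carrier M. \<forall>m'\<in>carrier M. f (m \<oplus>\<^bsub>M\<^esub> m') = f m \<oplus>\<^bsub>N\<^esub> f m') \<and>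
        (\<forall>r. \<forall>m\<in>carrier M. f (r \<odot>\<^bsub>M\<^esub> m) = r \<odot>\<^bsub>N\<^esub> f m)}"

text \<open>
  The scalar \<open>r\<close> acts on \<open>g M\<close> as \<open>inv g\<close> applied to \<open>r\<close> does on \<open>M\<close>. The inverse is what
  makes this a left action; with \<open>g\<close> in its place, \<open>g (h M)\<close> would be \<open>(h g) M\<close>.
\<close>

definition twist_module ::
  "('g, 'x) monoid_scheme \<Rightarrow> ('g \<Rightarrow> 'r \<Rightarrow> 'r) \<Rightarrow> 'g \<Rightarrow> ('r, 'm) module \<Rightarrow> ('r, 'm) module" where
  "twist_module G act g M = M\<lparr>smult := \<lambda>r m. act (inv\<^bsub>G\<^esub> g) r \<odot>\<^bsub>M\<^esub> m\<rparr>"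

text \<open>
  A small model of the category of all finitely generated free modules and their isomorphisms:
  the modules whose elements are taken from the type \<open>'m\<close>. It contains free modules of every
  rank as soon as \<open>'m\<close> is large enough.
\<close>

definition isoF_gcat ::
  "('g, 'x) monoid_scheme \<Rightarrow> ('g \<Rightarrow> 'r::ring_1 \<Rightarrow> 'r)
     \<Rightarrow> ('g, ('r, 'm) module, ('r, 'm) module \<times> ('r, 'm) module \<times> ('m \<Rightarrow> 'm)) gcat" where
  "isoF_gcat G act =
     (let Ar = {(M, N, f). M \<in> fg_free_modules \<and> N \<in> fg_free_modules \<and> f \<in> module_isos M N}
      in \<lparr>Obj = fg_free_modules, Arr = Ar, Src = \<lambda>(M, _, _). M, Tgt = \<lambda>(_, N, _). N,
          Idt = \<lambda>M. (M, M, \<lambda>m\<in>carrier M. m),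
          Cmp = \<lambda>(_, P, f') (M, _, f). (M, P, \<lambda>m\<in>carrier M. f' (f m)),
          gact = \<lambda>g. \<lparr>omap = \<lambda>M\<in>fg_free_modules. twist_module G act g M,
                       amap = \<lambda>(M, N, f)\<in>Ar. (twist_module G act g M, twist_module G act g N, f)\<rparr>\<rparr>)"

text \<open>
  The object \<open>n\<close> stands for \<open>R\<^sup>n\<close>, and a matrix of size \<open>n\<close> is an arrow from \<open>n\<close> to \<open>n\<close>.
  The composite of \<open>A\<close> after \<open>B\<close> is the product \<open>A * B\<close> in the group \<open>GL\<^sub>n R\<close>. Matrices acting on
  rows from the right would give the opposite order; \<open>A \<mapsto> A\<^sup>-\<^sup>1\<close> is an equivariant isomorphism
  between the two versions.
\<close>

definition GL_gcat ::
  "('g \<Rightarrow> 'r::ring_1 \<Rightarrow> 'r) \<Rightarrow> ('g, nat, 'r mat) gcat" where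
  "GL_gcat act =
     \<lparr>Obj = UNIV, Arr = {A. invertible_mat A}, Src = dim_row, Tgt = dim_row,
      Idt = 1\<^sub>m, Cmp = (*),
      gact = \<lambda>g. \<lparr>omap = \<lambda>n. n, amap = \<lambda>A\<in>{A. invertible_mat A}. map_mat (act g) A\<rparr>\<rparr>"

text \<open>
  \<open>R\<^sup>m\<close> and \<open>R\<^sup>n\<close> are isomorphic only for \<open>m = n\<close>, where linear maps between them are
  written as matrices.
\<close>

definition invariant_basis_number :: "'r::ring_1 itself \<Rightarrow> bool" where
  "invariant_basis_number _ \<longleftrightarrow>
     (\<forall>m n. \<forall>A\<in>carrier_mat m n. \<forall>B\<in>carrier_mat n m.
        A * B = (1\<^sub>m m :: 'r mat) \<and> B * A = (1\<^sub>m n :: 'r mat) \<longrightarrow> m = n)"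

end

(*
  Scalars are twisted without changing the underlying group, so a basis of M is also a basis of
  gM, and bases can be chosen to depend only on the orbit of M. Writing isomorphisms as matrices
  is then a strictly equivariant functor Phi from iso F(R) to GL(R), which is fully faithful and
  surjective on objects. Composition with Phi is again fully faithful on Cat(G~, -), and it
  has an equivariant section on objects: P lifts to x |-> x . e(x^-1 . P x) for any section e of
  Phi on objects. Full faithfulness turns this into an equivariant functor S with F S = id and
  an equivariant natural isomorphism id => S F.

  On classifying spaces, S F is equivariantly homotopic to the identity, so that everything
  restricts to fixed points and no comparison of (BC)^H with B(C^H) is needed. A map with a
  section which is also a homotopy inverse is a weak equivalence; the change of base points is
  done on cubes with a collar.
*)
theory Submission
  imports Defs
begin

text \<open>The functor from modules to matrices has in general no equivariant section of its own.
  The group fixes every rank \<open>n\<close>, whereas a free module of positive rank with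
  \<open>gM = M\<close> forces \<open>act g\<close> to be the identity, as one sees on a basis
  element. Functors on \<open>translation_gcat G\<close> remove this obstacle: an object
  \<open>x\<close> of the indexing category is itself a group element, by which a chosen module can
  be twisted. On the topological side the difficulty is that the homotopy from the identity to
  \<open>S F\<close> moves base points, along paths whose images downstairs are loops that may be
  nonconstant. Free homotopies therefore have to be turned into based ones, which is what the collar
  provides room for. Matrices represent inverses of isomorphisms because left modules are written as
  rows, on which matrices act from the right; without the inverse the order of composition would be
  reversed.\<close>

section \<open>Equivalence relations\<close>

text \<open>The maps induced on homotopy groups have exactly this shape: a class goes to the
  saturation of its image. Bijectivity thus reduces to conditions on representatives:
  \<open>f\<close> preserves the relation, reflects it on \<open>A\<close>, and meets every
  class.\<close>

lemma bij_betw_quotient: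
  assumes r: "equiv A r" and r': "equiv B r'"
    and resp: "\<And>a b. (a, b) \<in> r \<Longrightarrow> (f a, f b) \<in> r'"
    and refl: "\<And>a b. \<lbrakk>a \<in> A; b \<in> A; (f a, f b) \<in> r'\<rbrakk> \<Longrightarrow> (a, b) \<in> r"
    and surj: "\<And>b. b \<in> B \<Longrightarrow> \<exists>a\<in>A. (f a, b) \<in> r'"
  shows "bij_betw (\<lambda>c. r' `` (f ` c)) (A // r) (B // r')"
proof -
  have img: "r' `` (f ` (r `` {a})) = r' `` {f a}" if "a \<in> A" for a
  proof
    show "r' `` (f ` (r `` {a})) \<subseteq> r' `` {f a}"
      using resp r' by (blast dest: equivE transD)
    have "(a, a) \<in> r" using r that by (meson equivE refl_onD)
    then show "r' `` {f a} \<subseteq> r' `` (f ` (r `` {a}))" by blast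
  qed
  have fB: "f a \<in> B" if "a \<in> A" for a
  proof -
    have "(a, a) \<in> r" using r that by (meson equivE refl_onD)
    then show ?thesis using resp equiv_class_eq_iff[OF r'] by blast
  qed
  show ?thesis
    unfolding bij_betw_def
  proof
    show "inj_on (\<lambda>c. r' `` (f ` c)) (A // r)"
    proof (rule inj_onI)
      fix c c' assume "c \<in> A // r" "c' \<in> A // r" and eq: "r' `` (f ` c) = r' `` (f ` c')"
      then obtain a a' where a: "a \<in> A" "c = r `` {a}" "a' \<in> A" "c' = r `` {a'}"
        by (auto elim!: quotientE)
      with eq img have "r' `` {f a} = r' `` {f a'}" by simp
      then have "(f a, f a') \<in> r'" using fB a r' by (meson eq_equiv_class)
      then show "c = c'" using a refl equiv_class_eq[OF r] by blast
    qed
    show "(\<lambda>c. r' `` (f ` c)) ` (A // r) = B // r'"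
    proof
      show "(\<lambda>c. r' `` (f ` c)) ` (A // r) \<subseteq> B // r'"
        using img fB by (auto elim!: quotientE intro!: quotientI)
      show "B // r' \<subseteq> (\<lambda>c. r' `` (f ` c)) ` (A // r)"
      proof
        fix c assume "c \<in> B // r'"
        then obtain b where b: "b \<in> B" "c = r' `` {b}" by (auto elim!: quotientE)
        obtain a where a: "a \<in> A" "(f a, b) \<in> r'" using surj b by blast
        then have "c = r' `` (f ` (r `` {a}))" using img b equiv_class_eq[OF r'] by auto
        then show "c \<in> (\<lambda>c. r' `` (f ` c)) ` (A // r)" using a by (auto intro: quotientI)
      qed
    qed
  qed
qed

section \<open>Cubes with a collar\<close>

abbreviation unit_interval :: "real topology" where
  "unit_interval \<equiv> top_of_set {0..1}"

text \<open>\<open>expand\<close> maps the concentric cube of half the size onto the whole cube, and everything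
  outside to the boundary; \<open>collar\<close> measures the distance to that inner cube.\<close>

definition expand :: "nat \<Rightarrow> (nat \<Rightarrow> real) \<Rightarrow> nat \<Rightarrow> real" where
  "expand n s = (\<lambda>i\<in>{..<n}. max 0 (min 1 (2 * s i - 1/2)))"

definition collar :: "nat \<Rightarrow> (nat \<Rightarrow> real) \<Rightarrow> real" where
  "collar n s = min 1 (\<Sum>i<n. max 0 (\<bar>4 * s i - 2\<bar> - 1))"

abbreviation cylinder :: "nat \<Rightarrow> (real \<times> (nat \<Rightarrow> real)) topology" where
  "cylinder n \<equiv> prod_topology unit_interval (cube n)"

text \<open>Change of base point along \<gamma>: the inner cube carries a shrunken copy of
  \<open>d\<close>, and \<gamma> runs across the collar, from \<open>\<gamma> 0\<close> at the inner
  cube to \<open>\<gamma> 1\<close> on the boundary.\<close>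

definition add_collar :: "nat \<Rightarrow> (real \<Rightarrow> 'p) \<Rightarrow> ((nat \<Rightarrow> real) \<Rightarrow> 'p) \<Rightarrow> (nat \<Rightarrow> real) \<Rightarrow> 'p" where
  "add_collar n \<gamma> d s = (if collar n s = 0 then d (expand n s) else \<gamma> (collar n s))"

lemma topspace_cube: "topspace (cube n) = {..<n} \<rightarrow>\<^sub>E {0..1}"
  by (simp add: cube_def)

lemma cube_boundary_subset: "b \<in> cube_boundary n \<Longrightarrow> b \<in> topspace (cube n)"
  by (simp add: cube_boundary_def)

lemma continuous_map_cube_component:
  assumes "i < n" shows "continuous_map (cube n) euclideanreal (\<lambda>s. s i)"
  using continuous_map_product_projection[of i "{..<n}" "\<lambda>_. unit_interval"] assms
  by (auto simp: cube_def continuous_map_in_subtopology)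

lemma continuous_map_into_cube:
  "continuous_map Z (cube n) f \<longleftrightarrow>
     (\<forall>z\<in>topspace Z. f z \<in> extensional {..<n}) \<and>
     (\<forall>i<n. continuous_map Z euclideanreal (\<lambda>z. f z i) \<and> (\<forall>z\<in>topspace Z. f z i \<in> {0..1}))"
  unfolding cube_def continuous_map_componentwise continuous_map_in_subtopology
  by (auto simp: Pi_iff)

lemma expand_in_cube: "expand n s \<in> topspace (cube n)"
  by (auto simp: topspace_cube expand_def)

lemma collar_range: "0 \<le> collar n s" "collar n s \<le> 1"
  by (auto simp: collar_def intro!: sum_nonneg)

lemma continuous_map_expand: "continuous_map (cube n) (cube n) (expand n)"
  unfolding continuous_map_into_cube
  by (auto simp: expand_def intro!: continuous_intros continuous_map_real_max
      continuous_map_real_min continuous_map_cube_component)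

lemma continuous_map_collar: "continuous_map (cube n) unit_interval (collar n)"
  unfolding continuous_map_in_subtopology
proof
  show "continuous_map (cube n) euclideanreal (collar n)"
    unfolding collar_def
    by (intro continuous_intros continuous_map_real_max continuous_map_real_min
      continuous_map_sum continuous_map_real_abs continuous_map_cube_component) auto
  show "collar n \<in> topspace (cube n) \<rightarrow> {0..1}" using collar_range by auto
qed

text \<open>The summands of \<open>collar\<close> are scaled so that a coordinate equal to 0 or 1
  contributes exactly 1, which is the cap of the sum. The clamp in \<open>expand\<close> fixes 0 and
  1.\<close>

lemma expand_boundary:
  assumes "b \<in> cube_boundary n" shows "expand n b \<in> cube_boundary n" "collar n b = 1"
proof -
  from assms obtain i where i: "i < n" "b i = 0 \<or> b i = 1" by (auto simp: cube_boundary_def)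
  then have "expand n b i = 0 \<or> expand n b i = 1" by (auto simp: expand_def)
  then show "expand n b \<in> cube_boundary n"
    using i expand_in_cube by (auto simp: cube_boundary_def)
  have "1 \<le> max 0 (\<bar>4 * b i - 2\<bar> - 1)" using i by auto
  also have "\<dots> \<le> (\<Sum>i<n. max 0 (\<bar>4 * b i - 2\<bar> - 1))"
    using i by (intro member_le_sum) auto
  finally show "collar n b = 1" by (simp add: collar_def)
qed

text \<open>A nonzero summand means that some coordinate lies outside the interval from 1/4 to 3/4,
  and there the clamp in \<open>expand\<close> takes the value 0 or 1.\<close>

lemma expand_outside:
  assumes "collar n s \<noteq> 0" shows "expand n s \<in> cube_boundary n"
proof -
  have "(\<Sum>i<n. max 0 (\<bar>4 * s i - 2\<bar> - 1)) \<noteq> 0" using assms by (auto simp: collar_def)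
  then obtain i where i: "i < n" "max 0 (\<bar>4 * s i - 2\<bar> - 1) \<noteq> 0"
    by (metis (no_types, lifting) lessThan_iff sum.neutral)
  then have "expand n s i = 0 \<or> expand n s i = 1" by (auto simp: expand_def)
  then show ?thesis using i expand_in_cube by (auto simp: cube_boundary_def)
qed

lemma closedin_cube_boundary: "closedin (cube n) (cube_boundary n)"
proof -
  have "cube_boundary n = (\<Union>i<n. {s \<in> topspace (cube n). s i \<in> {0, 1}})"
    by (auto simp: cube_boundary_def)
  moreover have "closedin (cube n) {s \<in> topspace (cube n). s i \<in> {0, 1}}" if "i < n" for i
    using continuous_map_cube_component[OF that]
    by (rule closedin_continuous_map_preimage) auto
  ultimately show ?thesis by (auto intro!: closedin_Union)
qed

text \<open>The parameter space \<open>Z\<close> covers both a homotopy of cubes with a fixed path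
  and a fixed cube with a growing path.\<close>

lemma continuous_map_add_collar:
  assumes K: "continuous_map (prod_topology Z (cube n)) X (\<lambda>(z, s). K z s)"
    and \<delta>: "continuous_map (prod_topology Z unit_interval) X (\<lambda>(z, v). \<delta> z v)"
    and eq: "\<And>z b. \<lbrakk>z \<in> topspace Z; b \<in> cube_boundary n\<rbrakk> \<Longrightarrow> K z b = \<delta> z 0"
  shows "continuous_map (prod_topology Z (cube n)) X (\<lambda>(z, s). add_collar n (\<delta> z) (K z) s)"
proof -
  let ?P = "prod_topology Z (cube n)"
  \<comment> \<open>Two closed pieces: the inner cube, where the collar vanishes, and the preimage
    of the boundary under \<open>expand\<close>. They cover everything by
    \<open>expand_outside\<close>; on the overlap the path is at its start and \<open>eq\<close>
    gives agreement.\<close>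
  define T where "T b = (if b then {p \<in> topspace ?P. collar n (snd p) \<in> {0}}
      else {p \<in> topspace ?P. expand n (snd p) \<in> cube_boundary n})" for b
  define f where "f b = (if b then (\<lambda>(z, s). K z (expand n s)) else (\<lambda>(z, s). \<delta> z (collar n s)))" for b
  have e: "continuous_map ?P (cube n) (\<lambda>p. expand n (snd p))"
    using continuous_map_compose[OF continuous_map_snd continuous_map_expand] by (simp add: o_def)
  have v: "continuous_map ?P unit_interval (\<lambda>p. collar n (snd p))"
    using continuous_map_compose[OF continuous_map_snd continuous_map_collar] by (simp add: o_def)
  show ?thesis
  proof (rule pasting_lemma_closed[where I = UNIV and T = T and f = f])
    show "closedin ?P (T b)" for b
      using closedin_continuous_map_preimage[OF v, of "{0}"]
        closedin_continuous_map_preimage[OF e closedin_cube_boundary]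
      by (auto simp: T_def)
    have "continuous_map ?P (prod_topology Z (cube n)) (\<lambda>p. (fst p, expand n (snd p)))"
      using e by (intro continuous_map_pairedI continuous_map_fst)
    from continuous_map_compose[OF this K]
    have 1: "continuous_map ?P X (f True)" by (simp add: f_def o_def split_def)
    have "continuous_map ?P (prod_topology Z unit_interval) (\<lambda>p. (fst p, collar n (snd p)))"
      using v by (intro continuous_map_pairedI continuous_map_fst)
    from continuous_map_compose[OF this \<delta>]
    have 2: "continuous_map ?P X (f False)" by (simp add: f_def o_def split_def)
    from 1 2 show "continuous_map (subtopology ?P (T b)) X (f b)" for b
      by (cases b) (auto intro: continuous_map_from_subtopology)
    have "f True p = f False p" if "p \<in> topspace ?P \<inter> T True \<inter> T False" for p
      using that eq by (auto simp: T_def f_def split_def)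
    then show "f b p = f c p" if "p \<in> topspace ?P \<inter> T b \<inter> T c" for b c p
      using that by (cases b; cases c) auto
    show "\<exists>j. j \<in> UNIV \<and> p \<in> T j \<and> (\<lambda>(z, s). add_collar n (\<delta> z) (K z) s) p = f j p"
      if "p \<in> topspace ?P" for p
    proof (cases "collar n (snd p) = 0")
      case True
      then show ?thesis using that
        by (intro exI[of _ True]) (auto simp: T_def f_def add_collar_def split: prod.splits)
    next
      case False
      then show ?thesis using that expand_outside[OF False]
        by (intro exI[of _ False]) (auto simp: T_def f_def add_collar_def split: prod.splits)
    qed
  qed auto
qed

section \<open>Change of base point in homotopy groups\<close>

text \<open>The end conditions are imposed on the cube only, since a map out of
  \<open>cube n\<close> is arbitrary elsewhere as a HOL function.\<close>

lemma based_homotopy_relI: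
  assumes L: "continuous_map (cylinder n) X (\<lambda>(t, s). L t s)"
    and b: "\<And>t b. \<lbrakk>t \<in> {0..1}; b \<in> cube_boundary n\<rbrakk> \<Longrightarrow> L t b = x"
    and "\<And>s. s \<in> topspace (cube n) \<Longrightarrow> f s = L 0 s"
    and "\<And>s. s \<in> topspace (cube n) \<Longrightarrow> g s = L 1 s"
  shows "(f, g) \<in> based_homotopy_rel n X x"
proof -
  have "homotopic_with (\<lambda>h. h ` cube_boundary n \<subseteq> {x}) (cube n) X f g"
  proof (subst homotopic_with)
    show "(h ` cube_boundary n \<subseteq> {x}) = (k ` cube_boundary n \<subseteq> {x})"
      if "\<And>s. s \<in> topspace (cube n) \<Longrightarrow> h s = k s" for h k
      using that cube_boundary_subset by (metis (no_types, lifting) image_cong)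
    show "\<exists>h. continuous_map (cylinder n) X h \<and>
        (\<forall>s\<in>topspace (cube n). h (0, s) = f s) \<and> (\<forall>s\<in>topspace (cube n). h (1, s) = g s) \<and>
        (\<forall>t\<in>{0..1}. (\<lambda>s. h (t, s)) ` cube_boundary n \<subseteq> {x})"
      using assms by (intro exI[of _ "\<lambda>(t, s). L t s"]) auto
  qed
  then show ?thesis
    using homotopic_with_imp_continuous_maps[of _ "cube n" X f g]
      homotopic_with_imp_property[of _ "cube n" X f g]
    by (simp add: based_homotopy_rel_def based_cubes_def)
qed

lemma based_homotopy_relE:
  assumes "(f, g) \<in> based_homotopy_rel n X x"
  obtains L where "continuous_map (cylinder n) X (\<lambda>(t, s). L t s)"
    "\<And>t b. \<lbrakk>t \<in> {0..1}; b \<in> cube_boundary n\<rbrakk> \<Longrightarrow> L t b = x" "L 0 = f" "L 1 = g"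
proof -
  from assms obtain h where h: "continuous_map (cylinder n) X h"
    "\<And>s. h (0, s) = f s" "\<And>s. h (1, s) = g s"
    "\<And>t. t \<in> {0..1} \<Longrightarrow> (\<lambda>s. h (t, s)) ` cube_boundary n \<subseteq> {x}"
    by (auto simp: based_homotopy_rel_def homotopic_with_def)
  show ?thesis
    using h by (intro that[of "\<lambda>t s. h (t, s)"]) (auto simp: image_subset_iff)
qed

lemma equiv_based_homotopy_rel:
  "equiv (based_cubes n X x) (based_homotopy_rel n X x)"
  unfolding equiv_def
proof (intro conjI)
  show "refl_on (based_cubes n X x) (based_homotopy_rel n X x)"
    by (auto simp: refl_on_def based_homotopy_rel_def based_cubes_def)
  show "sym (based_homotopy_rel n X x)"
    by (auto simp: sym_def based_homotopy_rel_def homotopic_with_sym)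
  show "trans (based_homotopy_rel n X x)"
    by (auto simp: trans_def based_homotopy_rel_def intro: homotopic_with_trans)
qed (auto simp: based_homotopy_rel_def)

lemma based_homotopy_trans:
  "\<lbrakk>(f, g) \<in> based_homotopy_rel n X x; (g, h) \<in> based_homotopy_rel n X x\<rbrakk>
     \<Longrightarrow> (f, h) \<in> based_homotopy_rel n X x"
  using equiv_based_homotopy_rel by (meson equivE transD)

lemma based_homotopy_sym:
  "(f, g) \<in> based_homotopy_rel n X x \<Longrightarrow> (g, f) \<in> based_homotopy_rel n X x"
  using equiv_based_homotopy_rel by (meson equivE symD)

lemma based_homotopy_cubes:
  "(f, g) \<in> based_homotopy_rel n X x \<Longrightarrow> f \<in> based_cubes n X x \<and> g \<in> based_cubes n X x"
  by (simp add: based_homotopy_rel_def)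

lemma based_homotopy_refl: "f \<in> based_cubes n X x \<Longrightarrow> (f, f) \<in> based_homotopy_rel n X x"
  by (simp add: based_homotopy_rel_def based_cubes_def)

lemma based_homotopy_compose:
  assumes "(f, g) \<in> based_homotopy_rel n X x" "continuous_map X Y \<phi>"
  shows "(\<phi> \<circ> f, \<phi> \<circ> g) \<in> based_homotopy_rel n Y (\<phi> x)"
proof (rule based_homotopy_relE[OF assms(1)])
  fix L assume L: "continuous_map (cylinder n) X (\<lambda>(t, s). L t s)"
    "\<And>t b. \<lbrakk>t \<in> {0..1}; b \<in> cube_boundary n\<rbrakk> \<Longrightarrow> L t b = x" "L 0 = f" "L 1 = g"
  show ?thesis
    by (rule based_homotopy_relI[where L = "\<lambda>t s. \<phi> (L t s)"])
      (use continuous_map_compose[OF L(1) assms(2)] L in \<open>auto simp: o_def split_def\<close>)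
qed

text \<open>The straight-line homotopy from the identity to \<open>expand n\<close> stays in the
  cube by convexity. Coordinates 0 and 1 are fixed by \<open>expand\<close>, so every boundary point
  stays in a face containing it, where \<open>f\<close> is constant.\<close>

lemma based_homotopy_expand:
  assumes "f \<in> based_cubes n X x"
  shows "(f, \<lambda>s. f (expand n s)) \<in> based_homotopy_rel n X x"
proof -
  define e where "e t s = (\<lambda>i\<in>{..<n}. (1 - t) * s i + t * expand n s i)" for t s
  have f: "continuous_map (cube n) X f" and fb: "\<And>b. b \<in> cube_boundary n \<Longrightarrow> f b = x"
    using assms by (auto simp: based_cubes_def)
  have in01: "(1 - t) * a + t * b \<in> {0..1}" if "t \<in> {0..1}" "a \<in> {0..1}" "b \<in> {0..1}" for t a b :: real
    using that convex_bound_le[of a 1 b "1 - t" t] by auto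
  have c: "continuous_map (cylinder n) euclideanreal (\<lambda>p. snd p i)"
    "continuous_map (cylinder n) euclideanreal (\<lambda>p. expand n (snd p) i)"
    if "i < n" for i
    using continuous_map_compose[OF continuous_map_snd continuous_map_cube_component[OF that]]
      continuous_map_compose[OF continuous_map_snd
        continuous_map_compose[OF continuous_map_expand continuous_map_cube_component[OF that]]]
    by (auto simp: o_def)
  have t: "continuous_map (cylinder n) euclideanreal fst"
    by (metis continuous_map_fst continuous_map_in_subtopology)
  have e: "continuous_map (cylinder n) (cube n) (\<lambda>(t, s). e t s)"
    unfolding continuous_map_into_cube
  proof (intro conjI ballI allI impI)
    fix p i assume "p \<in> topspace (cylinder n)" "i < n"
    then show "(case p of (t, s) \<Rightarrow> e t s) i \<in> {0..1}"
      using expand_in_cube[of n "snd p"]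
      by (auto simp: e_def topspace_cube split_def PiE_iff intro!: in01 simp del: atLeastAtMost_iff)
  next
    fix i assume "i < n"
    then show "continuous_map (cylinder n) euclideanreal
        (\<lambda>p. (case p of (t, s) \<Rightarrow> e t s) i)"
      using c t by (auto simp: e_def split_def intro!: continuous_intros)
  qed (auto simp: e_def)
  show ?thesis
  proof (rule based_homotopy_relI[where L = "\<lambda>t s. f (e t s)"])
    show "continuous_map (cylinder n) X (\<lambda>(t, s). f (e t s))"
      using continuous_map_compose[OF e f] by (simp add: o_def split_def)
    fix t :: real and b assume t: "t \<in> {0..1}" and b: "b \<in> cube_boundary n"
    then obtain i where i: "i < n" "b i = 0 \<or> b i = 1" by (auto simp: cube_boundary_def)
    then have "e t b i = 0 \<or> e t b i = 1" by (auto simp: e_def expand_def)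
    moreover have "(\<lambda>(t, s). e t s) (t, b) \<in> topspace (cube n)"
      by (rule subsetD[OF continuous_map_image_subset_topspace[OF e]], rule imageI)
        (use t cube_boundary_subset[OF b] in auto)
    ultimately have "e t b \<in> cube_boundary n" using i by (auto simp: cube_boundary_def)
    then show "f (e t b) = x" by (rule fb)
  next
    fix s assume s: "s \<in> topspace (cube n)"
    have "e 0 s = s" using s by (auto simp: e_def topspace_cube PiE_iff extensional_def)
    then show "f s = f (e 0 s)" by simp
    have "e 1 s = expand n s" by (auto simp: e_def expand_def)
    then show "f (expand n s) = f (e 1 s)" by simp
  qed
qed

text \<open>A free homotopy that carries the whole boundary along \<gamma> becomes a based one once
  a collar undoes this motion: \<open>H 0\<close> is \<open>H 1\<close> transported back along the
  reverse of \<gamma>.\<close>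

lemma free_homotopy_imp_add_collar:
  assumes H: "continuous_map (cylinder n) X (\<lambda>(t, s). H t s)"
    and \<gamma>: "\<And>t b. \<lbrakk>t \<in> {0..1}; b \<in> cube_boundary n\<rbrakk> \<Longrightarrow> H t b = \<gamma> t"
  shows "(H 0, add_collar n (\<lambda>v. \<gamma> (1 - v)) (H 1)) \<in> based_homotopy_rel n X (\<gamma> 0)"
proof -
  have "continuous_map (cube n) (cylinder n) (\<lambda>s. (0, s))"
    by (intro continuous_map_pairedI) auto
  from continuous_map_compose[OF this H] have "H 0 \<in> based_cubes n X (\<gamma> 0)"
    using \<gamma> by (auto simp: based_cubes_def o_def)
  then have 1: "(H 0, \<lambda>s. H 0 (expand n s)) \<in> based_homotopy_rel n X (\<gamma> 0)"
    by (rule based_homotopy_expand)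
  let ?P = "cylinder n"
  have v: "continuous_map ?P unit_interval (\<lambda>p. collar n (snd p))"
    using continuous_map_compose[OF continuous_map_snd continuous_map_collar] by (simp add: o_def)
  \<comment> \<open>Time is slowed down across the collar: it is \<open>t\<close> on the inner cube
    and 0 on the boundary, which keeps the boundary at \<open>\<gamma> 0\<close>. At
    \<open>t = 1\<close> the collar runs through \<open>\<gamma> (1 - v)\<close>, as
    required.\<close>
  have "continuous_map ?P unit_interval (\<lambda>p. fst p * (1 - collar n (snd p)))"
    unfolding continuous_map_in_subtopology
  proof
    show "continuous_map ?P euclideanreal (\<lambda>p. fst p * (1 - collar n (snd p)))"
      using v continuous_map_fst[of unit_interval "cube n"] unfolding continuous_map_in_subtopology
      by (intro continuous_intros continuous_map_real_mult) auto
    show "(\<lambda>p. fst p * (1 - collar n (snd p))) \<in> topspace ?P \<rightarrow> {0..1}"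
      by (auto simp: collar_range mult_le_one)
  qed
  then have "continuous_map ?P ?P (\<lambda>p. (fst p * (1 - collar n (snd p)), expand n (snd p)))"
    using continuous_map_compose[OF continuous_map_snd continuous_map_expand]
    by (intro continuous_map_pairedI) (auto simp: o_def)
  from continuous_map_compose[OF this H]
  have c: "continuous_map ?P X (\<lambda>(t, s). H (t * (1 - collar n s)) (expand n s))"
    by (simp add: o_def split_def)
  have 2: "(\<lambda>s. H 0 (expand n s), add_collar n (\<lambda>v. \<gamma> (1 - v)) (H 1)) \<in> based_homotopy_rel n X (\<gamma> 0)"
  proof (rule based_homotopy_relI[OF c])
    show "H (t * (1 - collar n b)) (expand n b) = \<gamma> 0" if "b \<in> cube_boundary n" for t b
      using expand_boundary[OF that] \<gamma> by simp
    show "add_collar n (\<lambda>v. \<gamma> (1 - v)) (H 1) s = H (1 * (1 - collar n s)) (expand n s)" for s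
      using \<gamma>[OF _ expand_outside] collar_range[of n s] by (simp add: add_collar_def)
  qed auto
  from 1 2 show ?thesis by (rule based_homotopy_trans)
qed

text \<open>Transport along a path passes to based homotopy classes: the collar is held fixed while
  the inner cube is deformed.\<close>

lemma add_collar_based_homotopy:
  assumes K: "(d, d') \<in> based_homotopy_rel n X (\<gamma> 0)" and \<gamma>: "continuous_map unit_interval X \<gamma>"
  shows "(add_collar n \<gamma> d, add_collar n \<gamma> d') \<in> based_homotopy_rel n X (\<gamma> 1)"
proof (rule based_homotopy_relE[OF K])
  fix L assume L: "continuous_map (cylinder n) X (\<lambda>(t, s). L t s)"
    "\<And>t b. \<lbrakk>t \<in> {0..1}; b \<in> cube_boundary n\<rbrakk> \<Longrightarrow> L t b = \<gamma> 0" "L 0 = d" "L 1 = d'"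
  have "continuous_map (prod_topology unit_interval unit_interval) X (\<lambda>(t, v). \<gamma> v)"
    using continuous_map_compose[OF continuous_map_snd \<gamma>] by (simp only: o_def split_def)
  from continuous_map_add_collar[OF L(1) this] L(2)
  have "continuous_map (cylinder n) X (\<lambda>(t, s). add_collar n \<gamma> (L t) s)"
    by simp
  then show ?thesis
    by (rule based_homotopy_relI) (use L expand_boundary in \<open>auto simp: add_collar_def\<close>)
qed

text \<open>Transport is surjective up to based homotopy. The cube \<open>d'\<close> is
  \<open>d\<close> transported along \<delta>, and the homotopy that extends \<delta> from the
  boundary shows that transporting back recovers \<open>d\<close>.\<close>

lemma exists_add_collar:
  assumes d: "d \<in> based_cubes n X (\<delta> 0)" and \<delta>: "continuous_map unit_interval X \<delta>"
  shows "\<exists>d'\<in>based_cubes n X (\<delta> 1). (d, add_collar n (\<lambda>v. \<delta> (1 - v)) d') \<in> based_homotopy_rel n X (\<delta> 0)"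
proof -
  \<comment> \<open>At time \<open>t\<close> the collar contains only the part of \<delta> from 0 to
    \<open>t\<close>, so the boundary of \<open>H t\<close> sits at \<open>\<delta> t\<close>. At
    time 0 this is \<open>d\<close> inside a constant collar.\<close>
  define H where "H t = add_collar n (\<lambda>v. \<delta> (t * v)) d" for t
  have dc: "continuous_map (cube n) X d" and db: "\<And>b. b \<in> cube_boundary n \<Longrightarrow> d b = \<delta> 0"
    using d by (auto simp: based_cubes_def)
  have m: "continuous_map (prod_topology unit_interval unit_interval) unit_interval (\<lambda>p. fst p * snd p)"
    unfolding continuous_map_in_subtopology
  proof
    show "continuous_map (prod_topology unit_interval unit_interval) euclideanreal (\<lambda>p. fst p * snd p)"
      using continuous_map_fst[of unit_interval unit_interval] continuous_map_snd[of unit_interval unit_interval]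
      unfolding continuous_map_in_subtopology by (intro continuous_map_real_mult) auto
  qed (auto intro: mult_le_one)
  have H: "continuous_map (cylinder n) X (\<lambda>(t, s). H t s)"
    unfolding H_def
  proof (rule continuous_map_add_collar)
    show "continuous_map (cylinder n) X (\<lambda>(t, s). d s)"
      using continuous_map_compose[OF continuous_map_snd dc] by (simp add: o_def split_def)
    show "continuous_map (prod_topology unit_interval unit_interval) X (\<lambda>(t, v). \<delta> (t * v))"
      using continuous_map_compose[OF m \<delta>] by (simp add: o_def split_def)
  qed (use db in auto)
  have Hb: "H t b = \<delta> t" if "b \<in> cube_boundary n" for t b
    using expand_boundary[OF that] by (simp add: H_def add_collar_def)
  have "H 0 = (\<lambda>s. d (expand n s))"
    using db[OF expand_outside] by (fastforce simp: H_def add_collar_def)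
  then have "(d, H 0) \<in> based_homotopy_rel n X (\<delta> 0)"
    using based_homotopy_expand[OF d] by simp
  moreover have "(H 0, add_collar n (\<lambda>v. \<delta> (1 - v)) (H 1)) \<in> based_homotopy_rel n X (\<delta> 0)"
    using free_homotopy_imp_add_collar[OF H] Hb by blast
  ultimately have 1: "(d, add_collar n (\<lambda>v. \<delta> (1 - v)) (H 1)) \<in> based_homotopy_rel n X (\<delta> 0)"
    by (rule based_homotopy_trans)
  have "continuous_map (cube n) (cylinder n) (\<lambda>s. (1, s))"
    by (intro continuous_map_pairedI) auto
  from continuous_map_compose[OF this H] have "H 1 \<in> based_cubes n X (\<delta> 1)"
    using Hb by (auto simp: based_cubes_def o_def)
  with 1 show ?thesis by blast
qed

text \<open>Since \<open>f\<close> after \<open>s\<close> is the identity on the nose, one homotopy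
  on \<open>X\<close> suffices. It moves base points, so bijectivity on homotopy groups is obtained
  by transport along the traces of points under \<open>h\<close>.\<close>

lemma weak_homotopy_equivalence_of_section:
  assumes f: "continuous_map X Y f" and s: "continuous_map Y X s"
    and fs: "\<And>y. y \<in> topspace Y \<Longrightarrow> f (s y) = y"
    and h: "continuous_map (prod_topology unit_interval X) X (\<lambda>(t, x). h t x)"
    and h0: "\<And>x. x \<in> topspace X \<Longrightarrow> h 0 x = x" and h1: "\<And>x. x \<in> topspace X \<Longrightarrow> h 1 x = s (f x)"
  shows "weak_homotopy_equivalence X Y f"
  unfolding weak_homotopy_equivalence_def
proof (intro conjI ballI allI impI)
  have path: "continuous_map unit_interval X (\<lambda>t. h t x)" if "x \<in> topspace X" for x
  proof -
    have "continuous_map unit_interval (prod_topology unit_interval X) (\<lambda>t. (t, x))"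
      using that by (intro continuous_map_pairedI) auto
    from continuous_map_compose[OF this h] show ?thesis by (simp add: o_def)
  qed
  have fX: "f x \<in> topspace Y" if "x \<in> topspace X" for x
    using continuous_map_image_subset_topspace[OF f] that by blast
  have sY: "s y \<in> topspace X" if "y \<in> topspace Y" for y
    using continuous_map_image_subset_topspace[OF s] that by blast
  show "continuous_map X Y f" by fact
  show "bij_betw (\<lambda>c. \<Union>x\<in>c. path_component_of_set Y (f x)) (path_components_of X) (path_components_of Y)"
  proof -
    have pc: "path_component_of Y' (\<phi> x) (\<phi> x')"
      if "path_component_of X' x x'" "continuous_map X' Y' \<phi>" for X' Y' \<phi> x x'
      using that unfolding path_component_of_def pathin_def
      by (metis comp_apply continuous_map_compose)
    have eq: "(\<Union>x\<in>path_component_of_set X a. path_component_of_set Y (f x)) = path_component_of_set Y (f a)"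
      if "a \<in> topspace X" for a
    proof
      show "(\<Union>x\<in>path_component_of_set X a. path_component_of_set Y (f x)) \<subseteq> path_component_of_set Y (f a)"
        using pc[OF _ f] path_component_of_trans by fastforce
      have "a \<in> path_component_of_set X a" using that by (simp add: path_component_of_refl)
      then show "path_component_of_set Y (f a) \<subseteq> (\<Union>x\<in>path_component_of_set X a. path_component_of_set Y (f x))"
        by (rule UN_upper)
    qed
    have sf: "path_component_of X (s (f x)) x" if "x \<in> topspace X" for x
      using path[OF that] h0[OF that] h1[OF that] path_component_of_sym
      unfolding path_component_of_def pathin_def by metis
    show ?thesis
      unfolding bij_betw_def path_components_of_def
    proof
      show "inj_on (\<lambda>c. \<Union>x\<in>c. path_component_of_set Y (f x)) (path_component_of_set X ` topspace X)"
      proof (clarsimp simp: inj_on_def eq)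
        fix a b assume ab: "a \<in> topspace X" "b \<in> topspace X"
          and "path_component_of_set Y (f a) = path_component_of_set Y (f b)"
        then have "path_component_of Y (f a) (f b)"
          using fX path_component_of_refl by (metis mem_Collect_eq)
        from pc[OF this s] have "path_component_of X a b"
          using sf[OF ab(1)] sf[OF ab(2)] path_component_of_sym path_component_of_trans by metis
        from this[THEN iffD1[OF path_component_of_equiv]]
        show "path_component_of_set X a = path_component_of_set X b" by argo
      qed
      show "(\<lambda>c. \<Union>x\<in>c. path_component_of_set Y (f x)) ` path_component_of_set X ` topspace X
          = path_component_of_set Y ` topspace Y"
      proof -
        have "topspace Y = f ` topspace X" using fX fs sY by force
        then show ?thesis using eq by (simp add: image_image)
      qed
    qed
  qed
  fix x :: 'a and n :: nat assume x: "x \<in> topspace X"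
  show "bij_betw (\<lambda>c. based_homotopy_rel n Y (f x) `` (\<lambda>g. f \<circ> g) ` c)
      (homotopy_group n X x) (homotopy_group n Y (f x))"
    unfolding homotopy_group_def
  proof (rule bij_betw_quotient[OF equiv_based_homotopy_rel equiv_based_homotopy_rel])
    show "(f \<circ> a, f \<circ> b) \<in> based_homotopy_rel n Y (f x)" if "(a, b) \<in> based_homotopy_rel n X x" for a b
      using based_homotopy_compose[OF that f] .
    \<comment> \<open>The trace of \<open>x\<close> under \<open>h\<close>, reversed: a path from
      \<open>s (f x)\<close> back to \<open>x\<close>.\<close>
    let ?\<gamma> = "\<lambda>v. h (1 - v) x"
    have "continuous_map unit_interval unit_interval (\<lambda>v::real. 1 - v)"
      unfolding continuous_map_in_subtopology
      by (auto intro!: continuous_intros)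
    from continuous_map_compose[OF this path[OF x]]
    have \<gamma>: "continuous_map unit_interval X ?\<gamma>" by (simp add: o_def)
    \<comment> \<open>The maps \<open>h t \<circ> a\<close> form a free homotopy whose boundary
      follows the trace of \<open>x\<close>. Hence \<open>a\<close> is recovered from
      \<open>f \<circ> a\<close> by applying \<open>s\<close> and transporting back to
      \<open>x\<close>.\<close>
    have key: "(a, add_collar n ?\<gamma> (s \<circ> (f \<circ> a))) \<in> based_homotopy_rel n X x"
      if a: "a \<in> based_cubes n X x" for a
    proof -
      have ac: "continuous_map (cube n) X a" using a by (simp add: based_cubes_def)
      have aX: "a u \<in> topspace X" if "u \<in> topspace (cube n)" for u
        using continuous_map_image_subset_topspace[OF ac] that by blast
      have "continuous_map (cylinder n) (prod_topology unit_interval X)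
          (\<lambda>p. (fst p, a (snd p)))"
        using continuous_map_compose[OF continuous_map_snd ac]
        by (intro continuous_map_pairedI continuous_map_fst) (simp add: o_def)
      from continuous_map_compose[OF this h]
      have "continuous_map (cylinder n) X (\<lambda>(t, u). h t (a u))"
        by (simp add: o_def split_def)
      then have "(\<lambda>u. h 0 (a u), add_collar n ?\<gamma> (\<lambda>u. h 1 (a u))) \<in> based_homotopy_rel n X (h 0 x)"
        using a by (intro free_homotopy_imp_add_collar) (auto simp: based_cubes_def)
      moreover have "add_collar n ?\<gamma> (\<lambda>u. h 1 (a u)) = add_collar n ?\<gamma> (s \<circ> (f \<circ> a))"
        using h1[OF aX[OF expand_in_cube]] by (auto simp: add_collar_def)
      ultimately have 1: "(\<lambda>u. h 0 (a u), add_collar n ?\<gamma> (s \<circ> (f \<circ> a))) \<in> based_homotopy_rel n X x"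
        using h0[OF x] by simp
      \<comment> \<open>\<open>h 0\<close> is known to be the identity only on
        \<open>topspace X\<close>, so \<open>a\<close> and \<open>h 0 \<circ> a\<close> may differ
        off the cube; a constant homotopy identifies their classes.\<close>
      have "continuous_map (cylinder n) X (\<lambda>(t, u). a u)"
        using continuous_map_compose[OF continuous_map_snd ac] by (simp add: o_def split_def)
      then have "(a, \<lambda>u. h 0 (a u)) \<in> based_homotopy_rel n X x"
        by (rule based_homotopy_relI) (use a h0 aX in \<open>auto simp: based_cubes_def\<close>)
      from this 1 show ?thesis by (rule based_homotopy_trans)
    qed
    show "(a, b) \<in> based_homotopy_rel n X x"
      if a: "a \<in> based_cubes n X x" and b: "b \<in> based_cubes n X x"
        and ab: "(f \<circ> a, f \<circ> b) \<in> based_homotopy_rel n Y (f x)" for a b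
    proof -
      have "(s \<circ> (f \<circ> a), s \<circ> (f \<circ> b)) \<in> based_homotopy_rel n X (?\<gamma> 0)"
        using based_homotopy_compose[OF ab s] h1[OF x] by simp
      from add_collar_based_homotopy[OF this \<gamma>]
      have "(add_collar n ?\<gamma> (s \<circ> (f \<circ> a)), add_collar n ?\<gamma> (s \<circ> (f \<circ> b))) \<in> based_homotopy_rel n X x"
        using h0[OF x] by simp
      then show ?thesis
        using key[OF a] key[OF b] based_homotopy_trans based_homotopy_sym by metis
    qed
    show "\<exists>a\<in>based_cubes n X x. (f \<circ> a, d) \<in> based_homotopy_rel n Y (f x)"
      if d: "d \<in> based_cubes n Y (f x)" for d
    proof -
      \<comment> \<open>\<open>f\<close> turns the trace of \<open>x\<close> into a loop at
        \<open>f x\<close>. The class of \<open>d\<close> is first moved back along this loop, which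
        gives \<open>d'\<close>; lifting \<open>d'\<close> by \<open>s\<close> and transporting to
        \<open>x\<close> then maps to the class of \<open>d\<close>.\<close>
      have \<delta>: "continuous_map unit_interval Y (\<lambda>t. f (h t x))"
        using continuous_map_compose[OF path[OF x] f] by (simp add: o_def)
      have "d \<in> based_cubes n Y (f (h 0 x))" using d h0[OF x] by simp
      from exists_add_collar[OF this \<delta>] obtain d' where
        d': "d' \<in> based_cubes n Y (f (h 1 x))"
        "(d, add_collar n (\<lambda>v. f (?\<gamma> v)) d') \<in> based_homotopy_rel n Y (f x)"
        using h0[OF x] by auto
      then have d'2: "d' \<in> based_cubes n Y (f x)" using h1[OF x] fs fX x by simp
      then have "(s \<circ> d', s \<circ> d') \<in> based_homotopy_rel n X (?\<gamma> 0)"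
        using based_homotopy_compose[OF based_homotopy_refl s, of d' n "f x"] h1[OF x] by simp
      from add_collar_based_homotopy[OF this \<gamma>]
      have 1: "add_collar n ?\<gamma> (s \<circ> d') \<in> based_cubes n X x"
        using h0[OF x] based_homotopy_cubes by fastforce
      have "continuous_map (cube n) Y d'" using d'2 by (simp add: based_cubes_def)
      then have "d' ` topspace (cube n) \<subseteq> topspace Y"
        by (rule continuous_map_image_subset_topspace)
      then have "f \<circ> add_collar n ?\<gamma> (s \<circ> d') = add_collar n (\<lambda>v. f (?\<gamma> v)) d'"
        using fs expand_in_cube by (fastforce simp: add_collar_def)
      with based_homotopy_sym[OF d'(2)]
      have "(f \<circ> add_collar n ?\<gamma> (s \<circ> d'), d) \<in> based_homotopy_rel n Y (f x)" by simp
      from this 1 show ?thesis by (rule bexI)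
    qed
  qed
qed

section \<open>Functors and nerves\<close>

lemma fctr_eqI: "omap F = omap F' \<Longrightarrow> amap F = amap F' \<Longrightarrow> F = (F' :: ('o, 'a, 'p, 'b) fctr)"
  by (cases F; cases F') simp

lemma comp_fctr_simps [simp]:
  "x \<in> Obj C \<Longrightarrow> omap (comp_fctr C F' F) x = omap F' (omap F x)"
  "f \<in> Arr C \<Longrightarrow> amap (comp_fctr C F' F) f = amap F' (amap F f)"
  by (simp_all add: comp_fctr_def)

lemma id_fctr_simps [simp]:
  "x \<in> Obj C \<Longrightarrow> omap (id_fctr C) x = x"
  "f \<in> Arr C \<Longrightarrow> amap (id_fctr C) f = f"
  by (simp_all add: id_fctr_def)

lemma is_functor_obj: "\<lbrakk>is_functor C D F; x \<in> Obj C\<rbrakk> \<Longrightarrow> omap F x \<in> Obj D"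
  by (auto simp: is_functor_def)

lemma is_functor_arr:
  assumes "is_functor C D F" "f \<in> Arr C"
  shows "amap F f \<in> Arr D" "Src D (amap F f) = omap F (Src C f)" "Tgt D (amap F f) = omap F (Tgt C f)"
  using assms by (auto simp: is_functor_def)

lemma is_functor_idt: "\<lbrakk>is_functor C D F; x \<in> Obj C\<rbrakk> \<Longrightarrow> amap F (Idt C x) = Idt D (omap F x)"
  by (auto simp: is_functor_def)

lemma is_functor_cmp:
  "\<lbrakk>is_functor C D F; f \<in> Arr C; g \<in> Arr C; Tgt C f = Src C g\<rbrakk>
     \<Longrightarrow> amap F (Cmp C g f) = Cmp D (amap F g) (amap F f)"
  by (auto simp: is_functor_def)

lemma functor_eqI:
  assumes "is_functor C D F" "is_functor C D F'"
    and "\<And>x. x \<in> Obj C \<Longrightarrow> omap F x = omap F' x" "\<And>f. f \<in> Arr C \<Longrightarrow> amap F f = amap F' f"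
  shows "F = F'"
proof (rule fctr_eqI)
  show "omap F = omap F'"
    using assms by (intro PiE_ext[of _ "Obj C" "\<lambda>_. Obj D"]) (simp_all add: is_functor_def)
  show "amap F = amap F'"
    using assms by (intro PiE_ext[of _ "Arr C" "\<lambda>_. Arr D"]) (simp_all add: is_functor_def)
qed

lemma comp_fctr_assoc:
  "is_functor C D F \<Longrightarrow> comp_fctr C F'' (comp_fctr C F' F) = comp_fctr C (comp_fctr D F'' F') F"
  by (intro fctr_eqI) (auto simp: comp_fctr_def is_functor_obj is_functor_arr)

lemma comp_id_fctr: "is_functor C D F \<Longrightarrow> comp_fctr C (id_fctr D) F = F"
  by (intro fctr_eqI) (auto simp: comp_fctr_def id_fctr_def is_functor_def PiE_iff extensional_def
      fun_eq_iff)

context category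
begin

lemma is_functor_id: "is_functor C C (id_fctr C)"
  using idt cmp src_closed tgt_closed by (auto simp: is_functor_def id_fctr_def)

lemma is_functor_comp:
  assumes "is_functor C D F" "is_functor D E F'"
  shows "is_functor C E (comp_fctr C F' F)"
proof -
  have "omap (comp_fctr C F' F) \<in> Obj C \<rightarrow>\<^sub>E Obj E" "amap (comp_fctr C F' F) \<in> Arr C \<rightarrow>\<^sub>E Arr E"
    using assms by (auto simp: comp_fctr_def is_functor_obj is_functor_arr)
  then show ?thesis
    unfolding is_functor_def[of C E]
    using idt cmp src_closed tgt_closed is_functor_obj[OF assms(1)] is_functor_arr[OF assms(1)]
      is_functor_arr[OF assms(2)] is_functor_idt[OF assms(1)] is_functor_idt[OF assms(2)]
      is_functor_cmp[OF assms(1)] is_functor_cmp[OF assms(2)]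
    by simp
qed

end

section \<open>Simplices of the nerve and their faces\<close>

lemma ord_cat_simps [simp]:
  "Obj (ord_cat n) = {..n}" "Arr (ord_cat n) = {(i, j). i \<le> j \<and> j \<le> n}"
  "Src (ord_cat n) = fst" "Tgt (ord_cat n) = snd" "Idt (ord_cat n) i = (i, i)"
  "Cmp (ord_cat n) (i, j) (k, l) = (k, j)"
  by (simp_all add: ord_cat_def)

lemma category_ord_cat: "category (ord_cat n)"
  by unfold_locales auto

lemma is_functor_ord_fctr:
  assumes "mono_on {..m} \<alpha>" "\<alpha> \<in> {..m} \<rightarrow> {..n}"
  shows "is_functor (ord_cat m) (ord_cat n) (ord_fctr m \<alpha>)"
  using assms by (auto simp: is_functor_def ord_fctr_def Pi_iff intro: mono_onD)

lemma ord_fctr_simps [simp]: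
  "i \<le> m \<Longrightarrow> omap (ord_fctr m \<alpha>) i = \<alpha> i"
  "i \<le> j \<Longrightarrow> j \<le> m \<Longrightarrow> amap (ord_fctr m \<alpha>) (i, j) = (\<alpha> i, \<alpha> j)"
  by (simp_all add: ord_fctr_def)

lemma nerve_comp_fctr:
  "\<lbrakk>\<sigma> \<in> nerve C n; is_functor C D F\<rbrakk> \<Longrightarrow> comp_fctr (ord_cat n) F \<sigma> \<in> nerve D n"
  using category.is_functor_comp[OF category_ord_cat] by (auto simp: nerve_def)

lemma nerve_face:
  "\<lbrakk>\<sigma> \<in> nerve C n; mono_on {..m} \<alpha>; \<alpha> \<in> {..m} \<rightarrow> {..n}\<rbrakk>
     \<Longrightarrow> comp_fctr (ord_cat m) \<sigma> (ord_fctr m \<alpha>) \<in> nerve C m"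
  using category.is_functor_comp[OF category_ord_cat is_functor_ord_fctr] by (auto simp: nerve_def)

lemma nerve_arr:
  assumes "\<sigma> \<in> nerve C n" "i \<le> j" "j \<le> n"
  shows "amap \<sigma> (i, j) \<in> Arr C" "Src C (amap \<sigma> (i, j)) = omap \<sigma> i" "Tgt C (amap \<sigma> (i, j)) = omap \<sigma> j"
  using assms is_functor_arr[of "ord_cat n" C \<sigma> "(i, j)"] by (auto simp: nerve_def)

lemma nerve_obj: "\<lbrakk>\<sigma> \<in> nerve C n; i \<le> n\<rbrakk> \<Longrightarrow> omap \<sigma> i \<in> Obj C"
  using is_functor_obj[of "ord_cat n" C \<sigma> i] by (auto simp: nerve_def)

lemma nerve_cmp:
  assumes "\<sigma> \<in> nerve C n" "i \<le> j" "j \<le> k" "k \<le> n"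
  shows "Cmp C (amap \<sigma> (j, k)) (amap \<sigma> (i, j)) = amap \<sigma> (i, k)"
  using assms is_functor_cmp[of "ord_cat n" C \<sigma> "(i, j)" "(j, k)"] by (auto simp: nerve_def)

lemma simplex_push_in_standard_simplex:
  assumes "\<alpha> \<in> {..m} \<rightarrow> {..n}" "t \<in> standard_simplex m"
  shows "simplex_push m \<alpha> t \<in> standard_simplex n"
proof -
  have t: "0 \<le> t i" "sum t {..m} = 1" for i using assms(2) by (auto simp: standard_simplex_def)
  have "(\<Sum>j\<le>n. simplex_push m \<alpha> t j) = sum t {..m}"
    unfolding simplex_push_def using assms(1) by (intro sum.group) auto
  moreover have "simplex_push m \<alpha> t j \<le> sum t {..m}" for j
    unfolding simplex_push_def using t by (intro sum_mono2) auto
  moreover have "simplex_push m \<alpha> t j = 0" if "j > n" for j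
  proof -
    have "{i \<in> {..m}. \<alpha> i = j} = {}" using assms(1) that by force
    then show ?thesis by (simp only: simplex_push_def sum.empty)
  qed
  ultimately show ?thesis
    using t by (auto simp: standard_simplex_def simplex_push_def intro!: sum_nonneg)
qed

section \<open>Classifying spaces as quotients\<close>

lemma topspace_simplex_space:
  "topspace (simplex_space C) = {((n, \<sigma>), t). \<sigma> \<in> nerve C n \<and> t \<in> standard_simplex n}"
  by (auto simp: simplex_space_def)

lemma glue_subset: "glue C \<subseteq> topspace (simplex_space C) \<times> topspace (simplex_space C)"
  by (auto simp: glue_def topspace_simplex_space nerve_face simplex_push_in_standard_simplex)

lemma glue_imp_realization_rel: "p \<in> glue C \<Longrightarrow> p \<in> realization_rel C"
  by (auto simp: realization_rel_def)

lemma realization_rel_sym: "(p, q) \<in> realization_rel C \<Longrightarrow> (q, p) \<in> realization_rel C"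
  using equiv_realization_rel by (meson equivE symD)

lemma realization_class_eq: "(p, q) \<in> realization_rel C \<Longrightarrow> realization_rel C `` {p} = realization_rel C `` {q}"
  using equiv_class_eq[OF equiv_realization_rel] .

text \<open>The relation is generated by \<open>glue C\<close>, so a map of points descends once it
  respects single gluings; chains and reversals follow by induction.\<close>

lemma realization_rel_map:
  assumes "\<And>p q. (p, q) \<in> glue C \<Longrightarrow> (\<phi> p, \<phi> q) \<in> realization_rel D" "(p, q) \<in> realization_rel C"
  shows "(\<phi> p, \<phi> q) \<in> realization_rel D"
  using assms(2) unfolding realization_rel_def
proof (induction rule: rtrancl_induct)
  case (step q r)
  then have "(\<phi> q, \<phi> r) \<in> realization_rel D" using assms(1) realization_rel_sym by blast
  with step.IH show ?case unfolding realization_rel_def by (rule rtrancl_trans)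
qed simp

text \<open>\<open>realization_rel C\<close> is an equivalence on the whole type, including points
  outside the space. Since it never leaves \<open>simplex_space C\<close>, the points of the space
  form a union of classes, as the quotient map requires.\<close>

lemma realization_rel_closed:
  assumes "(p, q) \<in> realization_rel C" "p \<in> topspace (simplex_space C)"
  shows "q \<in> topspace (simplex_space C)"
  using assms(1) unfolding realization_rel_def
proof (induction rule: rtrancl_induct)
  case (step q r) then show ?case using glue_subset by blast
qed (use assms in auto)

text \<open>For a set \<open>U\<close> of classes, the preimage under the projection is the union of
  \<open>U\<close>, and this union is what the definition of \<open>quotient_topology\<close> tests
  for openness.\<close>

lemma quotient_map_quotient_topology:
  assumes r: "equiv UNIV r" and X: "r `` topspace X \<subseteq> topspace X"
  shows "topspace (quotient_topology X r) = topspace X // r"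
    and "quotient_map X (quotient_topology X r) (\<lambda>p. r `` {p})"
proof -
  have self: "p \<in> r `` {p}" for p using r by (meson UNIV_I equiv_class_self)
  have U: "\<Union>U = {p \<in> topspace X. r `` {p} \<in> U}" if "U \<subseteq> topspace X // r" for U
  proof
    show "{p \<in> topspace X. r `` {p} \<in> U} \<subseteq> \<Union>U" using self by blast
    show "\<Union>U \<subseteq> {p \<in> topspace X. r `` {p} \<in> U}"
    proof
      fix p assume "p \<in> \<Union>U"
      then obtain c where c: "p \<in> c" "c \<in> U" by blast
      then have "c \<in> topspace X // r" using that by blast
      then obtain q where q: "q \<in> topspace X" "c = r `` {q}" by (rule quotientE)
      then have "c = r `` {p}" using c equiv_class_eq[OF r] by blast
      moreover have "p \<in> topspace X" using c q X by blast
      ultimately show "p \<in> {p \<in> topspace X. r `` {p} \<in> U}" using c by simp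
    qed
  qed
  have op: "openin (quotient_topology X r) U \<longleftrightarrow>
      U \<subseteq> topspace X // r \<and> openin X {p \<in> topspace X. r `` {p} \<in> U}" for U
    unfolding openin_quotient_topology[OF r] using U by auto
  have "{p \<in> topspace X. r `` {p} \<in> topspace X // r} = topspace X" by (auto intro: quotientI)
  then have "openin (quotient_topology X r) (topspace X // r)" using op by simp
  then show top: "topspace (quotient_topology X r) = topspace X // r"
    using op openin_topspace[of "quotient_topology X r"] by (meson openin_subset subset_antisym)
  show "quotient_map X (quotient_topology X r) (\<lambda>p. r `` {p})"
    unfolding quotient_map_def top using op by (auto simp: quotient_def)
qed

lemma classifying_space_quotient:
  shows topspace_classifying_space:
      "topspace (classifying_space C) = topspace (simplex_space C) // realization_rel C"
    and quotient_map_classifying_space: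
      "quotient_map (simplex_space C) (classifying_space C) (\<lambda>p. realization_rel C `` {p})"
  unfolding classifying_space_def
  using quotient_map_quotient_topology[OF equiv_realization_rel] realization_rel_closed
  by blast+

text \<open>The map on representatives inside \<open>classifying_map\<close>, named so that its
  effect on single points can be stated.\<close>

definition simplices_map :: "('o, 'a, 'p, 'b) fctr \<Rightarrow> ('o, 'a) simplices \<Rightarrow> ('p, 'b) simplices" where
  "simplices_map F = (\<lambda>((n, \<sigma>), t). ((n, comp_fctr (ord_cat n) F \<sigma>), t))"

lemma simplices_map_rel:
  assumes F: "is_functor C D F" and "(p, q) \<in> realization_rel C"
  shows "(simplices_map F p, simplices_map F q) \<in> realization_rel D"
proof (rule realization_rel_map[OF _ assms(2)])
  fix p q assume "(p, q) \<in> glue C"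
  then obtain m n \<alpha> \<sigma> t where *: "p = ((m, comp_fctr (ord_cat m) \<sigma> (ord_fctr m \<alpha>)), t)"
    "q = ((n, \<sigma>), simplex_push m \<alpha> t)" "mono_on {..m} \<alpha>" "\<alpha> \<in> {..m} \<rightarrow> {..n}"
    "\<sigma> \<in> nerve C n" "t \<in> standard_simplex m"
    by (auto simp: glue_def)
  have "(simplices_map F p, simplices_map F q) \<in> glue D"
    unfolding glue_def mem_Collect_eq
    using * nerve_comp_fctr[OF _ F] comp_fctr_assoc[OF is_functor_ord_fctr]
    by (intro exI[of _ m] exI[of _ n] exI[of _ \<alpha>] exI[of _ "comp_fctr (ord_cat n) F \<sigma>"] exI[of _ t])
      (auto simp: simplices_map_def)
  then show "(simplices_map F p, simplices_map F q) \<in> realization_rel D"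
    by (rule glue_imp_realization_rel)
qed

text \<open>Induced maps and homotopies of classifying spaces are both defined by saturating the
  image of a class; here such a saturation is evaluated on one representative.\<close>

lemma realization_rel_image:
  assumes "\<And>p q. (p, q) \<in> realization_rel C \<Longrightarrow> (\<phi> p, \<phi> q) \<in> realization_rel D"
  shows "realization_rel D `` (\<phi> ` (realization_rel C `` {p})) = realization_rel D `` {\<phi> p}"
proof
  show "realization_rel D `` (\<phi> ` (realization_rel C `` {p})) \<subseteq> realization_rel D `` {\<phi> p}"
  proof
    fix r assume "r \<in> realization_rel D `` (\<phi> ` (realization_rel C `` {p}))"
    then obtain q where "(p, q) \<in> realization_rel C" "(\<phi> q, r) \<in> realization_rel D" by auto
    with assms have "(\<phi> p, r) \<in> realization_rel D" unfolding realization_rel_def by (meson rtrancl_trans)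
    then show "r \<in> realization_rel D `` {\<phi> p}" by simp
  qed
  have "p \<in> realization_rel C `` {p}" by (simp add: realization_rel_def)
  then show "realization_rel D `` {\<phi> p} \<subseteq> realization_rel D `` (\<phi> ` (realization_rel C `` {p}))"
    by blast
qed

lemma classifying_map_class:
  "is_functor C D F \<Longrightarrow>
     classifying_map D F (realization_rel C `` {p}) = realization_rel D `` {simplices_map F p}"
  unfolding classifying_map_def simplices_map_def[symmetric]
  by (intro realization_rel_image simplices_map_rel)

lemma classifying_space_cases:
  assumes "c \<in> topspace (classifying_space C)"
  obtains p where "p \<in> topspace (simplex_space C)" "c = realization_rel C `` {p}"
  using assms by (auto simp: topspace_classifying_space elim: quotientE)

lemma classifying_map_comp:
  assumes "is_functor C D F" "is_functor D E F'" "category C" "c \<in> topspace (classifying_space C)"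
  shows "classifying_map E F' (classifying_map D F c) = classifying_map E (comp_fctr C F' F) c"
proof -
  obtain p where p: "p \<in> topspace (simplex_space C)" "c = realization_rel C `` {p}"
    using assms(4) by (rule classifying_space_cases)
  have "simplices_map F' (simplices_map F p) = simplices_map (comp_fctr C F' F) p"
    using p by (auto simp: simplices_map_def topspace_simplex_space nerve_def comp_fctr_assoc)
  then show ?thesis
    using p classifying_map_class[OF assms(1)] classifying_map_class[OF assms(2)]
      classifying_map_class[OF category.is_functor_comp[OF assms(3,1,2)]] by simp
qed

lemma classifying_map_id:
  assumes "category C" "c \<in> topspace (classifying_space C)"
  shows "classifying_map C (id_fctr C) c = c"
proof -
  obtain p where p: "p \<in> topspace (simplex_space C)" "c = realization_rel C `` {p}"
    using assms(2) by (rule classifying_space_cases)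
  have "simplices_map (id_fctr C) p = p"
    using p by (auto simp: simplices_map_def topspace_simplex_space nerve_def comp_id_fctr)
  then show ?thesis
    using p classifying_map_class[OF category.is_functor_id[OF assms(1)]] by simp
qed

text \<open>The sets \<open>Z \<times> ({i} \<times> X i)\<close> are open and cover the product, so
  continuity can be checked on each. With \<open>Z\<close> the interval this reduces homotopies on
  all simplices to single simplices.\<close>

lemma continuous_map_prod_sum_topology:
  assumes "\<And>i. i \<in> I \<Longrightarrow> continuous_map (prod_topology Z (X i)) W (\<lambda>(z, x). f z (i, x))"
  shows "continuous_map (prod_topology Z (sum_topology X I)) W (\<lambda>(z, p). f z p)"
proof (rule pasting_lemma[where I = I and f = "\<lambda>_ (z, p). f z p"
      and T = "\<lambda>i. topspace Z \<times> ({i} \<times> topspace (X i))"])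
  let ?S = "sum_topology X I"
  fix i assume i: "i \<in> I"
  have pi: "Pair i ` U = {i} \<times> U" for U by auto
  have "openin ?S ({i} \<times> topspace (X i))"
    using open_map_component_injection[OF i] unfolding open_map_def pi by auto
  then show "openin (prod_topology Z ?S) (topspace Z \<times> ({i} \<times> topspace (X i)))"
    by (simp add: openin_prod_Times_iff)
  \<comment> \<open>On an open summand, \<open>snd\<close> inverts the injection of
    \<open>X i\<close>, which is an open map.\<close>
  have snd: "continuous_map (subtopology ?S ({i} \<times> topspace (X i))) (X i) snd"
    unfolding continuous_map_def
  proof (intro conjI allI impI)
    fix U assume U: "openin (X i) U"
    then have "openin ?S ({i} \<times> U)"
      using open_map_component_injection[OF i] pi by (metis open_map_def)
    moreover have "{p \<in> topspace (subtopology ?S ({i} \<times> topspace (X i))). snd p \<in> U}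
        = {i} \<times> U \<inter> {i} \<times> topspace (X i)"
      using i openin_subset[OF U] by auto
    ultimately show "openin (subtopology ?S ({i} \<times> topspace (X i)))
        {p \<in> topspace (subtopology ?S ({i} \<times> topspace (X i))). snd p \<in> U}"
      by (metis openin_subtopology_Int)
  qed auto
  have sub: "subtopology (prod_topology Z ?S) (topspace Z \<times> ({i} \<times> topspace (X i)))
      = prod_topology Z (subtopology ?S ({i} \<times> topspace (X i)))"
    by (simp add: prod_topology_subtopology)
  have "continuous_map (prod_topology Z (subtopology ?S ({i} \<times> topspace (X i)))) (prod_topology Z (X i))
      (\<lambda>q. (fst q, snd (snd q)))"
    using continuous_map_compose[OF continuous_map_snd snd]
    by (intro continuous_map_pairedI continuous_map_fst) (simp add: o_def)
  from continuous_map_compose[OF this assms[OF i]]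
  have "continuous_map (prod_topology Z (subtopology ?S ({i} \<times> topspace (X i)))) W
      (\<lambda>q. f (fst q) (i, snd (snd q)))"
    by (simp only: o_def split_def fst_conv snd_conv)
  then show "continuous_map (subtopology (prod_topology Z ?S) (topspace Z \<times> ({i} \<times> topspace (X i)))) W
      (\<lambda>(z, p). f z p)"
    unfolding sub by (rule continuous_map_eq) auto
qed auto

lemma continuous_map_sum_topology:
  assumes "\<And>i. i \<in> I \<Longrightarrow> continuous_map (X i) W (\<lambda>x. f (i, x))"
  shows "continuous_map (sum_topology X I) W f"
  unfolding continuous_map_def
proof (intro conjI allI impI)
  show "f \<in> topspace (sum_topology X I) \<rightarrow> topspace W"
    using assms continuous_map_image_subset_topspace by fastforce
  fix U assume "openin W U"
  then show "openin (sum_topology X I) {p \<in> topspace (sum_topology X I). f p \<in> U}"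
    using openin_continuous_map_preimage[OF assms] by (auto simp: openin_sum_topology)
qed

lemma continuous_map_classifying_map:
  assumes F: "is_functor C D F"
  shows "continuous_map (classifying_space C) (classifying_space D) (classifying_map D F)"
proof (rule continuous_compose_quotient_map[OF quotient_map_classifying_space])
  have "continuous_map (simplex_space C) (simplex_space D) (simplices_map F)"
    unfolding simplex_space_def
  proof (rule continuous_map_sum_topology)
    fix i assume i: "i \<in> (SIGMA n:UNIV. nerve C n)"
    obtain n \<sigma> where n: "i = (n, \<sigma>)" by fastforce
    have j: "(n, comp_fctr (ord_cat n) F \<sigma>) \<in> (SIGMA n:UNIV. nerve D n)"
      using i n nerve_comp_fctr[OF _ F] by auto
    show "continuous_map (case i of (n, \<sigma>) \<Rightarrow> subtopology (powertop_real UNIV) (standard_simplex n))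
        (sum_topology (\<lambda>(n, \<sigma>). subtopology (powertop_real UNIV) (standard_simplex n))
          (SIGMA n:UNIV. nerve D n))
        (\<lambda>x. simplices_map F (i, x))"
      using continuous_map_component_injection[OF j,
          of "\<lambda>(n, \<sigma>). subtopology (powertop_real UNIV) (standard_simplex n)"]
      by (simp add: n simplices_map_def)
  qed
  from continuous_map_compose[OF this quotient_imp_continuous_map[OF quotient_map_classifying_space]]
  show "continuous_map (simplex_space C) (classifying_space D)
      (classifying_map D F \<circ> (\<lambda>p. realization_rel C `` {p}))"
    by (simp add: o_def classifying_map_class[OF F])
qed

section \<open>Groupoids and fans\<close>

locale groupoid = category C for C :: "('o, 'a, 'z) cat_scheme" +
  assumes ex_inverse: "f \<in> Arr C \<Longrightarrow> \<exists>g\<in>Arr C. Src C g = Tgt C f \<and> Tgt C g = Src C f \<and>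
    Cmp C g f = Idt C (Src C f) \<and> Cmp C f g = Idt C (Tgt C f)"

definition Inv :: "('o, 'a, 'z) cat_scheme \<Rightarrow> 'a \<Rightarrow> 'a" where
  "Inv C f = (SOME g. g \<in> Arr C \<and> Src C g = Tgt C f \<and> Tgt C g = Src C f \<and>
    Cmp C g f = Idt C (Src C f) \<and> Cmp C f g = Idt C (Tgt C f))"

text \<open>The arrow \<open>g f^-1\<close>, from the target of \<open>f\<close> to the target of
  \<open>g\<close>, for arrows with a common source.\<close>

definition rdiv :: "('o, 'a, 'z) cat_scheme \<Rightarrow> 'a \<Rightarrow> 'a \<Rightarrow> 'a" where
  "rdiv C g f = Cmp C g (Inv C f)"

text \<open>In a groupoid, arrows \<open>u p\<close> from one common source to the vertices
  determine a simplex, as each edge must be a quotient of two of them. Any such family gives a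
  functor, so simplices can be prescribed by vertices and spokes alone.\<close>

definition fan :: "('o, 'a, 'z) cat_scheme \<Rightarrow> nat \<Rightarrow> (nat \<Rightarrow> 'a) \<Rightarrow> (nat, nat \<times> nat, 'o, 'a) fctr" where
  "fan C N u = \<lparr>omap = \<lambda>p\<in>{..N}. Tgt C (u p),
     amap = \<lambda>e\<in>{(i, j). i \<le> j \<and> j \<le> N}. rdiv C (u (snd e)) (u (fst e))\<rparr>"

lemma fan_simps [simp]:
  "p \<le> N \<Longrightarrow> omap (fan C N u) p = Tgt C (u p)"
  "i \<le> j \<Longrightarrow> j \<le> N \<Longrightarrow> amap (fan C N u) (i, j) = rdiv C (u j) (u i)"
  by (simp_all add: fan_def)

lemma fan_cong: "(\<And>p. p \<le> N \<Longrightarrow> u p = v p) \<Longrightarrow> fan C N u = fan C N v"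
  by (intro fctr_eqI) (auto simp: fan_def intro!: restrict_ext)

context groupoid
begin

lemma Inv:
  assumes "f \<in> Arr C"
  shows "Inv C f \<in> Arr C" "Src C (Inv C f) = Tgt C f" "Tgt C (Inv C f) = Src C f"
    "Cmp C (Inv C f) f = Idt C (Src C f)" "Cmp C f (Inv C f) = Idt C (Tgt C f)"
proof -
  have "\<exists>g. g \<in> Arr C \<and> Src C g = Tgt C f \<and> Tgt C g = Src C f \<and>
    Cmp C g f = Idt C (Src C f) \<and> Cmp C f g = Idt C (Tgt C f)"
    using ex_inverse[OF assms] by blast
  from someI_ex[OF this, folded Inv_def]
  show "Inv C f \<in> Arr C" "Src C (Inv C f) = Tgt C f" "Tgt C (Inv C f) = Src C f"
    "Cmp C (Inv C f) f = Idt C (Src C f)" "Cmp C f (Inv C f) = Idt C (Tgt C f)"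
    by blast+
qed

lemma rdiv:
  assumes "f \<in> Arr C" "g \<in> Arr C" "Src C f = Src C g"
  shows "rdiv C g f \<in> Arr C" "Src C (rdiv C g f) = Tgt C f" "Tgt C (rdiv C g f) = Tgt C g"
    "Cmp C (rdiv C g f) f = g"
proof -
  show "rdiv C g f \<in> Arr C" "Src C (rdiv C g f) = Tgt C f" "Tgt C (rdiv C g f) = Tgt C g"
    using assms cmp[OF Inv(1)[OF assms(1)] assms(2)] Inv[OF assms(1)] by (auto simp: rdiv_def)
  show "Cmp C (rdiv C g f) f = g"
    using assms Inv[OF assms(1)] cmp_assoc[of f "Inv C f" g] cmp_idt_right[of g] by (simp add: rdiv_def)
qed

text \<open>Right cancellation of an invertible arrow; the identities for \<open>rdiv\<close> below
  come down to it.\<close>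

lemma rdiv_unique:
  assumes "f \<in> Arr C" "h \<in> Arr C" "Src C h = Tgt C f" "Cmp C h f = g"
  shows "rdiv C g f = h"
  using assms Inv[OF assms(1)] cmp_assoc[of "Inv C f" f h] cmp_idt_right[of h] by (auto simp: rdiv_def)

lemma rdiv_self: "f \<in> Arr C \<Longrightarrow> rdiv C f f = Idt C (Tgt C f)"
  using idt tgt_closed cmp_idt_left by (intro rdiv_unique) auto

lemma rdiv_cmp:
  assumes "f \<in> Arr C" "g \<in> Arr C" "h \<in> Arr C" "Src C f = Src C g" "Src C g = Src C h"
  shows "Cmp C (rdiv C h g) (rdiv C g f) = rdiv C h f"
proof (rule rdiv_unique[symmetric])
  show "Cmp C (rdiv C h g) (rdiv C g f) \<in> Arr C" "Src C (Cmp C (rdiv C h g) (rdiv C g f)) = Tgt C f"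
    using assms rdiv[of f g] rdiv[of g h] cmp[of "rdiv C g f" "rdiv C h g"] by auto
  show "Cmp C (Cmp C (rdiv C h g) (rdiv C g f)) f = h"
    using assms rdiv[of f g] rdiv[of g h] cmp_assoc[of f "rdiv C g f" "rdiv C h g"] by simp
qed (use assms in auto)

lemma rdiv_cmp_right:
  assumes "f \<in> Arr C" "g \<in> Arr C" "w \<in> Arr C" "Src C f = Tgt C w" "Src C g = Tgt C w"
  shows "rdiv C (Cmp C g w) (Cmp C f w) = rdiv C g f"
  using assms rdiv[of f g] cmp[of w f] cmp_assoc[of w f "rdiv C g f"]
  by (intro rdiv_unique) auto

lemma rdiv_functor:
  assumes "groupoid D" "is_functor C D F" "f \<in> Arr C" "g \<in> Arr C" "Src C f = Src C g"
  shows "amap F (rdiv C g f) = rdiv D (amap F g) (amap F f)"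
  using assms rdiv[of f g] is_functor_arr[OF assms(2)] is_functor_cmp[OF assms(2), of f "rdiv C g f"]
  by (intro groupoid.rdiv_unique[symmetric, OF assms(1)]) auto

lemma fan_nerve:
  assumes u: "\<And>p. p \<le> N \<Longrightarrow> u p \<in> Arr C \<and> Src C (u p) = z"
  shows "fan C N u \<in> nerve C N"
proof -
  have "is_functor (ord_cat N) C (fan C N u)"
    unfolding is_functor_def
  proof (intro conjI ballI impI)
    show "omap (fan C N u) \<in> Obj (ord_cat N) \<rightarrow>\<^sub>E Obj C"
      using u tgt_closed by (auto simp: fan_def)
    show "amap (fan C N u) \<in> Arr (ord_cat N) \<rightarrow>\<^sub>E Arr C"
      using u by (auto simp: fan_def intro!: rdiv(1))
    fix e assume e: "e \<in> Arr (ord_cat N)"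
    show "Src C (amap (fan C N u) e) = omap (fan C N u) (Src (ord_cat N) e)"
      "Tgt C (amap (fan C N u) e) = omap (fan C N u) (Tgt (ord_cat N) e)"
      using e u rdiv(2,3) by (cases e; auto)+
    fix e' assume e': "e' \<in> Arr (ord_cat N)" "Tgt (ord_cat N) e = Src (ord_cat N) e'"
    show "amap (fan C N u) (Cmp (ord_cat N) e' e) = Cmp C (amap (fan C N u) e') (amap (fan C N u) e)"
      using e e' u rdiv_cmp by auto
  next
    fix i assume "i \<in> Obj (ord_cat N)"
    then show "amap (fan C N u) (Idt (ord_cat N) i) = Idt C (omap (fan C N u) i)"
      using u rdiv_self by simp
  qed
  then show ?thesis by (simp add: nerve_def)
qed

lemma nerve_eqI:
  assumes "\<sigma> \<in> nerve C n" "\<tau> \<in> nerve C n" "\<And>i. i \<le> n \<Longrightarrow> omap \<sigma> i = omap \<tau> i"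
    "\<And>i j. i \<le> j \<Longrightarrow> j \<le> n \<Longrightarrow> amap \<sigma> (i, j) = amap \<tau> (i, j)"
  shows "\<sigma> = \<tau>"
  using assms by (intro functor_eqI[of "ord_cat n" C]) (auto simp: nerve_def)

text \<open>The arrows out of vertex 0 serve as spokes, and functoriality of \<sigma> identifies
  their quotients with the edges.\<close>

lemma fan_simplex:
  assumes "\<sigma> \<in> nerve C n" shows "fan C n (\<lambda>p. amap \<sigma> (0, p)) = \<sigma>"
proof (rule nerve_eqI[OF fan_nerve assms])
  show "amap (fan C n (\<lambda>p. amap \<sigma> (0, p))) (i, j) = amap \<sigma> (i, j)" if "i \<le> j" "j \<le> n" for i j
    using that nerve_arr[OF assms] nerve_cmp[OF assms] by (auto intro!: rdiv_unique)
qed (use nerve_arr[OF assms] in auto)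

text \<open>Reindexing the spokes works even if \<open>\<alpha> 0\<close> differs from 0, because
  the common source of a fan need not be one of its vertices.\<close>

lemma fan_face:
  assumes u: "\<And>p. p \<le> n \<Longrightarrow> u p \<in> Arr C \<and> Src C (u p) = z"
    and \<alpha>: "mono_on {..m} \<alpha>" "\<alpha> \<in> {..m} \<rightarrow> {..n}"
  shows "comp_fctr (ord_cat m) (fan C n u) (ord_fctr m \<alpha>) = fan C m (\<lambda>p. u (\<alpha> p))"
proof (rule nerve_eqI[OF nerve_face[OF fan_nerve \<alpha>] fan_nerve])
  show "amap (comp_fctr (ord_cat m) (fan C n u) (ord_fctr m \<alpha>)) (i, j) = amap (fan C m (\<lambda>p. u (\<alpha> p))) (i, j)"
    if "i \<le> j" "j \<le> m" for i j
  proof -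
    have "\<alpha> i \<le> \<alpha> j" "\<alpha> j \<le> n" using that \<alpha> by (auto intro: mono_onD)
    then show ?thesis using that by simp
  qed
qed (use u \<alpha> in \<open>auto simp: Pi_iff\<close>)

text \<open>Precomposition with one arrow moves the common source and cancels in every quotient of
  spokes. Fans drawn from different sources can be compared in this way.\<close>

lemma fan_cmp_right:
  assumes u: "\<And>p. p \<le> N \<Longrightarrow> u p \<in> Arr C \<and> Src C (u p) = Tgt C w" and w: "w \<in> Arr C"
  shows "fan C N (\<lambda>p. Cmp C (u p) w) = fan C N u"
proof (rule nerve_eqI[OF fan_nerve fan_nerve])
  show "Cmp C (u p) w \<in> Arr C \<and> Src C (Cmp C (u p) w) = Src C w" if "p \<le> N" for p
    using u[OF that] w cmp[of w "u p"] by simp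
qed (use u w cmp in \<open>auto intro!: rdiv_cmp_right\<close>)

lemma fan_functor:
  assumes D: "groupoid D" and F: "is_functor C D F"
    and u: "\<And>p. p \<le> N \<Longrightarrow> u p \<in> Arr C \<and> Src C (u p) = z"
  shows "comp_fctr (ord_cat N) F (fan C N u) = fan D N (\<lambda>p. amap F (u p))"
  by (rule groupoid.nerve_eqI[OF D nerve_comp_fctr[OF fan_nerve F] groupoid.fan_nerve[OF D]])
    (use u is_functor_arr[OF F] rdiv_functor[OF D F] in auto)

end

section \<open>Homotopies from natural transformations of groupoids\<close>

text \<open>The vertices up to \<open>2 * n + 1\<close> form two copies of those up to
  \<open>n\<close>, the second shifted by \<open>Suc n\<close>. The point \<open>t\<close> slides in
  a straight line from the first copy at \<open>u = 0\<close> to the second at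
  \<open>u = 1\<close>.\<close>

definition join_weights :: "nat \<Rightarrow> real \<Rightarrow> (nat \<Rightarrow> real) \<Rightarrow> nat \<Rightarrow> real" where
  "join_weights n u t p = (if p \<le> n then (1 - u) * t p else u * t (p - Suc n))"

text \<open>The map \<alpha> on each of the two copies. It is monotone across them because the first
  copy precedes the second.\<close>

definition join_ord :: "nat \<Rightarrow> nat \<Rightarrow> (nat \<Rightarrow> nat) \<Rightarrow> nat \<Rightarrow> nat" where
  "join_ord m n \<alpha> p = (if p \<le> m then \<alpha> p else Suc (n + \<alpha> (p - Suc m)))"

lemma atMost_join: "{..2 * n + 1} = {..n} \<union> (\<lambda>i. i + Suc n) ` {..n}"
proof -
  have "p \<in> (\<lambda>i. i + Suc n) ` {..n}" if "p \<le> 2 * n + 1" "\<not> p \<le> n" for p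
    using that by (intro image_eqI[of _ _ "p - Suc n"]) auto
  then show ?thesis by auto
qed

lemma join_ord_mono:
  assumes "mono_on {..m} \<alpha>" "\<alpha> \<in> {..m} \<rightarrow> {..n}"
  shows "mono_on {..2 * m + 1} (join_ord m n \<alpha>)" "join_ord m n \<alpha> \<in> {..2 * m + 1} \<rightarrow> {..2 * n + 1}"
proof -
  have le: "\<alpha> i \<le> n" if "i \<le> m" for i using assms(2) that by auto
  show "mono_on {..2 * m + 1} (join_ord m n \<alpha>)"
  proof (rule mono_onI)
    fix p q assume pq: "p \<in> {..2 * m + 1}" "q \<in> {..2 * m + 1}" "p \<le> q"
    then show "join_ord m n \<alpha> p \<le> join_ord m n \<alpha> q"
      using mono_onD[OF assms(1), of p q] mono_onD[OF assms(1), of "p - Suc m" "q - Suc m"] le[of p]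
      by (auto simp: join_ord_def)
  qed
  show "join_ord m n \<alpha> \<in> {..2 * m + 1} \<rightarrow> {..2 * n + 1}"
  proof
    fix p assume "p \<in> {..2 * m + 1}"
    then show "join_ord m n \<alpha> p \<in> {..2 * n + 1}"
      using le[of p] le[of "p - Suc m"] by (auto simp: join_ord_def)
  qed
qed

lemma join_weights_in_standard_simplex:
  assumes t: "t \<in> standard_simplex n" and u: "u \<in> {0..1}"
  shows "join_weights n u t \<in> standard_simplex (2 * n + 1)"
proof -
  have t': "0 \<le> t i" "t i \<le> 1" "i > n \<Longrightarrow> t i = 0" "sum t {..n} = 1" for i
    using t by (auto simp: standard_simplex_def)
  have "sum (join_weights n u t) {..2 * n + 1}
      = sum (join_weights n u t) {..n} + sum (join_weights n u t) ((\<lambda>i. i + Suc n) ` {..n})"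
    unfolding atMost_join by (intro sum.union_disjoint) auto
  also have "sum (join_weights n u t) ((\<lambda>i. i + Suc n) ` {..n}) = (\<Sum>i\<le>n. u * t i)"
    by (subst sum.reindex) (auto simp: inj_on_def join_weights_def)
  also have "sum (join_weights n u t) {..n} = (\<Sum>i\<le>n. (1 - u) * t i)"
    by (intro sum.cong) (auto simp: join_weights_def)
  finally have "sum (join_weights n u t) {..2 * n + 1} = 1"
    using t' by (simp add: sum_distrib_left[symmetric])
  moreover have "0 \<le> join_weights n u t p \<and> join_weights n u t p \<le> 1" for p
    using t' u by (auto simp: join_weights_def mult_le_one)
  moreover have "join_weights n u t p = 0" if "p > 2 * n + 1" for p
    using that t' by (auto simp: join_weights_def)
  ultimately show ?thesis by (auto simp: standard_simplex_def)
qed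

text \<open>The fibre of \<open>join_ord m n \<alpha>\<close> over a vertex is a fibre of \<alpha>
  in the matching copy, so summing over fibres commutes with splitting the weights.\<close>

lemma simplex_push_join:
  assumes "\<alpha> \<in> {..m} \<rightarrow> {..n}"
  shows "simplex_push (2 * m + 1) (join_ord m n \<alpha>) (join_weights m u t)
    = join_weights n u (simplex_push m \<alpha> t)"
proof
  fix j
  have le: "\<alpha> i \<le> n" if "i \<le> m" for i using assms that by auto
  show "simplex_push (2 * m + 1) (join_ord m n \<alpha>) (join_weights m u t) j
      = join_weights n u (simplex_push m \<alpha> t) j"
  proof (cases "j \<le> n")
    case True
    then have "{p \<in> {..2 * m + 1}. join_ord m n \<alpha> p = j} = {i \<in> {..m}. \<alpha> i = j}"
      by (auto simp: join_ord_def split: if_splits)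
    then show ?thesis using True
      by (auto simp: simplex_push_def join_weights_def sum_distrib_left intro!: sum.cong)
  next
    case False
    have "{p \<in> {..2 * m + 1}. join_ord m n \<alpha> p = j} = (\<lambda>i. i + Suc m) ` {i \<in> {..m}. \<alpha> i = j - Suc n}"
    proof (intro equalityI subsetI)
      fix p assume "p \<in> {p \<in> {..2 * m + 1}. join_ord m n \<alpha> p = j}"
      then show "p \<in> (\<lambda>i. i + Suc m) ` {i \<in> {..m}. \<alpha> i = j - Suc n}"
        using False le[of p]
        by (intro image_eqI[of _ _ "p - Suc m"]) (auto simp: join_ord_def split: if_splits)
    qed (use False in \<open>auto simp: join_ord_def\<close>)
    then show ?thesis using False
      by (simp add: simplex_push_def join_weights_def sum_distrib_left sum.reindex inj_on_def)
  qed
qed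

locale groupoid_transformation = groupoid A
  for A :: "('o, 'a, 'z) cat_scheme" +
  fixes P :: "('o, 'a, 'o, 'a) fctr" and \<theta> :: "'o \<Rightarrow> 'a"
  assumes P: "is_functor A A P" and \<theta>: "nat_trans A A (id_fctr A) P \<theta>"
begin

definition spokes :: "nat \<Rightarrow> (nat, nat \<times> nat, 'o, 'a) fctr \<Rightarrow> nat \<Rightarrow> 'a" where
  "spokes n \<sigma> p = (if p \<le> n then amap \<sigma> (0, p)
     else Cmp A (\<theta> (omap \<sigma> (p - Suc n))) (amap \<sigma> (0, p - Suc n)))"

text \<open>The simplex \<open>x\<^sub>0 \<rightarrow> \<dots> \<rightarrow> x\<^sub>n \<rightarrow> P x\<^sub>0 \<rightarrow> \<dots> \<rightarrow> P x\<^sub>n\<close>. Its middle arrow exists because arrows are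
  invertible; this spares the triangulation of the prism.\<close>

definition join_simplex :: "nat \<Rightarrow> (nat, nat \<times> nat, 'o, 'a) fctr \<Rightarrow> (nat, nat \<times> nat, 'o, 'a) fctr" where
  "join_simplex n \<sigma> = fan A (2 * n + 1) (spokes n \<sigma>)"

definition simplices_homotopy :: "real \<Rightarrow> ('o, 'a) simplices \<Rightarrow> ('o, 'a) simplices" where
  "simplices_homotopy u = (\<lambda>((n, \<sigma>), t). ((2 * n + 1, join_simplex n \<sigma>), join_weights n u t))"

definition classifying_homotopy :: "real \<Rightarrow> ('o, 'a) simplices set \<Rightarrow> ('o, 'a) simplices set" where
  "classifying_homotopy u c = realization_rel A `` (simplices_homotopy u ` c)"

lemma \<theta>_arr:
  assumes "x \<in> Obj A" shows "\<theta> x \<in> Arr A" "Src A (\<theta> x) = x" "Tgt A (\<theta> x) = omap P x"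
  using assms \<theta> by (auto simp: nat_trans_def)

lemma \<theta>_nat: "f \<in> Arr A \<Longrightarrow> Cmp A (\<theta> (Tgt A f)) f = Cmp A (amap P f) (\<theta> (Src A f))"
  using \<theta> by (auto simp: nat_trans_def)

lemma spokes_arr:
  assumes "\<sigma> \<in> nerve A n" "p \<le> 2 * n + 1"
  shows "spokes n \<sigma> p \<in> Arr A \<and> Src A (spokes n \<sigma> p) = omap \<sigma> 0"
  using assms nerve_arr[OF assms(1), of 0 p] nerve_arr[OF assms(1), of 0 "p - Suc n"]
    \<theta>_arr[OF nerve_obj[OF assms(1), of "p - Suc n"]]
    cmp[of "amap \<sigma> (0, p - Suc n)" "\<theta> (omap \<sigma> (p - Suc n))"]
  by (auto simp: spokes_def)

lemma join_simplex_nerve: "\<sigma> \<in> nerve A n \<Longrightarrow> join_simplex n \<sigma> \<in> nerve A (2 * n + 1)"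
  unfolding join_simplex_def by (rule fan_nerve[OF spokes_arr])

text \<open>The spokes of the join for \<sigma> start at its vertex 0, those for the face at its
  vertex \<open>\<alpha> 0\<close>. They differ by the arrow between these vertices, which
  \<open>fan_cmp_right\<close> cancels.\<close>

lemma join_simplex_face:
  assumes \<sigma>: "\<sigma> \<in> nerve A n" and \<alpha>: "mono_on {..m} \<alpha>" "\<alpha> \<in> {..m} \<rightarrow> {..n}"
  shows "comp_fctr (ord_cat (2 * m + 1)) (join_simplex n \<sigma>) (ord_fctr (2 * m + 1) (join_ord m n \<alpha>))
    = join_simplex m (comp_fctr (ord_cat m) \<sigma> (ord_fctr m \<alpha>))"
proof -
  let ?\<tau> = "comp_fctr (ord_cat m) \<sigma> (ord_fctr m \<alpha>)"
  have \<tau>: "?\<tau> \<in> nerve A m" using nerve_face[OF \<sigma> \<alpha>] .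
  have le: "\<alpha> i \<le> n" "\<alpha> 0 \<le> \<alpha> i" if "i \<le> m" for i using \<alpha> that by (auto intro: mono_onD)
  have "spokes n \<sigma> (join_ord m n \<alpha> p) = Cmp A (spokes m ?\<tau> p) (amap \<sigma> (0, \<alpha> 0))"
    if p: "p \<le> 2 * m + 1" for p
  proof (cases "p \<le> m")
    case True
    then show ?thesis
      using le[of p] nerve_cmp[OF \<sigma>, of 0 "\<alpha> 0" "\<alpha> p"] by (simp add: spokes_def join_ord_def)
  next
    case False
    define i where "i = p - Suc m"
    have i: "i \<le> m" using p False by (simp add: i_def)
    have "Cmp A (amap \<sigma> (\<alpha> 0, \<alpha> i)) (amap \<sigma> (0, \<alpha> 0)) = amap \<sigma> (0, \<alpha> i)"
      using le[OF i] nerve_cmp[OF \<sigma>] by simp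
    then show ?thesis
      using False i le[OF i] le[of 0] nerve_arr[OF \<sigma>] \<theta>_arr[OF nerve_obj[OF \<sigma>]]
        cmp_assoc[of "amap \<sigma> (0, \<alpha> 0)" "amap \<sigma> (\<alpha> 0, \<alpha> i)" "\<theta> (omap \<sigma> (\<alpha> i))"]
      by (simp add: spokes_def join_ord_def i_def[symmetric])
  qed
  then have "fan A (2 * m + 1) (\<lambda>p. spokes n \<sigma> (join_ord m n \<alpha> p))
      = fan A (2 * m + 1) (\<lambda>p. Cmp A (spokes m ?\<tau> p) (amap \<sigma> (0, \<alpha> 0)))"
    by (intro fan_cong) auto
  also have "\<dots> = fan A (2 * m + 1) (spokes m ?\<tau>)"
    using spokes_arr[OF \<tau>] nerve_arr[OF \<sigma>, of 0 "\<alpha> 0"] le[of 0] by (intro fan_cmp_right) auto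
  finally show ?thesis
    unfolding join_simplex_def using fan_face[OF spokes_arr[OF \<sigma>] join_ord_mono[OF \<alpha>]] by simp
qed

text \<open>A gluing along \<alpha> is sent to a single gluing along
  \<open>join_ord m n \<alpha>\<close>, with the same \<open>u\<close>.\<close>

lemma simplices_homotopy_rel:
  assumes u: "u \<in> {0..1}" and "(p, q) \<in> realization_rel A"
  shows "(simplices_homotopy u p, simplices_homotopy u q) \<in> realization_rel A"
proof (rule realization_rel_map[OF _ assms(2)])
  fix p q assume "(p, q) \<in> glue A"
  then obtain m n \<alpha> \<sigma> t where *: "p = ((m, comp_fctr (ord_cat m) \<sigma> (ord_fctr m \<alpha>)), t)"
    "q = ((n, \<sigma>), simplex_push m \<alpha> t)" "mono_on {..m} \<alpha>" "\<alpha> \<in> {..m} \<rightarrow> {..n}"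
    "\<sigma> \<in> nerve A n" "t \<in> standard_simplex m"
    by (auto simp: glue_def)
  have "(simplices_homotopy u p, simplices_homotopy u q) \<in> glue A"
    unfolding glue_def mem_Collect_eq
    using * join_simplex_nerve join_weights_in_standard_simplex[OF _ u] join_ord_mono join_simplex_face
      simplex_push_join
    by (intro exI[of _ "2 * m + 1"] exI[of _ "2 * n + 1"] exI[of _ "join_ord m n \<alpha>"]
        exI[of _ "join_simplex n \<sigma>"] exI[of _ "join_weights m u t"])
      (simp add: simplices_homotopy_def)
  then show "(simplices_homotopy u p, simplices_homotopy u q) \<in> realization_rel A"
    by (rule glue_imp_realization_rel)
qed

lemma classifying_homotopy_class:
  "u \<in> {0..1} \<Longrightarrow>
    classifying_homotopy u (realization_rel A `` {p}) = realization_rel A `` {simplices_homotopy u p}"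
  unfolding classifying_homotopy_def by (intro realization_rel_image simplices_homotopy_rel)

text \<open>Used with the inclusions of the two copies of the vertices, that is, at the two ends of
  the homotopy.\<close>

lemma join_face_rel:
  assumes \<sigma>: "\<sigma> \<in> nerve A n" and t: "t \<in> standard_simplex n"
    and \<alpha>: "mono_on {..n} \<alpha>" "\<alpha> \<in> {..n} \<rightarrow> {..2 * n + 1}"
  shows "((n, fan A n (\<lambda>p. spokes n \<sigma> (\<alpha> p))), t) \<in> realization_rel A ``
      {((2 * n + 1, join_simplex n \<sigma>), simplex_push n \<alpha> t)}"
proof -
  have "(((n, comp_fctr (ord_cat n) (join_simplex n \<sigma>) (ord_fctr n \<alpha>)), t),
      ((2 * n + 1, join_simplex n \<sigma>), simplex_push n \<alpha> t)) \<in> glue A"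
    unfolding glue_def using \<alpha> t join_simplex_nerve[OF \<sigma>] by blast
  then show ?thesis
    using fan_face[OF spokes_arr[OF \<sigma>] \<alpha>]
    by (auto simp: join_simplex_def intro: realization_rel_sym glue_imp_realization_rel)
qed

lemma classifying_homotopy_0:
  assumes "c \<in> topspace (classifying_space A)" shows "classifying_homotopy 0 c = c"
proof -
  obtain p where p: "p \<in> topspace (simplex_space A)" "c = realization_rel A `` {p}"
    using assms by (rule classifying_space_cases)
  then obtain n \<sigma> t where n: "p = ((n, \<sigma>), t)" "\<sigma> \<in> nerve A n" "t \<in> standard_simplex n"
    by (auto simp: topspace_simplex_space)
  have "simplex_push n (\<lambda>i. i) t = join_weights n 0 t"
  proof
    fix j
    have "{i \<in> {..n}. i = j} = (if j \<le> n then {j} else {})" by auto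
    then show "simplex_push n (\<lambda>i. i) t j = join_weights n 0 t j"
      by (simp add: simplex_push_def join_weights_def)
  qed
  moreover have "fan A n (spokes n \<sigma>) = \<sigma>"
    using fan_simplex[OF n(2)] fan_cong[of n "spokes n \<sigma>" "\<lambda>p. amap \<sigma> (0, p)" A]
    by (simp add: spokes_def)
  ultimately have "(simplices_homotopy 0 p, p) \<in> realization_rel A"
    using join_face_rel[OF n(2,3), of "\<lambda>i. i"] n(1) by (simp add: simplices_homotopy_def monotone_on_def)
  then show ?thesis using p realization_class_eq by (simp add: classifying_homotopy_class)
qed

lemma classifying_homotopy_1:
  assumes "c \<in> topspace (classifying_space A)" shows "classifying_homotopy 1 c = classifying_map A P c"
proof -
  obtain p where p: "p \<in> topspace (simplex_space A)" "c = realization_rel A `` {p}"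
    using assms by (rule classifying_space_cases)
  then obtain n \<sigma> t where n: "p = ((n, \<sigma>), t)" "\<sigma> \<in> nerve A n" "t \<in> standard_simplex n"
    by (auto simp: topspace_simplex_space)
  have "simplex_push n (\<lambda>i. Suc (i + n)) t = join_weights n 1 t"
  proof
    fix j
    \<comment> \<open>Beyond \<open>2 * n + 1\<close> the fibre is empty, and the weights vanish as
      well because the coordinates of \<open>t\<close> do beyond \<open>n\<close>.\<close>
    have "{i \<in> {..n}. Suc (i + n) = j} = (if n < j \<and> j \<le> 2 * n + 1 then {j - Suc n} else {})" by auto
    then show "simplex_push n (\<lambda>i. Suc (i + n)) t j = join_weights n 1 t j"
      using n(3) by (auto simp: simplex_push_def join_weights_def standard_simplex_def)
  qed
  moreover have "fan A n (\<lambda>i. spokes n \<sigma> (Suc (i + n))) = comp_fctr (ord_cat n) P \<sigma>"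
  proof -
    have P\<sigma>: "comp_fctr (ord_cat n) P \<sigma> \<in> nerve A n" using nerve_comp_fctr[OF n(2) P] .
    \<comment> \<open>Naturality moves \<theta> to the source end: each spoke into the second copy
      becomes the image of a spoke under \<open>P\<close>, preceded by \<theta> at vertex 0. This
      common arrow is then cancelled.\<close>
    have "fan A n (\<lambda>i. spokes n \<sigma> (Suc (i + n))) = fan A n (\<lambda>i. Cmp A (amap P (amap \<sigma> (0, i))) (\<theta> (omap \<sigma> 0)))"
    proof (rule fan_cong)
      fix i assume "i \<le> n"
      then show "spokes n \<sigma> (Suc (i + n)) = Cmp A (amap P (amap \<sigma> (0, i))) (\<theta> (omap \<sigma> 0))"
        using \<theta>_nat[of "amap \<sigma> (0, i)"] nerve_arr[OF n(2), of 0 i] by (simp add: spokes_def)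
    qed
    also have "\<dots> = fan A n (\<lambda>i. amap P (amap \<sigma> (0, i)))"
      using \<theta>_arr[OF nerve_obj[OF n(2)]] nerve_arr[OF n(2)] is_functor_arr[OF P]
      by (intro fan_cmp_right) auto
    also have "\<dots> = fan A n (\<lambda>i. amap (comp_fctr (ord_cat n) P \<sigma>) (0, i))"
      by (intro fan_cong) simp
    finally show ?thesis using fan_simplex[OF P\<sigma>] by simp
  qed
  ultimately have "(simplices_homotopy 1 p, simplices_map P p) \<in> realization_rel A"
    using join_face_rel[OF n(2,3), of "\<lambda>i. Suc (i + n)"] n(1)
    by (simp add: simplices_homotopy_def simplices_map_def monotone_on_def)
  then show ?thesis using p realization_class_eq
    by (simp add: classifying_homotopy_class classifying_map_class[OF P])
qed

text \<open>A functor that preserves \<theta> preserves the spokes and hence the join simplex, while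
  the weights do not involve it. For the functors of a group action this keeps fixed points fixed
  during the homotopy.\<close>

lemma classifying_homotopy_equivariant:
  assumes F: "is_functor A A F" and F\<theta>: "\<And>x. x \<in> Obj A \<Longrightarrow> amap F (\<theta> x) = \<theta> (omap F x)"
    and u: "u \<in> {0..1}" and c: "c \<in> topspace (classifying_space A)"
  shows "classifying_map A F (classifying_homotopy u c) = classifying_homotopy u (classifying_map A F c)"
proof -
  obtain p where p: "p \<in> topspace (simplex_space A)" "c = realization_rel A `` {p}"
    using c by (rule classifying_space_cases)
  then obtain n \<sigma> t where n: "p = ((n, \<sigma>), t)" "\<sigma> \<in> nerve A n"
    by (auto simp: topspace_simplex_space)
  have "comp_fctr (ord_cat (2 * n + 1)) F (join_simplex n \<sigma>)
      = fan A (2 * n + 1) (\<lambda>p. amap F (spokes n \<sigma> p))"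
    unfolding join_simplex_def using spokes_arr[OF n(2)]
    by (intro fan_functor[OF groupoid_axioms F]) auto
  also have "\<dots> = join_simplex n (comp_fctr (ord_cat n) F \<sigma>)"
    unfolding join_simplex_def
  proof (rule fan_cong)
    fix p assume "p \<le> 2 * n + 1"
    then show "amap F (spokes n \<sigma> p) = spokes n (comp_fctr (ord_cat n) F \<sigma>) p"
      using is_functor_cmp[OF F, of "amap \<sigma> (0, p - Suc n)" "\<theta> (omap \<sigma> (p - Suc n))"]
        nerve_arr[OF n(2), of 0 "p - Suc n"] \<theta>_arr[OF nerve_obj[OF n(2), of "p - Suc n"]]
        F\<theta>[OF nerve_obj[OF n(2), of "p - Suc n"]]
      by (auto simp: spokes_def)
  qed
  finally have "simplices_map F (simplices_homotopy u p) = simplices_homotopy u (simplices_map F p)"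
    by (simp add: simplices_homotopy_def simplices_map_def n)
  then show ?thesis using p u by (simp add: classifying_map_class[OF F] classifying_homotopy_class)
qed

lemma continuous_map_classifying_homotopy:
  "continuous_map (prod_topology unit_interval (classifying_space A)) (classifying_space A)
     (\<lambda>(u, c). classifying_homotopy u c)"
proof -
  let ?X = "\<lambda>(n, \<sigma>). subtopology (powertop_real UNIV) (standard_simplex n)"
  let ?I = "SIGMA n:UNIV. nerve A n"
  have sp: "continuous_map (prod_topology unit_interval (simplex_space A)) (simplex_space A)
      (\<lambda>(u, p). simplices_homotopy u p)"
  proof (subst simplex_space_def, rule continuous_map_prod_sum_topology)
    fix i assume i: "i \<in> ?I"
    obtain n \<sigma> where n: "i = (n, \<sigma>)" by fastforce
    have j: "(2 * n + 1, join_simplex n \<sigma>) \<in> ?I" using i n join_simplex_nerve by auto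
    let ?Q = "prod_topology unit_interval (subtopology (powertop_real UNIV) (standard_simplex n))"
    have pr: "continuous_map ?Q euclideanreal fst" "continuous_map ?Q euclideanreal (\<lambda>q. snd q k)" for k
    proof -
      show "continuous_map ?Q euclideanreal fst"
        by (metis continuous_map_fst continuous_map_in_subtopology)
      have "continuous_map ?Q (powertop_real UNIV) snd"
        by (metis continuous_map_snd continuous_map_in_subtopology)
      from continuous_map_compose[OF this continuous_map_product_projection[of k UNIV]]
      show "continuous_map ?Q euclideanreal (\<lambda>q. snd q k)" by (simp add: o_def)
    qed
    have "continuous_map ?Q euclideanreal (\<lambda>q. join_weights n (fst q) (snd q) k)" for k
      unfolding join_weights_def using pr
      by (auto intro!: continuous_map_real_mult continuous_map_diff)
    then have "continuous_map ?Q (?X (2 * n + 1, join_simplex n \<sigma>)) (\<lambda>q. join_weights n (fst q) (snd q))"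
      using join_weights_in_standard_simplex
      by (auto simp: continuous_map_in_subtopology continuous_map_componentwise_UNIV)
    moreover have "continuous_map (?X (2 * n + 1, join_simplex n \<sigma>)) (simplex_space A)
        (Pair (2 * n + 1, join_simplex n \<sigma>))"
      unfolding simplex_space_def using j by (rule continuous_map_component_injection)
    ultimately have "continuous_map ?Q (simplex_space A)
        (Pair (2 * n + 1, join_simplex n \<sigma>) \<circ> (\<lambda>q. join_weights n (fst q) (snd q)))"
      by (rule continuous_map_compose)
    then show "continuous_map (prod_topology unit_interval (?X i)) (simplex_space A)
        (\<lambda>(u, t). simplices_homotopy u (i, t))"
      by (simp add: n o_def split_def simplices_homotopy_def)
  qed
  \<comment> \<open>The interval is locally compact Hausdorff, so its product with the quotient map
    of the realization is again a quotient map, and continuity can be tested on simplices.\<close>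
  have "locally_compact_space unit_interval" "Hausdorff_space unit_interval"
    by (auto intro!: compact_imp_locally_compact_space Hausdorff_space_subtopology
        simp: compact_space_subtopology)
  then have q: "quotient_map (prod_topology unit_interval (simplex_space A))
      (prod_topology unit_interval (classifying_space A)) (\<lambda>(u, p). (u, realization_rel A `` {p}))"
    by (intro quotient_map_prod_right quotient_map_classifying_space) auto
  show ?thesis
  proof (rule continuous_compose_quotient_map[OF q])
    from continuous_map_compose[OF sp quotient_imp_continuous_map[OF quotient_map_classifying_space]]
    show "continuous_map (prod_topology unit_interval (simplex_space A)) (classifying_space A)
        ((\<lambda>(u, c). classifying_homotopy u c) \<circ> (\<lambda>(u, p). (u, realization_rel A `` {p})))"
      by (rule continuous_map_eq) (auto simp: classifying_homotopy_class)
  qed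
qed

end

section \<open>Equivariant equivalences of categories\<close>

lemma topspace_fixed_classifying_space:
  "topspace (fixed_classifying_space C H)
     = {c \<in> topspace (classifying_space C). \<forall>h\<in>H. classifying_map C (gact C h) c = c}"
  by (auto simp: fixed_classifying_space_def)

lemma (in equivariant_functor) continuous_map_fixed_classifying_space:
  assumes "subgroup H G"
  shows "continuous_map (fixed_classifying_space C H) (fixed_classifying_space D H) (classifying_map D F)"
proof -
  have "classifying_map D (gact D h) (classifying_map D F c) = classifying_map D F c"
    if c: "c \<in> topspace (fixed_classifying_space C H)" and h: "h \<in> H" for c h
  proof -
    have hG: "h \<in> carrier G" using assms h by (rule subgroup.mem_carrier)
    have c': "c \<in> topspace (classifying_space C)" and ch: "classifying_map C (gact C h) c = c"
      using c h by (auto simp: topspace_fixed_classifying_space)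
    have "classifying_map D (gact D h) (classifying_map D F c)
        = classifying_map D (comp_fctr C F (gact C h)) c"
      using classifying_map_comp[OF is_functor D.gact_functor[OF hG] C.category_axioms c'] equivariant[OF hG]
      by simp
    also have "\<dots> = classifying_map D F (classifying_map C (gact C h) c)"
      using classifying_map_comp[OF C.gact_functor[OF hG] is_functor C.category_axioms c'] by simp
    finally show ?thesis using ch by simp
  qed
  then show ?thesis
    unfolding fixed_classifying_space_def[of D]
    using continuous_map_from_subtopology[OF continuous_map_classifying_map[OF is_functor]]
    by (auto simp: continuous_map_in_subtopology fixed_classifying_space_def[of C])
qed

theorem weak_G_equivalence_of_section:
  assumes F: "equivariant_functor G A B F" and S: "equivariant_functor G B A S"
    and A: "groupoid A" and FS: "comp_fctr B F S = id_fctr B"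
    and \<theta>: "nat_trans A A (id_fctr A) (comp_fctr A S F) \<theta>"
    and \<theta>_equivariant: "\<And>g x. \<lbrakk>g \<in> carrier G; x \<in> Obj A\<rbrakk> \<Longrightarrow> amap (gact A g) (\<theta> x) = \<theta> (omap (gact A g) x)"
  shows "weak_G_equivalence G A B F"
  unfolding weak_G_equivalence_def
proof (intro conjI allI impI)
  show "equivariant_functor G A B F" by fact
  interpret F: equivariant_functor G A B F by fact
  interpret S: equivariant_functor G B A S by fact
  interpret A: groupoid A by fact
  let ?P = "comp_fctr A S F"
  interpret T: groupoid_transformation A ?P \<theta>
    using F.C.is_functor_comp[OF F.is_functor S.is_functor] \<theta> by unfold_locales
  fix H assume H: "subgroup H G"
  let ?X = "fixed_classifying_space A H"
  have X: "c \<in> topspace (classifying_space A)" if "c \<in> topspace ?X" for c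
    using that by (simp add: topspace_fixed_classifying_space)
  show "weak_homotopy_equivalence ?X (fixed_classifying_space B H) (classifying_map B F)"
  proof (rule weak_homotopy_equivalence_of_section)
    show "continuous_map ?X (fixed_classifying_space B H) (classifying_map B F)"
      using H by (rule F.continuous_map_fixed_classifying_space)
    show "continuous_map (fixed_classifying_space B H) ?X (classifying_map A S)"
      using H by (rule S.continuous_map_fixed_classifying_space)
    show "classifying_map B F (classifying_map A S c) = c"
      if "c \<in> topspace (fixed_classifying_space B H)" for c
      using that classifying_map_comp[OF S.is_functor F.is_functor F.D.category_axioms, of c]
        classifying_map_id[OF F.D.category_axioms, of c]
      by (simp add: topspace_fixed_classifying_space FS)
    show "T.classifying_homotopy 0 c = c" if "c \<in> topspace ?X" for c
      using T.classifying_homotopy_0 X[OF that] .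
    show "T.classifying_homotopy 1 c = classifying_map A S (classifying_map B F c)"
      if "c \<in> topspace ?X" for c
      using T.classifying_homotopy_1 X[OF that]
        classifying_map_comp[OF F.is_functor S.is_functor F.C.category_axioms X[OF that]] by simp
    have "T.classifying_homotopy u c \<in> {c. \<forall>h\<in>H. classifying_map A (gact A h) c = c}"
      if "u \<in> {0..1}" "c \<in> topspace ?X" for u c
    proof (clarsimp)
      fix h assume h: "h \<in> H"
      then have hG: "h \<in> carrier G" using H by (meson subgroup.mem_carrier)
      have "classifying_map A (gact A h) c = c"
        using h that(2) by (simp add: topspace_fixed_classifying_space)
      then show "classifying_map A (gact A h) (T.classifying_homotopy u c) = T.classifying_homotopy u c"
        using T.classifying_homotopy_equivariant[OF F.C.gact_functor[OF hG] \<theta>_equivariant[OF hG] that(1) X[OF that(2)]]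
        by simp
    qed
    moreover have "continuous_map (prod_topology unit_interval ?X) (classifying_space A)
        (\<lambda>(u, c). T.classifying_homotopy u c)"
      using continuous_map_from_subtopology[OF T.continuous_map_classifying_homotopy]
      by (simp add: fixed_classifying_space_def prod_topology_subtopology)
    ultimately show "continuous_map (prod_topology unit_interval ?X) ?X (\<lambda>(u, c). T.classifying_homotopy u c)"
      by (subst (2) fixed_classifying_space_def) (auto simp: continuous_map_in_subtopology)
  qed
qed

section \<open>Fully faithful equivariant functors\<close>

context gcategory
begin

lemma gact_obj: "\<lbrakk>g \<in> carrier G; x \<in> Obj C\<rbrakk> \<Longrightarrow> omap (gact C g) x \<in> Obj C"
  by (rule is_functor_obj[OF gact_functor])

lemmas gact_arr = is_functor_arr[OF gact_functor]
lemmas gact_idt = is_functor_idt[OF gact_functor]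
lemmas gact_cmp = is_functor_cmp[OF gact_functor]

lemma gact_one_obj: "x \<in> Obj C \<Longrightarrow> omap (gact C \<one>) x = x"
  and gact_one_arr: "f \<in> Arr C \<Longrightarrow> amap (gact C \<one>) f = f"
  by (simp_all add: gact_one)

lemma gact_mult_obj:
  "\<lbrakk>g \<in> carrier G; h \<in> carrier G; x \<in> Obj C\<rbrakk>
     \<Longrightarrow> omap (gact C (g \<otimes> h)) x = omap (gact C g) (omap (gact C h) x)"
  and gact_mult_arr:
  "\<lbrakk>g \<in> carrier G; h \<in> carrier G; f \<in> Arr C\<rbrakk>
     \<Longrightarrow> amap (gact C (g \<otimes> h)) f = amap (gact C g) (amap (gact C h) f)"
  by (simp_all add: gact_mult)

end

context equivariant_functor
begin

lemmas F_obj = is_functor_obj[OF is_functor]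
lemmas F_arr = is_functor_arr[OF is_functor]
lemmas F_idt = is_functor_idt[OF is_functor]
lemmas F_cmp = is_functor_cmp[OF is_functor]

lemma equivariant_obj:
  assumes "g \<in> carrier G" "x \<in> Obj C"
  shows "omap F (omap (gact C g) x) = omap (gact D g) (omap F x)"
  using arg_cong[OF equivariant[OF assms(1)], of "\<lambda>K. omap K x"] assms by simp

lemma equivariant_arr:
  assumes "g \<in> carrier G" "f \<in> Arr C"
  shows "amap F (amap (gact C g) f) = amap (gact D g) (amap F f)"
  using arg_cong[OF equivariant[OF assms(1)], of "\<lambda>K. amap K f"] assms by simp

end

text \<open>Existence is fullness and uniqueness is faithfulness; together they make
  \<open>lift\<close> well defined.\<close>

locale fully_faithful_functor = equivariant_functor G C D F
  for G :: "('g, 'x) monoid_scheme" (structure)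
    and C :: "('g, 'o, 'a, 'y) gcat_scheme" and D :: "('g, 'p, 'b, 'z) gcat_scheme"
    and F :: "('o, 'a, 'p, 'b) fctr" +
  assumes fully_faithful: "\<lbrakk>a \<in> Obj C; b \<in> Obj C; \<beta> \<in> Arr D; Src D \<beta> = omap F a; Tgt D \<beta> = omap F b\<rbrakk>
    \<Longrightarrow> \<exists>!f. f \<in> Arr C \<and> Src C f = a \<and> Tgt C f = b \<and> amap F f = \<beta>"
begin

definition lift :: "'o \<Rightarrow> 'o \<Rightarrow> 'b \<Rightarrow> 'a" where
  "lift a b \<beta> = (THE f. f \<in> Arr C \<and> Src C f = a \<and> Tgt C f = b \<and> amap F f = \<beta>)"

lemma lift:
  assumes "a \<in> Obj C" "b \<in> Obj C" "\<beta> \<in> Arr D" "Src D \<beta> = omap F a" "Tgt D \<beta> = omap F b"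
  shows "lift a b \<beta> \<in> Arr C" "Src C (lift a b \<beta>) = a" "Tgt C (lift a b \<beta>) = b" "amap F (lift a b \<beta>) = \<beta>"
  using theI'[OF fully_faithful[OF assms], folded lift_def] by auto

lemma faithful:
  assumes "f \<in> Arr C" "f' \<in> Arr C" "Src C f = Src C f'" "Tgt C f = Tgt C f'" "amap F f = amap F f'"
  shows "f = f'"
  using fully_faithful[of "Src C f" "Tgt C f" "amap F f"] assms C.src_closed C.tgt_closed F_arr
  by metis

text \<open>Arrows lift uniquely, so a section on objects extends to a functor. The component of
  \<theta> at \<open>x\<close> is the lift of an identity, as \<open>x\<close> and
  \<open>s (F x)\<close> have the same image. Equations between arrows, equivariance included, hold
  because both sides are parallel and agree after \<open>F\<close>.\<close>

lemma weak_G_equivalence_of_object_section: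
  assumes groupoid: "groupoid C"
    and s: "\<And>b. b \<in> Obj D \<Longrightarrow> s b \<in> Obj C" "\<And>b. b \<in> Obj D \<Longrightarrow> omap F (s b) = b"
    and s_equivariant: "\<And>g b. \<lbrakk>g \<in> carrier G; b \<in> Obj D\<rbrakk> \<Longrightarrow> s (omap (gact D g) b) = omap (gact C g) (s b)"
  shows "weak_G_equivalence G C D F"
proof -
  define S where "S = \<lparr>omap = \<lambda>b\<in>Obj D. s b, amap = \<lambda>\<beta>\<in>Arr D. lift (s (Src D \<beta>)) (s (Tgt D \<beta>)) \<beta>\<rparr>"
  define \<theta> where "\<theta> = (\<lambda>x\<in>Obj C. lift x (s (omap F x)) (Idt D (omap F x)))"
  have S_obj: "omap S b = s b" if "b \<in> Obj D" for b using that by (simp add: S_def)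
  have S_arr: "amap S \<beta> \<in> Arr C" "Src C (amap S \<beta>) = s (Src D \<beta>)" "Tgt C (amap S \<beta>) = s (Tgt D \<beta>)"
    "amap F (amap S \<beta>) = \<beta>" if "\<beta> \<in> Arr D" for \<beta>
    using that lift[of "s (Src D \<beta>)" "s (Tgt D \<beta>)" \<beta>] s D.src_closed D.tgt_closed by (auto simp: S_def)
  have S: "is_functor D C S"
    unfolding is_functor_def
  proof (intro conjI ballI impI)
    show "omap S \<in> Obj D \<rightarrow>\<^sub>E Obj C" using s by (auto simp: S_def)
    have "amap S \<in> extensional (Arr D)" by (simp add: S_def)
    then show "amap S \<in> Arr D \<rightarrow>\<^sub>E Arr C" using S_arr(1) by (simp add: PiE_def)
    show "Src C (amap S \<beta>) = omap S (Src D \<beta>)" "Tgt C (amap S \<beta>) = omap S (Tgt D \<beta>)" if "\<beta> \<in> Arr D" for \<beta>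
      using that S_arr S_obj D.src_closed D.tgt_closed by auto
    show "amap S (Idt D b) = Idt C (omap S b)" if "b \<in> Obj D" for b
      using that D.idt[OF that] C.idt[OF s(1)[OF that]] S_arr[of "Idt D b"] S_obj[OF that] s F_idt
      by (intro faithful) auto
    show "amap S (Cmp D \<gamma> \<beta>) = Cmp C (amap S \<gamma>) (amap S \<beta>)"
      if "\<beta> \<in> Arr D" "\<gamma> \<in> Arr D" "Tgt D \<beta> = Src D \<gamma>" for \<beta> \<gamma>
      using that D.cmp[OF that] C.cmp[of "amap S \<beta>" "amap S \<gamma>"] S_arr F_cmp[of "amap S \<beta>" "amap S \<gamma>"]
      by (intro faithful) auto
  qed
  have S_equivariant: "equivariant_functor G D C S"
  proof unfold_locales
    fix g assume g: "g \<in> carrier G"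
    show "comp_fctr D S (gact D g) = comp_fctr D (gact C g) S"
    proof (rule functor_eqI)
      show "is_functor D C (comp_fctr D S (gact D g))" "is_functor D C (comp_fctr D (gact C g) S)"
        using D.is_functor_comp D.gact_functor[OF g] C.gact_functor[OF g] S by blast+
      show "omap (comp_fctr D S (gact D g)) b = omap (comp_fctr D (gact C g) S) b" if "b \<in> Obj D" for b
        using that g s_equivariant S_obj D.gact_obj by simp
      show "amap (comp_fctr D S (gact D g)) \<beta> = amap (comp_fctr D (gact C g) S) \<beta>" if b: "\<beta> \<in> Arr D" for \<beta>
        using b D.gact_arr[OF g b] C.gact_arr[OF g S_arr(1)[OF b]] S_arr[OF b]
          S_arr[OF D.gact_arr(1)[OF g b]] equivariant_arr[OF g S_arr(1)[OF b]]
          s_equivariant[OF g] D.src_closed D.tgt_closed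
        by (intro faithful) auto
    qed
  qed (rule S)
  have FS: "comp_fctr D F S = id_fctr D"
    using D.is_functor_comp[OF S is_functor] D.is_functor_id s S_obj S_arr
    by (intro functor_eqI) auto
  have \<theta>: "\<theta> x \<in> Arr C" "Src C (\<theta> x) = x" "Tgt C (\<theta> x) = s (omap F x)" "amap F (\<theta> x) = Idt D (omap F x)"
    if "x \<in> Obj C" for x
    using that lift[of x "s (omap F x)" "Idt D (omap F x)"] s F_obj D.idt by (auto simp: \<theta>_def)
  have SF: "amap (comp_fctr C S F) f = amap S (amap F f)" if "f \<in> Arr C" for f
    using that by simp
  have \<theta>_nat: "nat_trans C C (id_fctr C) (comp_fctr C S F) \<theta>"
    unfolding nat_trans_def
  proof (intro conjI ballI)
    have "\<theta> \<in> extensional (Obj C)" by (simp add: \<theta>_def)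
    then show "\<theta> \<in> Obj C \<rightarrow>\<^sub>E Arr C" using \<theta>(1) by (simp add: PiE_def)
    show "Src C (\<theta> x) = omap (id_fctr C) x" "Tgt C (\<theta> x) = omap (comp_fctr C S F) x" if "x \<in> Obj C" for x
      using that \<theta> S_obj F_obj by auto
    show "Cmp C (\<theta> (Tgt C f)) (amap (id_fctr C) f) = Cmp C (amap (comp_fctr C S F) f) (\<theta> (Src C f))"
      if f: "f \<in> Arr C" for f
    proof (rule faithful)
      note st = C.src_closed[OF f] C.tgt_closed[OF f]
      note * = \<theta>[OF st(1)] \<theta>[OF st(2)] S_arr[OF F_arr(1)[OF f]] F_arr[OF f]
      have 1: "Cmp C (\<theta> (Tgt C f)) f \<in> Arr C" "Src C (Cmp C (\<theta> (Tgt C f)) f) = Src C f"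
        "Tgt C (Cmp C (\<theta> (Tgt C f)) f) = s (omap F (Tgt C f))"
        using C.cmp[of f "\<theta> (Tgt C f)"] * f by auto
      have 2: "Cmp C (amap S (amap F f)) (\<theta> (Src C f)) \<in> Arr C"
        "Src C (Cmp C (amap S (amap F f)) (\<theta> (Src C f))) = Src C f"
        "Tgt C (Cmp C (amap S (amap F f)) (\<theta> (Src C f))) = s (omap F (Tgt C f))"
        using C.cmp[of "\<theta> (Src C f)" "amap S (amap F f)"] * f by auto
      show "Cmp C (\<theta> (Tgt C f)) (amap (id_fctr C) f) \<in> Arr C"
        "Cmp C (amap (comp_fctr C S F) f) (\<theta> (Src C f)) \<in> Arr C"
        "Src C (Cmp C (\<theta> (Tgt C f)) (amap (id_fctr C) f)) = Src C (Cmp C (amap (comp_fctr C S F) f) (\<theta> (Src C f)))"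
        "Tgt C (Cmp C (\<theta> (Tgt C f)) (amap (id_fctr C) f)) = Tgt C (Cmp C (amap (comp_fctr C S F) f) (\<theta> (Src C f)))"
        using f 1 2 by simp_all
      \<comment> \<open>The components of \<theta> lie over identities, so both composites of the
        naturality square lie over \<open>amap F f\<close>.\<close>
      have "amap F (Cmp C (\<theta> (Tgt C f)) f) = amap F f"
        using F_cmp[of f "\<theta> (Tgt C f)"] * f D.cmp_idt_left[of "amap F f"] by simp
      moreover have "amap F (Cmp C (amap S (amap F f)) (\<theta> (Src C f))) = amap F f"
        using F_cmp[of "\<theta> (Src C f)" "amap S (amap F f)"] * f D.cmp_idt_right[of "amap F f"] by simp
      ultimately show "amap F (Cmp C (\<theta> (Tgt C f)) (amap (id_fctr C) f))
          = amap F (Cmp C (amap (comp_fctr C S F) f) (\<theta> (Src C f)))"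
        using f by simp
    qed
  qed
  show ?thesis
  proof (rule weak_G_equivalence_of_section[OF equivariant_functor_axioms S_equivariant groupoid FS \<theta>_nat])
    fix g x assume g: "g \<in> carrier G" and x: "x \<in> Obj C"
    show "amap (gact C g) (\<theta> x) = \<theta> (omap (gact C g) x)"
      using \<theta>[OF x] \<theta>[OF C.gact_obj[OF g x]] C.gact_arr[OF g \<theta>(1)[OF x]] s_equivariant[OF g F_obj[OF x]]
        equivariant_obj[OF g x] equivariant_arr[OF g \<theta>(1)[OF x]] D.gact_idt[OF g F_obj[OF x]]
      by (intro faithful) auto
  qed
qed

end

section \<open>Functor categories\<close>

lemma Cat_gcat_simps [simp]:
  "Obj (Cat_gcat G C D) = {F. is_functor C D F}"
  "Arr (Cat_gcat G C D) = {(F, F', \<eta>). is_functor C D F \<and> is_functor C D F' \<and> nat_trans C D F F' \<eta>}"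
  "Src (Cat_gcat G C D) (F, F', \<eta>) = F"
  "Tgt (Cat_gcat G C D) (F, F', \<eta>) = F'"
  "Idt (Cat_gcat G C D) F = (F, F, \<lambda>x\<in>Obj C. Idt D (omap F x))"
  "Cmp (Cat_gcat G C D) (K, K', \<eta>') (F, F', \<eta>) = (F, K', \<lambda>x\<in>Obj C. Cmp D (\<eta>' x) (\<eta> x))"
  by (simp_all add: Cat_gcat_def Let_def)

lemma Cat_gcat_gact [simp]:
  "is_functor C D F \<Longrightarrow> omap (gact (Cat_gcat G C D) g) F = conj_fctr G C D g F"
  "\<lbrakk>is_functor C D F; is_functor C D F'; nat_trans C D F F' \<eta>\<rbrakk>
     \<Longrightarrow> amap (gact (Cat_gcat G C D) g) (F, F', \<eta>) = (conj_fctr G C D g F, conj_fctr G C D g F',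
       \<lambda>x\<in>Obj C. amap (gact D g) (\<eta> (omap (gact C (inv\<^bsub>G\<^esub> g)) x)))"
  by (simp_all add: Cat_gcat_def Let_def)

lemma Cat_gcat_gact_extensional:
  "omap (gact (Cat_gcat G C D) g) \<in> extensional (Obj (Cat_gcat G C D))"
  "amap (gact (Cat_gcat G C D) g) \<in> extensional (Arr (Cat_gcat G C D))"
  by (simp_all add: Cat_gcat_def Let_def)

lemma nat_trans_arr:
  assumes "nat_trans C D F F' \<eta>" "x \<in> Obj C"
  shows "\<eta> x \<in> Arr D" "Src D (\<eta> x) = omap F x" "Tgt D (\<eta> x) = omap F' x"
  using assms by (auto simp: nat_trans_def)

lemma nat_trans_nat:
  "\<lbrakk>nat_trans C D F F' \<eta>; f \<in> Arr C\<rbrakk> \<Longrightarrow> Cmp D (\<eta> (Tgt C f)) (amap F f) = Cmp D (amap F' f) (\<eta> (Src C f))"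
  by (simp add: nat_trans_def)

lemma nat_transI:
  assumes "\<eta> \<in> extensional (Obj C)"
    and "\<And>x. x \<in> Obj C \<Longrightarrow> \<eta> x \<in> Arr D \<and> Src D (\<eta> x) = omap F x \<and> Tgt D (\<eta> x) = omap F' x"
    and "\<And>f. f \<in> Arr C \<Longrightarrow> Cmp D (\<eta> (Tgt C f)) (amap F f) = Cmp D (amap F' f) (\<eta> (Src C f))"
  shows "nat_trans C D F F' \<eta>"
  using assms by (auto simp: nat_trans_def PiE_def)

lemma nat_trans_eqI:
  assumes "nat_trans C D F F' \<eta>" "nat_trans C D K K' \<eta>'" "\<And>x. x \<in> Obj C \<Longrightarrow> \<eta> x = \<eta>' x"
  shows "\<eta> = \<eta>'"
  using assms by (intro extensionalityI[of _ "Obj C"]) (auto simp: nat_trans_def PiE_def)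

locale gcategory_pair = C: gcategory G C + D: gcategory G D
  for G :: "('g, 'x) monoid_scheme" (structure)
    and C :: "('g, 'o, 'a, 'y) gcat_scheme" and D :: "('g, 'p, 'b, 'z) gcat_scheme"
begin

lemma nat_trans_idt:
  assumes F: "is_functor C D F" shows "nat_trans C D F F (\<lambda>x\<in>Obj C. Idt D (omap F x))" (is "nat_trans C D F F ?\<iota>")
proof (rule nat_transI)
  show "?\<iota> x \<in> Arr D \<and> Src D (?\<iota> x) = omap F x \<and>
      Tgt D (?\<iota> x) = omap F x" if "x \<in> Obj C" for x
    using that D.idt[OF is_functor_obj[OF F that]] by simp
  show "Cmp D (?\<iota> (Tgt C f)) (amap F f)
      = Cmp D (amap F f) (?\<iota> (Src C f))" if f: "f \<in> Arr C" for f
    using C.src_closed[OF f] C.tgt_closed[OF f] is_functor_arr[OF F f]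
      D.cmp_idt_left[OF is_functor_arr(1)[OF F f]] D.cmp_idt_right[OF is_functor_arr(1)[OF F f]] by simp
qed simp

lemma nat_trans_cmp:
  assumes F: "is_functor C D F" "is_functor C D F'" "is_functor C D F''"
    and \<eta>: "nat_trans C D F F' \<eta>" and \<eta>': "nat_trans C D F' F'' \<eta>'"
  shows "nat_trans C D F F'' (\<lambda>x\<in>Obj C. Cmp D (\<eta>' x) (\<eta> x))" (is "nat_trans C D F F'' ?\<mu>")
proof (rule nat_transI)
  show "?\<mu> x \<in> Arr D \<and>
      Src D (?\<mu> x) = omap F x \<and>
      Tgt D (?\<mu> x) = omap F'' x" if "x \<in> Obj C" for x
    using that nat_trans_arr[OF \<eta> that] nat_trans_arr[OF \<eta>' that] D.cmp[of "\<eta> x" "\<eta>' x"] by simp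
  show "Cmp D (?\<mu> (Tgt C f)) (amap F f)
      = Cmp D (amap F'' f) (?\<mu> (Src C f))" if f: "f \<in> Arr C" for f
  proof -
    note st = C.src_closed[OF f] C.tgt_closed[OF f]
    note * = nat_trans_arr[OF \<eta> st(1)] nat_trans_arr[OF \<eta> st(2)] nat_trans_arr[OF \<eta>' st(1)]
      nat_trans_arr[OF \<eta>' st(2)] is_functor_arr[OF F(1) f] is_functor_arr[OF F(2) f] is_functor_arr[OF F(3) f]
    have "Cmp D (Cmp D (\<eta>' (Tgt C f)) (\<eta> (Tgt C f))) (amap F f)
        = Cmp D (\<eta>' (Tgt C f)) (Cmp D (\<eta> (Tgt C f)) (amap F f))"
      using * by (simp add: D.cmp_assoc)
    also have "\<dots> = Cmp D (\<eta>' (Tgt C f)) (Cmp D (amap F' f) (\<eta> (Src C f)))"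
      using nat_trans_nat[OF \<eta> f] by simp
    also have "\<dots> = Cmp D (Cmp D (\<eta>' (Tgt C f)) (amap F' f)) (\<eta> (Src C f))"
      using * by (simp add: D.cmp_assoc)
    also have "\<dots> = Cmp D (Cmp D (amap F'' f) (\<eta>' (Src C f))) (\<eta> (Src C f))"
      using nat_trans_nat[OF \<eta>' f] by simp
    also have "\<dots> = Cmp D (amap F'' f) (Cmp D (\<eta>' (Src C f)) (\<eta> (Src C f)))"
      using * by (simp add: D.cmp_assoc)
    finally show ?thesis using st by simp
  qed
qed simp

lemma category_Cat: "category (Cat_gcat G C D)" (is "category ?K")
proof
  fix a assume a: "a \<in> Arr ?K"
  then obtain F F' \<eta> where a': "a = (F, F', \<eta>)" "is_functor C D F" "is_functor C D F'" "nat_trans C D F F' \<eta>"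
    by auto
  note \<eta> = nat_trans_arr[OF a'(4)]
  show "Src ?K a \<in> Obj ?K" "Tgt ?K a \<in> Obj ?K" using a' by auto
  have "(\<lambda>x\<in>Obj C. Cmp D (\<eta> x) ((\<lambda>x\<in>Obj C. Idt D (omap F x)) x)) = \<eta>"
    using \<eta> D.cmp_idt_right[OF \<eta>(1)]
    by (intro nat_trans_eqI[OF nat_trans_cmp[OF a'(2,2,3) nat_trans_idt[OF a'(2)] a'(4)] a'(4)]) simp
  then show "Cmp ?K a (Idt ?K (Src ?K a)) = a" using a' by simp
  have "(\<lambda>x\<in>Obj C. Cmp D ((\<lambda>x\<in>Obj C. Idt D (omap F' x)) x) (\<eta> x)) = \<eta>"
    using \<eta> D.cmp_idt_left[OF \<eta>(1)]
    by (intro nat_trans_eqI[OF nat_trans_cmp[OF a'(2,3,3,4) nat_trans_idt[OF a'(3)]] a'(4)]) simp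
  then show "Cmp ?K (Idt ?K (Tgt ?K a)) a = a" using a' by simp
  fix b assume b: "b \<in> Arr ?K" "Tgt ?K a = Src ?K b"
  then obtain F'' \<eta>' where b': "b = (F', F'', \<eta>')" "is_functor C D F''" "nat_trans C D F' F'' \<eta>'"
    using a' by auto
  show "Cmp ?K b a \<in> Arr ?K \<and> Src ?K (Cmp ?K b a) = Src ?K a \<and> Tgt ?K (Cmp ?K b a) = Tgt ?K b"
    using a' b' nat_trans_cmp by simp
  fix c assume c: "c \<in> Arr ?K" "Tgt ?K b = Src ?K c"
  then obtain F''' \<eta>'' where c': "c = (F'', F''', \<eta>'')" "is_functor C D F'''" "nat_trans C D F'' F''' \<eta>''"
    using b' by auto
  show "Cmp ?K c (Cmp ?K b a) = Cmp ?K (Cmp ?K c b) a"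
    using a' b' c' \<eta> nat_trans_arr[OF b'(3)] nat_trans_arr[OF c'(3)] D.cmp_assoc
    by (auto intro!: restrict_ext)
next
  fix F assume "F \<in> Obj ?K"
  then show "Idt ?K F \<in> Arr ?K \<and>
      Src ?K (Idt ?K F) = F \<and> Tgt ?K (Idt ?K F) = F"
    using nat_trans_idt by simp
qed

lemma conj_fctr_simps:
  assumes "g \<in> carrier G"
  shows "x \<in> Obj C \<Longrightarrow> omap (conj_fctr G C D g F) x = omap (gact D g) (omap F (omap (gact C (inv g)) x))"
    "f \<in> Arr C \<Longrightarrow> amap (conj_fctr G C D g F) f = amap (gact D g) (amap F (amap (gact C (inv g)) f))"
  using assms by (simp_all add: conj_fctr_def C.gact_obj C.gact_arr)

lemma is_functor_conj:
  "\<lbrakk>g \<in> carrier G; is_functor C D F\<rbrakk> \<Longrightarrow> is_functor C D (conj_fctr G C D g F)"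
  unfolding conj_fctr_def
  by (intro C.is_functor_comp[OF C.is_functor_comp]) (auto simp: C.gact_functor D.gact_functor)

lemma nat_trans_conj:
  assumes g: "g \<in> carrier G" and F: "is_functor C D F" "is_functor C D F'" and \<eta>: "nat_trans C D F F' \<eta>"
  shows "nat_trans C D (conj_fctr G C D g F) (conj_fctr G C D g F')
    (\<lambda>x\<in>Obj C. amap (gact D g) (\<eta> (omap (gact C (inv g)) x)))" (is "nat_trans C D ?gF ?gF' ?\<mu>")
proof (rule nat_transI)
  have g': "inv g \<in> carrier G" using g by simp
  note [simp] = conj_fctr_simps[OF g]
  fix x assume x: "x \<in> Obj C"
  show "?\<mu> x \<in> Arr D \<and>
      Src D (?\<mu> x) = omap ?gF x \<and>
      Tgt D (?\<mu> x) = omap ?gF' x"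
    using x nat_trans_arr[OF \<eta> C.gact_obj[OF g' x]] D.gact_arr[OF g] by simp
next
  have g': "inv g \<in> carrier G" using g by simp
  note [simp] = conj_fctr_simps[OF g]
  fix f assume f: "f \<in> Arr C"
  let ?f = "amap (gact C (inv g)) f"
  note f' = C.gact_arr[OF g' f]
  note st = C.src_closed[OF f] C.tgt_closed[OF f] C.gact_obj[OF g' C.src_closed[OF f]]
    C.gact_obj[OF g' C.tgt_closed[OF f]]
  note * = nat_trans_arr[OF \<eta> st(3)] nat_trans_arr[OF \<eta> st(4)] is_functor_arr[OF F(1) f'(1)] is_functor_arr[OF F(2) f'(1)]
  have "Cmp D (amap (gact D g) (\<eta> (Tgt C ?f))) (amap (gact D g) (amap F ?f))
      = amap (gact D g) (Cmp D (\<eta> (Tgt C ?f)) (amap F ?f))"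
    using * f' D.gact_cmp[OF g] by simp
  also have "\<dots> = amap (gact D g) (Cmp D (amap F' ?f) (\<eta> (Src C ?f)))"
    using nat_trans_nat[OF \<eta> f'(1)] by simp
  also have "\<dots> = Cmp D (amap (gact D g) (amap F' ?f)) (amap (gact D g) (\<eta> (Src C ?f)))"
    using * f' D.gact_cmp[OF g] by simp
  finally show "Cmp D (?\<mu> (Tgt C f)) (amap ?gF f)
      = Cmp D (amap ?gF' f) (?\<mu> (Src C f))"
    using f st f' by simp
qed simp

lemma conj_fctr_one:
  assumes F: "is_functor C D F" shows "conj_fctr G C D \<one> F = F"
proof (rule functor_eqI[OF is_functor_conj[OF C.one_closed F] F])
  show "omap (conj_fctr G C D \<one> F) x = omap F x" if "x \<in> Obj C" for x
    using that is_functor_obj[OF F that]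
    by (simp add: conj_fctr_simps C.gact_one_obj D.gact_one_obj)
  show "amap (conj_fctr G C D \<one> F) f = amap F f" if "f \<in> Arr C" for f
    using that is_functor_arr(1)[OF F that]
    by (simp add: conj_fctr_simps C.gact_one_arr D.gact_one_arr)
qed

lemma conj_fctr_mult:
  assumes g: "g \<in> carrier G" and h: "h \<in> carrier G" and F: "is_functor C D F"
  shows "conj_fctr G C D (g \<otimes> h) F = conj_fctr G C D g (conj_fctr G C D h F)"
proof (rule functor_eqI[OF is_functor_conj[OF _ F] is_functor_conj[OF g is_functor_conj[OF h F]]])
  \<comment> \<open>Inversion reverses the product; this is the order in which the outer conjugation
    by \<open>g\<close> and the inner one by \<open>h\<close> act on the source category.\<close>
  have inv: "inv (g \<otimes> h) = inv h \<otimes> inv g" "inv g \<in> carrier G" "inv h \<in> carrier G"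
    using g h by (simp_all add: C.inv_mult_group)
  show "omap (conj_fctr G C D (g \<otimes> h) F) x = omap (conj_fctr G C D g (conj_fctr G C D h F)) x"
    if x: "x \<in> Obj C" for x
    using g h inv x C.gact_obj[OF inv(2) x]
      is_functor_obj[OF F C.gact_obj[OF inv(3) C.gact_obj[OF inv(2) x]]]
    by (simp add: conj_fctr_simps C.gact_mult_obj D.gact_mult_obj)
  show "amap (conj_fctr G C D (g \<otimes> h) F) f = amap (conj_fctr G C D g (conj_fctr G C D h F)) f"
    if f: "f \<in> Arr C" for f
    using g h inv f C.gact_arr(1)[OF inv(2) f]
      is_functor_arr(1)[OF F C.gact_arr(1)[OF inv(3) C.gact_arr(1)[OF inv(2) f]]]
    by (simp add: conj_fctr_simps C.gact_mult_arr D.gact_mult_arr)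
qed (use g h in simp)

lemma gcategory_Cat: "gcategory G (Cat_gcat G C D)"
proof -
  interpret K: category "Cat_gcat G C D" by (rule category_Cat)
  let ?K = "Cat_gcat G C D"
  have gfun: "is_functor ?K ?K (gact ?K g)" if g: "g \<in> carrier G" for g
    unfolding is_functor_def
  proof (intro conjI ballI impI)
    show "omap (gact ?K g) \<in> Obj ?K \<rightarrow>\<^sub>E Obj ?K"
      using is_functor_conj[OF g] Cat_gcat_gact_extensional(1)[of G C D g] by (auto simp: PiE_def)
    show "amap (gact ?K g) \<in> Arr ?K \<rightarrow>\<^sub>E Arr ?K"
      using is_functor_conj[OF g] nat_trans_conj[OF g] Cat_gcat_gact_extensional(2)[of G C D g]
      by (auto simp: PiE_def)
    show "amap (gact ?K g) (Idt ?K F) = Idt ?K (omap (gact ?K g) F)" if "F \<in> Obj ?K" for F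
      using that g nat_trans_idt D.gact_idt[OF g] is_functor_obj[of C D F]
      by (auto simp: conj_fctr_simps C.gact_obj intro!: restrict_ext)
    fix a assume "a \<in> Arr ?K"
    then obtain F F' \<eta> where a: "a = (F, F', \<eta>)" "is_functor C D F" "is_functor C D F'" "nat_trans C D F F' \<eta>"
      by auto
    then show "Src ?K (amap (gact ?K g) a) = omap (gact ?K g) (Src ?K a)"
      "Tgt ?K (amap (gact ?K g) a) = omap (gact ?K g) (Tgt ?K a)" by auto
    fix b assume "b \<in> Arr ?K" "Tgt ?K a = Src ?K b"
    then obtain F'' \<eta>' where b: "b = (F', F'', \<eta>')" "is_functor C D F''" "nat_trans C D F' F'' \<eta>'"
      using a by auto
    show "amap (gact ?K g) (Cmp ?K b a) = Cmp ?K (amap (gact ?K g) b) (amap (gact ?K g) a)"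
      using a b g nat_trans_cmp[OF a(2,3) b(2) a(4) b(3)] nat_trans_arr[OF a(4)] nat_trans_arr[OF b(3)]
        D.gact_cmp[OF g]
      by (auto simp: C.gact_obj intro!: restrict_ext)
  qed
  have one: "gact ?K \<one> = id_fctr ?K"
  proof (rule functor_eqI[OF gfun K.is_functor_id])
    show "omap (gact ?K \<one>) F = omap (id_fctr ?K) F" if "F \<in> Obj ?K" for F
      using that by (simp add: conj_fctr_one)
    show "amap (gact ?K \<one>) a = amap (id_fctr ?K) a" if aK: "a \<in> Arr ?K" for a
    proof -
      from aK obtain F F' \<eta> where a: "a = (F, F', \<eta>)" "is_functor C D F" "is_functor C D F'" "nat_trans C D F F' \<eta>"
        by auto
      have "(\<lambda>x\<in>Obj C. amap (gact D \<one>) (\<eta> (omap (gact C (inv \<one>)) x))) = \<eta>"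
        using nat_trans_arr[OF a(4)]
        by (intro nat_trans_eqI[OF nat_trans_conj[OF _ a(2-4)] a(4)])
          (auto simp: C.gact_one_obj D.gact_one_arr)
      then show ?thesis using a aK by (simp add: conj_fctr_one)
    qed
  qed simp
  have mult: "gact ?K (g \<otimes> h) = comp_fctr ?K (gact ?K g) (gact ?K h)"
    if g: "g \<in> carrier G" and h: "h \<in> carrier G" for g h
  proof (rule functor_eqI[OF gfun K.is_functor_comp[OF gfun gfun]])
    show "omap (gact ?K (g \<otimes> h)) F = omap (comp_fctr ?K (gact ?K g) (gact ?K h)) F" if "F \<in> Obj ?K" for F
      using that g h by (simp add: conj_fctr_mult is_functor_conj)
    show "amap (gact ?K (g \<otimes> h)) a = amap (comp_fctr ?K (gact ?K g) (gact ?K h)) a" if aK: "a \<in> Arr ?K" for a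
    proof -
      from aK obtain F F' \<eta> where a: "a = (F, F', \<eta>)" "is_functor C D F" "is_functor C D F'" "nat_trans C D F F' \<eta>"
        by auto
      show ?thesis
        using a aK g h nat_trans_arr[OF a(4)]
        by (auto simp: conj_fctr_mult is_functor_conj nat_trans_conj C.inv_mult_group C.gact_mult_obj
            D.gact_mult_arr C.gact_obj intro!: restrict_ext)
    qed
  qed (use g h in auto)
  show ?thesis
    using gfun one mult by unfold_locales
qed

lemma groupoid_Cat:
  assumes "groupoid D" shows "groupoid (Cat_gcat G C D)" (is "groupoid ?K")
proof -
  interpret K: category ?K by (rule category_Cat)
  interpret D': groupoid D by fact
  show ?thesis
  proof unfold_locales
    fix a assume "a \<in> Arr ?K"
    then obtain F F' \<eta> where a: "a = (F, F', \<eta>)" "is_functor C D F" "is_functor C D F'" "nat_trans C D F F' \<eta>"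
      by auto
    let ?\<eta>' = "\<lambda>x\<in>Obj C. Inv D (\<eta> x)"
    note \<eta> = nat_trans_arr[OF a(4)]
    have "nat_trans C D F' F ?\<eta>'"
    proof (rule nat_transI)
      show "?\<eta>' x \<in> Arr D \<and> Src D (?\<eta>' x) = omap F' x \<and> Tgt D (?\<eta>' x) = omap F x" if "x \<in> Obj C" for x
        using that \<eta>[OF that] D'.Inv by simp
      fix f assume f: "f \<in> Arr C"
      note st = C.src_closed[OF f] C.tgt_closed[OF f]
      note * = \<eta>[OF st(1)] \<eta>[OF st(2)] D'.Inv[OF \<eta>(1)[OF st(1)]] D'.Inv[OF \<eta>(1)[OF st(2)]]
        is_functor_arr[OF a(2) f] is_functor_arr[OF a(3) f]
      let ?x = "\<eta> (Src C f)" and ?y = "\<eta> (Tgt C f)"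
      \<comment> \<open>The pointwise inverse is natural: insert \<open>?x\<close> after its inverse
        on the right, use naturality of \<eta> in the middle, and cancel \<open>?y\<close> on the
        left.\<close>
      have "Cmp D (Inv D ?y) (amap F' f) = Cmp D (Cmp D (Inv D ?y) (amap F' f)) (Cmp D ?x (Inv D ?x))"
        using * D.cmp_idt_right[of "Cmp D (Inv D ?y) (amap F' f)"] D.cmp[of "amap F' f" "Inv D ?y"] by simp
      also have "\<dots> = Cmp D (Cmp D (Inv D ?y) (Cmp D (amap F' f) ?x)) (Inv D ?x)"
        using * D.cmp[of "amap F' f" "Inv D ?y"] D.cmp_assoc[of ?x "amap F' f" "Inv D ?y"]
          D.cmp_assoc[of "Inv D ?x" ?x "Cmp D (Inv D ?y) (amap F' f)"] by simp
      also have "\<dots> = Cmp D (Cmp D (Inv D ?y) (Cmp D ?y (amap F f))) (Inv D ?x)"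
        using nat_trans_nat[OF a(4) f] by simp
      also have "\<dots> = Cmp D (amap F f) (Inv D ?x)"
        using * D.cmp_assoc[of "amap F f" ?y "Inv D ?y"] D.cmp_idt_left[of "amap F f"] by simp
      finally show "Cmp D (?\<eta>' (Tgt C f)) (amap F' f) = Cmp D (amap F f) (?\<eta>' (Src C f))"
        using st by simp
    qed simp
    then show "\<exists>b\<in>Arr ?K. Src ?K b = Tgt ?K a \<and>
        Tgt ?K b = Src ?K a \<and>
        Cmp ?K b a = Idt ?K (Src ?K a) \<and>
        Cmp ?K a b = Idt ?K (Tgt ?K a)"
      using a \<eta> D'.Inv
      by (intro bexI[of _ "(F', F, ?\<eta>')"]) (auto intro!: restrict_ext)
  qed
qed

end

section \<open>The translation category and postcomposition with a functor\<close>

lemma translation_gcat_simps [simp]: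
  "Obj (translation_gcat G) = carrier G" "Arr (translation_gcat G) = carrier G \<times> carrier G"
  "Src (translation_gcat G) = fst" "Tgt (translation_gcat G) = snd"
  "Idt (translation_gcat G) x = (x, x)" "Cmp (translation_gcat G) (z, w) (x, y) = (x, w)"
  "x \<in> carrier G \<Longrightarrow> omap (gact (translation_gcat G) g) x = g \<otimes>\<^bsub>G\<^esub> x"
  "x \<in> carrier G \<Longrightarrow> y \<in> carrier G \<Longrightarrow>
    amap (gact (translation_gcat G) g) (x, y) = (g \<otimes>\<^bsub>G\<^esub> x, g \<otimes>\<^bsub>G\<^esub> y)"
  by (simp_all add: translation_gcat_def)

lemma (in group) gcategory_translation: "gcategory G (translation_gcat G)"
proof -
  let ?T = "translation_gcat G"
  interpret T: category ?T by unfold_locales auto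
  have gact: "is_functor ?T ?T (gact ?T g)" if g: "g \<in> carrier G" for g
    unfolding is_functor_def
  proof (intro conjI)
    show "omap (gact ?T g) \<in> Obj ?T \<rightarrow>\<^sub>E Obj ?T" "amap (gact ?T g) \<in> Arr ?T \<rightarrow>\<^sub>E Arr ?T"
      using g by (auto simp: translation_gcat_def)
  qed (use g in auto)
  show ?thesis
  proof unfold_locales
    show "gact ?T \<one> = id_fctr ?T"
      using gact[OF one_closed] T.is_functor_id by (rule functor_eqI) auto
    show "gact ?T (g \<otimes> h) = comp_fctr ?T (gact ?T g) (gact ?T h)"
      if "g \<in> carrier G" "h \<in> carrier G" for g h
      using gact[OF m_closed[OF that]] T.is_functor_comp[OF gact[OF that(2)] gact[OF that(1)]]
      by (rule functor_eqI) (use that in \<open>auto simp: m_assoc\<close>)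
  qed (rule gact)
qed

definition post_fctr ::
  "('g, 'x) monoid_scheme \<Rightarrow> ('g, 'i, 'j, 'w) gcat_scheme \<Rightarrow> ('g, 'o, 'a, 'y) gcat_scheme
     \<Rightarrow> ('o, 'a, 'p, 'b) fctr
     \<Rightarrow> (('i, 'j, 'o, 'a) fctr, ('i, 'j, 'o, 'a) fctr \<times> ('i, 'j, 'o, 'a) fctr \<times> ('i \<Rightarrow> 'a),
         ('i, 'j, 'p, 'b) fctr, ('i, 'j, 'p, 'b) fctr \<times> ('i, 'j, 'p, 'b) fctr \<times> ('i \<Rightarrow> 'b)) fctr" where
  "post_fctr G T C F =
     \<lparr>omap = \<lambda>P\<in>Obj (Cat_gcat G T C). comp_fctr T F P,
      amap = \<lambda>(P, Q, \<eta>)\<in>Arr (Cat_gcat G T C). (comp_fctr T F P, comp_fctr T F Q, \<lambda>x\<in>Obj T. amap F (\<eta> x))\<rparr>"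

lemma post_fctr_simps [simp]:
  "is_functor T C P \<Longrightarrow> omap (post_fctr G T C F) P = comp_fctr T F P"
  "\<lbrakk>is_functor T C P; is_functor T C Q; nat_trans T C P Q \<eta>\<rbrakk>
     \<Longrightarrow> amap (post_fctr G T C F) (P, Q, \<eta>) = (comp_fctr T F P, comp_fctr T F Q, \<lambda>x\<in>Obj T. amap F (\<eta> x))"
  by (simp_all add: post_fctr_def)

locale fully_faithful_post = fully_faithful_functor G C D F + T: gcategory G T
  for G :: "('g, 'x) monoid_scheme" (structure)
    and C :: "('g, 'o, 'a, 'y) gcat_scheme" and D :: "('g, 'p, 'b, 'z) gcat_scheme"
    and F :: "('o, 'a, 'p, 'b) fctr" and T :: "('g, 'i, 'j, 'w) gcat_scheme"
begin

sublocale TC: gcategory_pair G T C ..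
sublocale TD: gcategory_pair G T D ..

lemma is_functor_post: "is_functor T C P \<Longrightarrow> is_functor T D (comp_fctr T F P)"
  using T.is_functor_comp is_functor by blast

lemma nat_trans_post:
  assumes P: "is_functor T C P" and Q: "is_functor T C Q" and \<eta>: "nat_trans T C P Q \<eta>"
  shows "nat_trans T D (comp_fctr T F P) (comp_fctr T F Q) (\<lambda>x\<in>Obj T. amap F (\<eta> x))"
proof (rule nat_transI)
  fix x assume x: "x \<in> Obj T"
  show "(\<lambda>x\<in>Obj T. amap F (\<eta> x)) x \<in> Arr D \<and> Src D ((\<lambda>x\<in>Obj T. amap F (\<eta> x)) x) = omap (comp_fctr T F P) x
      \<and> Tgt D ((\<lambda>x\<in>Obj T. amap F (\<eta> x)) x) = omap (comp_fctr T F Q) x"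
    using x nat_trans_arr[OF \<eta> x] F_arr[OF nat_trans_arr(1)[OF \<eta> x]] by simp
next
  fix f assume f: "f \<in> Arr T"
  note st = T.src_closed[OF f] T.tgt_closed[OF f]
  note * = nat_trans_arr[OF \<eta> st(1)] nat_trans_arr[OF \<eta> st(2)] is_functor_arr[OF P f] is_functor_arr[OF Q f]
  show "Cmp D ((\<lambda>x\<in>Obj T. amap F (\<eta> x)) (Tgt T f)) (amap (comp_fctr T F P) f)
      = Cmp D (amap (comp_fctr T F Q) f) ((\<lambda>x\<in>Obj T. amap F (\<eta> x)) (Src T f))"
    using f st * nat_trans_nat[OF \<eta> f] F_cmp[of "amap P f" "\<eta> (Tgt T f)"] F_cmp[of "\<eta> (Src T f)" "amap Q f"]
    by simp
qed simp

lemma conj_fctr_post: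
  assumes g: "g \<in> carrier G" and P: "is_functor T C P"
  shows "comp_fctr T F (conj_fctr G T C g P) = conj_fctr G T D g (comp_fctr T F P)"
proof (rule functor_eqI[OF is_functor_post[OF TC.is_functor_conj[OF g P]] TD.is_functor_conj[OF g is_functor_post[OF P]]])
  have g': "inv g \<in> carrier G" using g by simp
  show "omap (comp_fctr T F (conj_fctr G T C g P)) x = omap (conj_fctr G T D g (comp_fctr T F P)) x"
    if x: "x \<in> Obj T" for x
    using x T.gact_obj[OF g' x] is_functor_obj[OF P T.gact_obj[OF g' x]]
    by (simp add: TC.conj_fctr_simps[OF g] TD.conj_fctr_simps[OF g] equivariant_obj[OF g])
  show "amap (comp_fctr T F (conj_fctr G T C g P)) f = amap (conj_fctr G T D g (comp_fctr T F P)) f"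
    if f: "f \<in> Arr T" for f
    using f T.gact_arr(1)[OF g' f] is_functor_arr(1)[OF P T.gact_arr(1)[OF g' f]]
    by (simp add: TC.conj_fctr_simps[OF g] TD.conj_fctr_simps[OF g] equivariant_arr[OF g])
qed

lemma equivariant_post:
  "equivariant_functor G (Cat_gcat G T C) (Cat_gcat G T D) (post_fctr G T C F)"
proof -
  let ?K = "Cat_gcat G T C" and ?L = "Cat_gcat G T D" and ?F = "post_fctr G T C F"
  interpret K: gcategory G ?K by (rule TC.gcategory_Cat)
  interpret L: gcategory G ?L by (rule TD.gcategory_Cat)
  have post: "is_functor ?K ?L ?F"
    unfolding is_functor_def
  proof (intro conjI ballI impI)
    have "omap ?F \<in> extensional (Obj ?K)" "amap ?F \<in> extensional (Arr ?K)"
      by (simp_all add: post_fctr_def)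
    then show "omap ?F \<in> Obj ?K \<rightarrow>\<^sub>E Obj ?L" "amap ?F \<in> Arr ?K \<rightarrow>\<^sub>E Arr ?L"
      using is_functor_post nat_trans_post by (auto simp: PiE_def)
    show "amap ?F (Idt ?K P) = Idt ?L (omap ?F P)" if "P \<in> Obj ?K" for P
      using that TC.nat_trans_idt F_idt is_functor_obj[of T C P] by (auto intro!: restrict_ext)
    fix a assume "a \<in> Arr ?K"
    then obtain P Q \<eta> where a: "a = (P, Q, \<eta>)" "is_functor T C P" "is_functor T C Q" "nat_trans T C P Q \<eta>"
      by auto
    then show "Src ?L (amap ?F a) = omap ?F (Src ?K a)" "Tgt ?L (amap ?F a) = omap ?F (Tgt ?K a)"
      by auto
    fix b assume "b \<in> Arr ?K" "Tgt ?K a = Src ?K b"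
    then obtain Q' \<eta>' where b: "b = (Q, Q', \<eta>')" "is_functor T C Q'" "nat_trans T C Q Q' \<eta>'"
      using a by auto
    show "amap ?F (Cmp ?K b a) = Cmp ?L (amap ?F b) (amap ?F a)"
      using a b TC.nat_trans_cmp[OF a(2,3) b(2) a(4) b(3)] nat_trans_arr[OF a(4)] nat_trans_arr[OF b(3)]
      by (auto intro!: restrict_ext F_cmp)
  qed
  show ?thesis
  proof unfold_locales
    show "comp_fctr ?K ?F (gact ?K g) = comp_fctr ?K (gact ?L g) ?F" if g: "g \<in> carrier G" for g
    proof (rule functor_eqI)
      show "is_functor ?K ?L (comp_fctr ?K ?F (gact ?K g))"
        using K.gact_functor[OF g] post by (rule K.is_functor_comp)
      show "is_functor ?K ?L (comp_fctr ?K (gact ?L g) ?F)"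
        using post L.gact_functor[OF g] by (rule K.is_functor_comp)
      show "omap (comp_fctr ?K ?F (gact ?K g)) P = omap (comp_fctr ?K (gact ?L g) ?F) P" if "P \<in> Obj ?K" for P
        using that by (simp add: TC.is_functor_conj[OF g] is_functor_post conj_fctr_post[OF g])
      show "amap (comp_fctr ?K ?F (gact ?K g)) a = amap (comp_fctr ?K (gact ?L g) ?F) a" if aK: "a \<in> Arr ?K" for a
      proof -
        from aK obtain P Q \<eta> where a: "a = (P, Q, \<eta>)" "is_functor T C P" "is_functor T C Q" "nat_trans T C P Q \<eta>"
          by auto
        have g': "inv g \<in> carrier G" using g by simp
        show ?thesis
          using a aK nat_trans_arr[OF a(4) T.gact_obj[OF g']] T.gact_obj[OF g']
          by (auto simp: TC.is_functor_conj[OF g] TC.nat_trans_conj[OF g] is_functor_post nat_trans_post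
              conj_fctr_post[OF g] equivariant_arr[OF g] intro!: restrict_ext)
      qed
    qed
  qed (rule post)
qed

text \<open>Lifts are taken at each object of \<open>T\<close> separately. Naturality of the lifted
  family is an equation between parallel arrows of \<open>C\<close>, which the faithful
  \<open>F\<close> reflects; uniqueness is again componentwise.\<close>

lemma fully_faithful_post:
  "fully_faithful_functor G (Cat_gcat G T C) (Cat_gcat G T D) (post_fctr G T C F)"
proof -
  let ?K = "Cat_gcat G T C" and ?L = "Cat_gcat G T D" and ?F = "post_fctr G T C F"
  interpret E: equivariant_functor G ?K ?L ?F by (rule equivariant_post)
  show ?thesis
  proof unfold_locales
    fix P Q b assume PQ: "P \<in> Obj ?K" "Q \<in> Obj ?K" and b: "b \<in> Arr ?L"
      "Src ?L b = omap ?F P" "Tgt ?L b = omap ?F Q"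
    then obtain \<beta> where P: "is_functor T C P" and Q: "is_functor T C Q"
      and \<beta>: "b = (comp_fctr T F P, comp_fctr T F Q, \<beta>)" "nat_trans T D (comp_fctr T F P) (comp_fctr T F Q) \<beta>"
      by auto
    define \<eta> where "\<eta> = (\<lambda>x\<in>Obj T. lift (omap P x) (omap Q x) (\<beta> x))"
    have \<eta>: "\<eta> x \<in> Arr C" "Src C (\<eta> x) = omap P x" "Tgt C (\<eta> x) = omap Q x" "amap F (\<eta> x) = \<beta> x"
      if "x \<in> Obj T" for x
      using that lift[OF is_functor_obj[OF P that] is_functor_obj[OF Q that] nat_trans_arr(1)[OF \<beta>(2) that]]
        nat_trans_arr[OF \<beta>(2) that]
      by (auto simp: \<eta>_def)
    have nat: "nat_trans T C P Q \<eta>"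
    proof (rule nat_transI)
      show "\<eta> x \<in> Arr C \<and> Src C (\<eta> x) = omap P x \<and> Tgt C (\<eta> x) = omap Q x" if "x \<in> Obj T" for x
        using \<eta>[OF that] by simp
      fix f assume f: "f \<in> Arr T"
      note st = T.src_closed[OF f] T.tgt_closed[OF f]
      note * = \<eta>[OF st(1)] \<eta>[OF st(2)] is_functor_arr[OF P f] is_functor_arr[OF Q f]
      have "amap F (Cmp C (\<eta> (Tgt T f)) (amap P f)) = amap F (Cmp C (amap Q f) (\<eta> (Src T f)))"
        using * f nat_trans_nat[OF \<beta>(2) f] F_cmp[of "amap P f" "\<eta> (Tgt T f)"] F_cmp[of "\<eta> (Src T f)" "amap Q f"]
        by simp
      then show "Cmp C (\<eta> (Tgt T f)) (amap P f) = Cmp C (amap Q f) (\<eta> (Src T f))"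
        using * C.cmp[of "amap P f" "\<eta> (Tgt T f)"] C.cmp[of "\<eta> (Src T f)" "amap Q f"]
        by (intro faithful) auto
    qed (simp add: \<eta>_def)
    have "(\<lambda>x\<in>Obj T. amap F (\<eta> x)) = \<beta>"
      using \<eta>(4) by (intro nat_trans_eqI[OF nat_trans_post[OF P Q nat] \<beta>(2)]) simp
    then have 1: "amap ?F (P, Q, \<eta>) = b" using P Q nat \<beta> by simp
    show "\<exists>!a. a \<in> Arr ?K \<and> Src ?K a = P \<and> Tgt ?K a = Q \<and> amap ?F a = b"
    proof (rule ex1I)
      show "(P, Q, \<eta>) \<in> Arr ?K \<and> Src ?K (P, Q, \<eta>) = P \<and> Tgt ?K (P, Q, \<eta>) = Q \<and> amap ?F (P, Q, \<eta>) = b"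
        using 1 P Q nat by simp
      fix a assume a: "a \<in> Arr ?K \<and> Src ?K a = P \<and> Tgt ?K a = Q \<and> amap ?F a = b"
      then obtain \<eta>' where a': "a = (P, Q, \<eta>')" "nat_trans T C P Q \<eta>'" by auto
      have eq: "(\<lambda>x\<in>Obj T. amap F (\<eta>' x)) = \<beta>" using a a' P Q \<beta> by simp
      have "\<eta>' = \<eta>"
      proof (rule nat_trans_eqI[OF a'(2) nat])
        fix x assume x: "x \<in> Obj T"
        then have "amap F (\<eta>' x) = \<beta> x" using fun_cong[OF eq, of x] by simp
        then show "\<eta>' x = \<eta> x"
          using nat_trans_arr[OF a'(2) x] \<eta>[OF x] by (intro faithful) auto
      qed
      then show "a = (P, Q, \<eta>)" using a' by simp
    qed
  qed
qed

end

text \<open>An object \<open>P\<close> of the functor category is lifted to \<open>x \<mapsto> x \<cdot> e (x\<^sup>-\<^sup>1 \<cdot> P x)\<close>, where \<open>e\<close> is any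
  section of \<open>F\<close> on objects. Twisting by \<open>x\<close> makes this commute with the action of \<open>G\<close>, although
  \<open>e\<close> need not.\<close>

theorem (in fully_faithful_functor) weak_G_equivalence_Cat_translation:
  assumes C: "groupoid C" and surj: "omap F ` Obj C = Obj D"
  shows "weak_G_equivalence G (Cat_gcat G (translation_gcat G) C) (Cat_gcat G (translation_gcat G) D)
    (post_fctr G (translation_gcat G) C F)"
proof -
  let ?T = "translation_gcat G"
  interpret T: gcategory G ?T by (rule C.gcategory_translation)
  interpret P: fully_faithful_post G C D F ?T ..
  let ?K = "Cat_gcat G ?T C" and ?L = "Cat_gcat G ?T D" and ?F = "post_fctr G ?T C F"
  interpret FP: fully_faithful_functor G ?K ?L ?F by (rule P.fully_faithful_post)
  define e where "e = inv_into (Obj C) (omap F)"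
  have e: "e d \<in> Obj C" "omap F (e d) = d" if "d \<in> Obj D" for d
    using that surj inv_into_into[of d "omap F" "Obj C"] f_inv_into_f[of d "omap F" "Obj C"]
    by (auto simp: e_def)
  define ob where "ob P x = omap (gact C x) (e (omap (gact D (inv x)) (omap P x)))" for P :: "('g, 'g \<times> 'g, 'p, 'b) fctr" and x
  define s where "s P = \<lparr>omap = \<lambda>x\<in>carrier G. ob P x,
      amap = \<lambda>(x, y)\<in>carrier G \<times> carrier G. lift (ob P x) (ob P y) (amap P (x, y))\<rparr>"
    for P :: "('g, 'g \<times> 'g, 'p, 'b) fctr"
  have ob: "ob P x \<in> Obj C" "omap F (ob P x) = omap P x"
    if P: "is_functor ?T D P" and x: "x \<in> carrier G" for P x
  proof -
    have x': "inv x \<in> carrier G" using x by simp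
    have Px: "omap P x \<in> Obj D" using is_functor_obj[OF P] x by simp
    have y: "omap (gact D (inv x)) (omap P x) \<in> Obj D" using D.gact_obj[OF x' Px] .
    show "ob P x \<in> Obj C" unfolding ob_def using C.gact_obj[OF x e(1)[OF y]] .
    \<comment> \<open>Equivariance of \<open>F\<close> pulls out the twist by \<open>x\<close>,
      which then cancels the twist by \<open>inv x\<close>.\<close>
    have "omap F (ob P x) = omap (gact D x) (omap (gact D (inv x)) (omap P x))"
      unfolding ob_def using equivariant_obj[OF x e(1)[OF y]] e(2)[OF y] by simp
    also have "\<dots> = omap P x"
      using D.gact_mult_obj[OF x x' Px] x Px by (simp add: D.gact_one_obj)
    finally show "omap F (ob P x) = omap P x" .
  qed
  have s_obj: "omap (s P) x = ob P x" if "x \<in> carrier G" for P x using that by (simp add: s_def)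
  have s_arr: "amap (s P) (x, y) \<in> Arr C" "Src C (amap (s P) (x, y)) = ob P x"
    "Tgt C (amap (s P) (x, y)) = ob P y" "amap F (amap (s P) (x, y)) = amap P (x, y)"
    if P: "is_functor ?T D P" and xy: "x \<in> carrier G" "y \<in> carrier G" for P x y
    using lift[OF ob(1)[OF P xy(1)] ob(1)[OF P xy(2)], of "amap P (x, y)"] ob(2)[OF P xy(1)] ob(2)[OF P xy(2)]
      is_functor_arr[OF P, of "(x, y)"] xy by (auto simp: s_def)
  have s: "is_functor ?T C (s P)" if P: "is_functor ?T D P" for P
    unfolding is_functor_def
  proof (intro conjI ballI impI)
    have "amap (s P) \<in> extensional (Arr ?T)" by (simp add: s_def)
    then show "amap (s P) \<in> Arr ?T \<rightarrow>\<^sub>E Arr C" using s_arr(1)[OF P] by (auto simp: PiE_def)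
    show "omap (s P) \<in> Obj ?T \<rightarrow>\<^sub>E Obj C" using ob(1)[OF P] by (auto simp: s_def)
    fix a assume "a \<in> Arr ?T"
    then obtain x y where a: "a = (x, y)" "x \<in> carrier G" "y \<in> carrier G" by auto
    show "Src C (amap (s P) a) = omap (s P) (Src ?T a)" "Tgt C (amap (s P) a) = omap (s P) (Tgt ?T a)"
      using a s_arr[OF P a(2,3)] s_obj by auto
    fix b assume "b \<in> Arr ?T" "Tgt ?T a = Src ?T b"
    then obtain z where b: "b = (y, z)" "z \<in> carrier G" using a by auto
    note * = s_arr[OF P a(2,3)] s_arr[OF P a(3) b(2)] s_arr[OF P a(2) b(2)]
    have "amap P (x, z) = Cmp D (amap P (y, z)) (amap P (x, y))"
      using is_functor_cmp[OF P, of "(x, y)" "(y, z)"] a b by simp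
    then have "amap (s P) (x, z) = Cmp C (amap (s P) (y, z)) (amap (s P) (x, y))"
      using * C.cmp[of "amap (s P) (x, y)" "amap (s P) (y, z)"] F_cmp[of "amap (s P) (x, y)" "amap (s P) (y, z)"]
      by (intro faithful) auto
    then show "amap (s P) (Cmp ?T b a) = Cmp C (amap (s P) b) (amap (s P) a)" using a b by simp
  next
    fix x assume "x \<in> Obj ?T"
    then have x: "x \<in> carrier G" by simp
    show "amap (s P) (Idt ?T x) = Idt C (omap (s P) x)"
      using s_arr[OF P x x] ob[OF P x] C.idt[OF ob(1)[OF P x]] F_idt[OF ob(1)[OF P x]] s_obj[OF x]
        is_functor_idt[OF P, of x] x
      by (intro faithful) auto
  qed
  have Fs: "comp_fctr ?T F (s P) = P" if P: "is_functor ?T D P" for P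
    using P.is_functor_post[OF s[OF P]] P ob(2)[OF P] s_arr(4)[OF P] s_obj
    by (intro functor_eqI[of ?T D]) auto
  have conj_s: "s (conj_fctr G ?T D g P) = conj_fctr G ?T C g (s P)"
    if g: "g \<in> carrier G" and P: "is_functor ?T D P" for g P
  proof (rule functor_eqI)
    let ?gP = "conj_fctr G ?T D g P" and ?gs = "conj_fctr G ?T C g (s P)"
    have g': "inv g \<in> carrier G" using g by simp
    have gP: "is_functor ?T D ?gP" using P.TD.is_functor_conj[OF g P] .
    show sgP: "is_functor ?T C (s ?gP)" using s[OF gP] .
    show gs: "is_functor ?T C ?gs" using P.TC.is_functor_conj[OF g s[OF P]] .
    show obj: "omap (s ?gP) x = omap ?gs x" if "x \<in> Obj ?T" for x
    proof -
      have x: "x \<in> carrier G" using that by simp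
      \<comment> \<open>The conjugate of \<open>P\<close> at \<open>x\<close> is \<open>g\<close>
        applied to \<open>P\<close> at \<open>?y\<close>, and
        \<open>inv x \<otimes> g = inv ?y\<close>. Both sides therefore evaluate \<open>e\<close> at
        the same object, so equivariance of \<open>e\<close> is never called upon.\<close>
      let ?y = "inv g \<otimes> x"
      have y: "?y \<in> carrier G" and x': "inv x \<in> carrier G" and y': "inv ?y \<in> carrier G" using g x by auto
      have inv_y: "inv ?y = inv x \<otimes> g" using g x by (simp add: C.inv_mult_group)
      have Py: "omap P ?y \<in> Obj D" using is_functor_obj[OF P] y by simp
      have "omap ?gP x = omap (gact D g) (omap P ?y)"
        using x by (simp add: P.TD.conj_fctr_simps[OF g])
      then have "omap (gact D (inv x)) (omap ?gP x) = omap (gact D (inv ?y)) (omap P ?y)"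
        using D.gact_mult_obj[OF x' g Py] inv_y by simp
      then have 1: "omap (s ?gP) x = omap (gact C x) (e (omap (gact D (inv ?y)) (omap P ?y)))"
        using s_obj[OF x] by (simp add: ob_def)
      have "omap ?gs x = omap (gact C g) (ob P ?y)"
        using x s_obj[OF y] by (simp add: P.TC.conj_fctr_simps[OF g])
      also have "\<dots> = omap (gact C (g \<otimes> ?y)) (e (omap (gact D (inv ?y)) (omap P ?y)))"
        unfolding ob_def
        by (rule C.gact_mult_obj[OF g y e(1)[OF D.gact_obj[OF y' Py]], symmetric])
      also have "g \<otimes> ?y = x" using g x by (simp add: C.m_assoc[symmetric])
      finally show ?thesis using 1 by simp
    qed
    show "amap (s ?gP) a = amap ?gs a" if a: "a \<in> Arr ?T" for a
    proof (rule faithful)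
      show "amap (s ?gP) a \<in> Arr C" "amap ?gs a \<in> Arr C"
        using is_functor_arr(1)[OF sgP a] is_functor_arr(1)[OF gs a] .
      show "Src C (amap (s ?gP) a) = Src C (amap ?gs a)" "Tgt C (amap (s ?gP) a) = Tgt C (amap ?gs a)"
        using is_functor_arr[OF sgP a] is_functor_arr[OF gs a] obj[OF T.src_closed[OF a]] obj[OF T.tgt_closed[OF a]]
        by auto
      \<comment> \<open>Sources and targets already agree by \<open>obj\<close>; what remains is
        that both functors lie over the conjugate of \<open>P\<close>.\<close>
      have "comp_fctr ?T F (s ?gP) = comp_fctr ?T F ?gs"
        using Fs[OF gP] Fs[OF P] P.conj_fctr_post[OF g s[OF P]] by simp
      from arg_cong[OF this, of "\<lambda>K. amap K a"] show "amap F (amap (s ?gP) a) = amap F (amap ?gs a)"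
        using comp_fctr_simps(2)[OF a] by metis
    qed
  qed
  show ?thesis
  proof (rule FP.weak_G_equivalence_of_object_section)
    show "groupoid ?K" using C by (rule P.TC.groupoid_Cat)
    show "s P \<in> Obj ?K" "omap ?F (s P) = P" if "P \<in> Obj ?L" for P
      using that s Fs by auto
    show "s (omap (gact ?L g) P) = omap (gact ?K g) (s P)" if "g \<in> carrier G" "P \<in> Obj ?L" for g P
      using that s conj_s by simp
  qed
qed

section \<open>Row vectors and linear maps\<close>

text \<open>Row vectors live in \<open>carrier_mat 1 n\<close>; rewriting \<open>1\<close> to
  \<open>Suc 0\<close> would hide this form.\<close>

declare One_nat_def [simp del]

definition unit_row :: "nat \<Rightarrow> nat \<Rightarrow> 'r::ring_1 mat" where
  "unit_row n i = mat 1 n (\<lambda>(_, j). if j = i then 1 else 0)"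

lemma unit_row_carrier [simp]: "unit_row n i \<in> carrier_mat 1 n"
  by (simp add: unit_row_def)

lemma smult_mult_mat:
  fixes v :: "'r::ring_1 mat"
  assumes "v \<in> carrier_mat k n" "A \<in> carrier_mat n m"
  shows "(r \<cdot>\<^sub>m v) * A = r \<cdot>\<^sub>m (v * A)"
  using assms by (intro eq_matI) (auto simp: scalar_prod_def sum_distrib_left mult.assoc)

lemma unit_row_mult:
  assumes "A \<in> carrier_mat n m" "i < n"
  shows "unit_row n i * A = mat 1 m (\<lambda>(_, j). A $$ (i, j))"
proof (rule eq_matI)
  fix k j assume "k < dim_row (mat 1 m (\<lambda>(_, j). A $$ (i, j)))" "j < dim_col (mat 1 m (\<lambda>(_, j). A $$ (i, j)))"
  then have kj: "k = 0" "j < m" by auto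
  have "(unit_row n i * A) $$ (k, j) = (\<Sum>l\<in>{0..<n}. (if l = i then 1 else 0) * A $$ (l, j))"
    using kj assms by (simp add: scalar_prod_def unit_row_def)
  also have "\<dots> = (\<Sum>l\<in>{0..<n}. if l = i then A $$ (i, j) else 0)"
    by (intro sum.cong) auto
  also have "\<dots> = A $$ (i, j)" using assms by simp
  finally show "(unit_row n i * A) $$ (k, j) = mat 1 m (\<lambda>(_, j). A $$ (i, j)) $$ (k, j)"
    using kj by simp
qed (use assms in \<open>auto simp: unit_row_def\<close>)

text \<open>Multiplication by unit rows recovers the rows of a matrix.\<close>

lemma mat_eq_if_mult_row_eq:
  assumes A: "A \<in> carrier_mat n m" and B: "B \<in> carrier_mat n m"
    and eq: "\<And>v. v \<in> carrier_mat 1 n \<Longrightarrow> v * A = v * (B :: 'r::ring_1 mat)"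
  shows "A = B"
proof (rule eq_matI)
  fix i j assume "i < dim_row B" "j < dim_col B"
  then have ij: "i < n" "j < m" using B by auto
  have "mat 1 m (\<lambda>(_, j). A $$ (i, j)) = mat 1 m (\<lambda>(_, j). B $$ (i, j))"
    using eq[of "unit_row n i"] unit_row_mult[OF A ij(1)] unit_row_mult[OF B ij(1)] by simp
  then have "mat 1 m (\<lambda>(_, j). A $$ (i, j)) $$ (0, j) = mat 1 m (\<lambda>(_, j). B $$ (i, j)) $$ (0, j)"
    by simp
  then show "A $$ (i, j) = B $$ (i, j)" using ij by simp
qed (use A B in auto)

text \<open>Scalars act on the left and matrices on the right, so the two commute over a
  noncommutative ring as well. Row \<open>i\<close> of \<open>A\<close> is the image of the unit row
  \<open>i\<close>.\<close>

lemma linear_row_map_eq_mult: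
  fixes L :: "'r::ring_1 mat \<Rightarrow> 'r mat"
  assumes L: "\<And>v. v \<in> carrier_mat 1 n \<Longrightarrow> L v \<in> carrier_mat 1 m"
    and add: "\<And>v w. \<lbrakk>v \<in> carrier_mat 1 n; w \<in> carrier_mat 1 n\<rbrakk> \<Longrightarrow> L (v + w) = L v + L w"
    and smult: "\<And>r v. v \<in> carrier_mat 1 n \<Longrightarrow> L (r \<cdot>\<^sub>m v) = r \<cdot>\<^sub>m L v"
  shows "\<exists>A\<in>carrier_mat n m. \<forall>v\<in>carrier_mat 1 n. L v = v * A"
proof
  define A where "A = mat n m (\<lambda>(i, j). L (unit_row n i) $$ (0, j))"
  show A: "A \<in> carrier_mat n m" by (simp add: A_def)
  have zero: "L (0\<^sub>m 1 n) = 0\<^sub>m 1 m"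
  proof -
    have "L (0\<^sub>m 1 n) = L (0 \<cdot>\<^sub>m 0\<^sub>m 1 n)" by (rule arg_cong[of _ _ L]) auto
    also have "\<dots> = 0 \<cdot>\<^sub>m L (0\<^sub>m 1 n)" by (rule smult) simp
    also have "\<dots> = 0\<^sub>m 1 m" using L[of "0\<^sub>m 1 n"] by (intro eq_matI) auto
    finally show ?thesis .
  qed
  have unit: "unit_row n k * A = L (unit_row n k)" if "k < n" for k
    using L[of "unit_row n k"] that unit_row_mult[OF A that] by (intro eq_matI) (auto simp: A_def)
  \<comment> \<open>Induction on a bound \<open>k\<close> for the support of \<open>v\<close>: the
    last coordinate allowed by the bound is split off as a multiple of a unit row.\<close>
  have "L v = v * A" if "k \<le> n" "v \<in> carrier_mat 1 n" "\<And>j. k \<le> j \<Longrightarrow> j < n \<Longrightarrow> v $$ (0, j) = 0" for k v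
    using that
  proof (induction k arbitrary: v)
    case 0
    then have "v = 0\<^sub>m 1 n" by (intro eq_matI) auto
    then show ?case using A zero by simp
  next
    case (Suc k)
    define w where "w = mat 1 n (\<lambda>(_, j). if j = k then 0 else v $$ (0, j))"
    let ?e = "v $$ (0, k) \<cdot>\<^sub>m unit_row n k"
    have w: "w \<in> carrier_mat 1 n" by (simp add: w_def)
    have e: "?e \<in> carrier_mat 1 n" by simp
    have "L w = w * A"
    proof (rule Suc.IH[OF _ w])
      show "w $$ (0, j) = 0" if "k \<le> j" "j < n" for j
        using that Suc.prems(3)[of j] by (simp add: w_def)
    qed (use Suc.prems in simp)
    moreover have "L ?e = ?e * A"
      using unit[of k] Suc.prems(1) by (simp add: smult smult_mult_mat[OF unit_row_carrier A])
    moreover have "v = w + ?e"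
      using Suc.prems(2) by (intro eq_matI) (auto simp: w_def unit_row_def)
    ultimately show ?case using add[OF w e] add_mult_distrib_mat[OF w e A] by simp
  qed
  from this[of n] show "\<forall>v\<in>carrier_mat 1 n. L v = v * A" by simp
qed

section \<open>Frames of free modules\<close>

definition comb :: "('r::ring_1, 'm) module \<Rightarrow> 'm list \<Rightarrow> 'r mat \<Rightarrow> 'm" where
  "comb M bs v = (\<Oplus>\<^bsub>M\<^esub>i\<in>{..<length bs}. v $$ (0, i) \<odot>\<^bsub>M\<^esub> bs ! i)"

text \<open>An ordered basis. A list fixes the order of coordinates, which matrices need, and
  bijectivity of \<open>comb\<close> says that coordinates exist and are unique.\<close>

definition is_frame :: "('r::ring_1, 'm) module \<Rightarrow> 'm list \<Rightarrow> bool" where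
  "is_frame M bs \<longleftrightarrow> set bs \<subseteq> carrier M \<and> bij_betw (comb M bs) (carrier_mat 1 (length bs)) (carrier M)"

context left_module
begin

lemma smult_zero: "r \<odot> \<zero> = \<zero>"
proof -
  have "r \<odot> \<zero> \<oplus> r \<odot> \<zero> = r \<odot> \<zero> \<oplus> \<zero>"
    using smult_r_distr[of \<zero> \<zero> r] smult_closed[of \<zero> r] by simp
  then show ?thesis using smult_closed[of \<zero> r] by (simp add: a_assoc)
qed

lemma smult_finsum:
  assumes "finite I" "f \<in> I \<rightarrow> carrier M"
  shows "r \<odot> (\<Oplus>i\<in>I. f i) = (\<Oplus>i\<in>I. r \<odot> f i)"
  using assms
proof (induction I)
  case empty
  then show ?case by (simp add: smult_zero)
next
  case (insert i I)
  then have "f \<in> I \<rightarrow> carrier M" "f i \<in> carrier M" "(\<lambda>i. r \<odot> f i) \<in> I \<rightarrow> carrier M" "r \<odot> f i \<in> carrier M"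
    by (auto intro: smult_closed)
  with insert show ?case by (simp add: smult_r_distr)
qed

lemma comb_closed: "set bs \<subseteq> carrier M \<Longrightarrow> comb M bs v \<in> carrier M"
  unfolding comb_def by (intro finsum_closed) (auto intro!: smult_closed nth_mem)

lemma comb_add:
  assumes bs: "set bs \<subseteq> carrier M" and vw: "v \<in> carrier_mat 1 (length bs)" "w \<in> carrier_mat 1 (length bs)"
  shows "comb M bs (v + w) = comb M bs v \<oplus> comb M bs w"
proof -
  have b: "bs ! i \<in> carrier M" if "i < length bs" for i using bs that by auto
  have "comb M bs (v + w) = (\<Oplus>i\<in>{..<length bs}. v $$ (0, i) \<odot> bs ! i \<oplus> w $$ (0, i) \<odot> bs ! i)"
    unfolding comb_def using vw b
    by (intro finsum_cong') (auto intro!: a_closed smult_closed simp: smult_l_distr)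
  also have "\<dots> = comb M bs v \<oplus> comb M bs w"
    unfolding comb_def using b by (intro finsum_addf) (auto intro!: smult_closed)
  finally show ?thesis .
qed

lemma comb_smult:
  assumes bs: "set bs \<subseteq> carrier M" and v: "v \<in> carrier_mat 1 (length bs)"
  shows "comb M bs (r \<cdot>\<^sub>m v) = r \<odot> comb M bs v"
proof -
  have b: "bs ! i \<in> carrier M" if "i < length bs" for i using bs that by auto
  have "comb M bs (r \<cdot>\<^sub>m v) = (\<Oplus>i\<in>{..<length bs}. r \<odot> (v $$ (0, i) \<odot> bs ! i))"
    unfolding comb_def using v b
    by (intro finsum_cong') (auto intro!: smult_closed simp: smult_assoc)
  also have "\<dots> = r \<odot> comb M bs v"
    unfolding comb_def using b by (subst smult_finsum) (auto intro!: smult_closed)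
  finally show ?thesis .
qed

text \<open>\<psi> reads a coefficient function on the set as a row in the order of the list,
  bijectively because the list is distinct. Unique existence of coefficients thus becomes
  bijectivity of \<open>comb\<close>.\<close>

lemma is_basis_iff_is_frame:
  assumes bs: "distinct bs" "set bs \<subseteq> carrier M"
  shows "is_basis M (set bs) \<longleftrightarrow> is_frame M bs"
proof -
  let ?n = "length bs"
  define \<psi> where "\<psi> c = mat 1 ?n (\<lambda>(_, j). c (bs ! j))" for c :: "'m \<Rightarrow> 'r"
  have nth: "bij_betw (nth bs) {..<?n} (set bs)" using bs(1) by (simp add: bij_betw_nth)
  have comb: "comb M bs (\<psi> c) = (\<Oplus>b\<in>set bs. c b \<odot> b)" for c
  proof -
    have "(\<Oplus>b\<in>nth bs ` {..<?n}. c b \<odot> b) = (\<Oplus>i\<in>{..<?n}. c (bs ! i) \<odot> bs ! i)"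
      using bs nth by (intro finsum_reindex) (auto simp: bij_betw_def intro!: smult_closed)
    also have "\<dots> = comb M bs (\<psi> c)"
      unfolding comb_def using bs(2) by (intro finsum_cong') (auto simp: \<psi>_def intro!: smult_closed)
    finally show ?thesis using nth by (simp add: bij_betw_def)
  qed
  have \<psi>: "bij_betw \<psi> (set bs \<rightarrow>\<^sub>E UNIV) (carrier_mat 1 ?n)"
  proof (rule bij_betw_imageI)
    show "inj_on \<psi> (set bs \<rightarrow>\<^sub>E UNIV)"
    proof (rule inj_onI)
      fix c d assume cd: "c \<in> set bs \<rightarrow>\<^sub>E UNIV" "d \<in> set bs \<rightarrow>\<^sub>E UNIV" "\<psi> c = \<psi> d"
      show "c = d"
      proof (rule PiE_ext[OF cd(1,2)])
        fix b assume "b \<in> set bs"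
        then obtain i where i: "i < ?n" "b = bs ! i" by (auto simp: in_set_conv_nth)
        have "\<psi> c $$ (0, i) = \<psi> d $$ (0, i)" using cd by simp
        then show "c b = d b" using i by (simp add: \<psi>_def)
      qed
    qed
    show "\<psi> ` (set bs \<rightarrow>\<^sub>E UNIV) = carrier_mat 1 ?n"
    proof
      show "carrier_mat 1 ?n \<subseteq> \<psi> ` (set bs \<rightarrow>\<^sub>E UNIV)"
      proof
        fix v :: "'r mat" assume v: "v \<in> carrier_mat 1 ?n"
        let ?c = "\<lambda>b\<in>set bs. v $$ (0, inv_into {..<?n} (nth bs) b)"
        have "\<psi> ?c = v"
          using v nth by (intro eq_matI) (auto simp: \<psi>_def bij_betw_inv_into_left)
        then show "v \<in> \<psi> ` (set bs \<rightarrow>\<^sub>E UNIV)" by (metis imageI restrict_PiE_iff UNIV_I)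
      qed
    qed (auto simp: \<psi>_def)
  qed
  have ex1: "(\<exists>!c. c \<in> set bs \<rightarrow>\<^sub>E UNIV \<and> m = (\<Oplus>b\<in>set bs. c b \<odot> b)) \<longleftrightarrow>
      (\<exists>!v. v \<in> carrier_mat 1 ?n \<and> m = comb M bs v)" for m
  proof
    assume "\<exists>!c. c \<in> set bs \<rightarrow>\<^sub>E UNIV \<and> m = (\<Oplus>b\<in>set bs. c b \<odot> b)"
    then obtain c where c: "c \<in> set bs \<rightarrow>\<^sub>E UNIV" "m = comb M bs (\<psi> c)"
      "\<And>c'. c' \<in> set bs \<rightarrow>\<^sub>E UNIV \<Longrightarrow> m = comb M bs (\<psi> c') \<Longrightarrow> c' = c"
      using comb by metis
    show "\<exists>!v. v \<in> carrier_mat 1 ?n \<and> m = comb M bs v"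
    proof (rule ex1I[of _ "\<psi> c"])
      show "\<psi> c \<in> carrier_mat 1 ?n \<and> m = comb M bs (\<psi> c)" using c by (simp add: \<psi>_def)
      fix v assume v: "v \<in> carrier_mat 1 ?n \<and> m = comb M bs v"
      then have "v \<in> \<psi> ` (set bs \<rightarrow>\<^sub>E UNIV)" using \<psi> by (simp add: bij_betw_def)
      then obtain c' where c': "c' \<in> set bs \<rightarrow>\<^sub>E UNIV" "v = \<psi> c'" by blast
      then show "v = \<psi> c" using c(3)[OF c'(1)] v by simp
    qed
  next
    assume "\<exists>!v. v \<in> carrier_mat 1 ?n \<and> m = comb M bs v"
    then obtain v where v: "v \<in> carrier_mat 1 ?n" "m = comb M bs v"
      "\<And>v'. v' \<in> carrier_mat 1 ?n \<Longrightarrow> m = comb M bs v' \<Longrightarrow> v' = v" by blast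
    from v(1) have "v \<in> \<psi> ` (set bs \<rightarrow>\<^sub>E UNIV)" using \<psi> by (simp add: bij_betw_def)
    then obtain c where c: "c \<in> set bs \<rightarrow>\<^sub>E UNIV" "v = \<psi> c" by blast
    show "\<exists>!c. c \<in> set bs \<rightarrow>\<^sub>E UNIV \<and> m = (\<Oplus>b\<in>set bs. c b \<odot> b)"
    proof (rule ex1I[of _ c])
      show "c \<in> set bs \<rightarrow>\<^sub>E UNIV \<and> m = (\<Oplus>b\<in>set bs. c b \<odot> b)" using c v(1,2) comb[of c] by simp
      fix c' assume c': "c' \<in> set bs \<rightarrow>\<^sub>E UNIV \<and> m = (\<Oplus>b\<in>set bs. c' b \<odot> b)"
      then have "\<psi> c' = \<psi> c" using v(3)[of "\<psi> c'"] comb[of c'] c by (simp add: \<psi>_def)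
      then show "c' = c" using \<psi> c c' by (auto simp: bij_betw_def inj_on_def)
    qed
  qed
  have "(\<forall>m\<in>carrier M. \<exists>!v. v \<in> carrier_mat 1 ?n \<and> m = comb M bs v) \<longleftrightarrow>
      bij_betw (comb M bs) (carrier_mat 1 ?n) (carrier M)"
  proof
    assume *: "\<forall>m\<in>carrier M. \<exists>!v. v \<in> carrier_mat 1 ?n \<and> m = comb M bs v"
    show "bij_betw (comb M bs) (carrier_mat 1 ?n) (carrier M)"
    proof (rule bij_betw_imageI)
      show "inj_on (comb M bs) (carrier_mat 1 ?n)"
        using * comb_closed[OF bs(2)] by (intro inj_onI) metis
      show "comb M bs ` carrier_mat 1 ?n = carrier M"
        using * comb_closed[OF bs(2)] by blast
    qed
  next
    assume *: "bij_betw (comb M bs) (carrier_mat 1 ?n) (carrier M)"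
    then have "m \<in> comb M bs ` carrier_mat 1 ?n" if "m \<in> carrier M" for m
      using that by (simp add: bij_betw_def)
    then show "\<forall>m\<in>carrier M. \<exists>!v. v \<in> carrier_mat 1 ?n \<and> m = comb M bs v"
      using * by (auto simp: bij_betw_def inj_on_def)
  qed
  then show ?thesis using bs ex1 by (simp add: is_basis_def is_frame_def)
qed

end

lemma fg_free_modulesE:
  assumes "M \<in> fg_free_modules"
  obtains "left_module M" "strip_module M = M" "\<exists>bs. distinct bs \<and> is_frame M bs"
proof -
  interpret left_module M using assms by (simp add: fg_free_modules_def)
  obtain B where B: "is_basis M B" using assms by (auto simp: fg_free_modules_def)
  then obtain bs where "set bs = B" "distinct bs" using finite_distinct_list[of B] by (auto simp: is_basis_def)
  with B have "distinct bs \<and> is_frame M bs" using is_basis_iff_is_frame by (auto simp: is_basis_def)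
  then show thesis using that assms by (auto simp: fg_free_modules_def)
qed

section \<open>The matrix of an isomorphism\<close>

text \<open>The matrix of \<open>f\<inverse>\<close> with respect to the frames, acting on rows from the right. Passing to the
  inverse turns composition of maps into multiplication of matrices in the same order.\<close>

definition is_matrix_of ::
  "('r::ring_1, 'm) module \<Rightarrow> 'm list \<Rightarrow> ('r, 'm) module \<Rightarrow> 'm list \<Rightarrow> ('m \<Rightarrow> 'm) \<Rightarrow> 'r mat \<Rightarrow> bool" where
  "is_matrix_of M bs N cs f A \<longleftrightarrow> A \<in> carrier_mat (length cs) (length bs) \<and>
     (\<forall>v\<in>carrier_mat 1 (length cs). f (comb M bs (v * A)) = comb N cs v)"

lemma is_frame_bij: "is_frame M bs \<Longrightarrow> bij_betw (comb M bs) (carrier_mat 1 (length bs)) (carrier M)"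
  by (simp add: is_frame_def)

lemma comb_in_carrier: "is_frame M bs \<Longrightarrow> v \<in> carrier_mat 1 (length bs) \<Longrightarrow> comb M bs v \<in> carrier M"
  using is_frame_bij bij_betwE by blast

lemma module_isosD:
  assumes "f \<in> module_isos M N"
  shows "f \<in> extensional (carrier M)" "bij_betw f (carrier M) (carrier N)"
    "\<And>m. m \<in> carrier M \<Longrightarrow> f m \<in> carrier N"
    "\<And>m m'. m \<in> carrier M \<Longrightarrow> m' \<in> carrier M \<Longrightarrow> f (m \<oplus>\<^bsub>M\<^esub> m') = f m \<oplus>\<^bsub>N\<^esub> f m'"
    "\<And>r m. m \<in> carrier M \<Longrightarrow> f (r \<odot>\<^bsub>M\<^esub> m) = r \<odot>\<^bsub>N\<^esub> f m"
  using assms by (auto simp: module_isos_def bij_betw_def)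

lemma is_matrix_of_unique:
  fixes M N :: "('r::ring_1, 'm) module"
  assumes M: "is_frame M bs" and f: "inj_on f (carrier M)"
    and A: "is_matrix_of M bs N cs f A" "is_matrix_of M bs N cs f B"
  shows "A = B"
proof (rule mat_eq_if_mult_row_eq)
  show AB: "A \<in> carrier_mat (length cs) (length bs)" "B \<in> carrier_mat (length cs) (length bs)"
    using A by (auto simp: is_matrix_of_def)
  fix v :: "'r mat" assume v: "v \<in> carrier_mat 1 (length cs)"
  then have "f (comb M bs (v * A)) = f (comb M bs (v * B))" using A by (simp add: is_matrix_of_def)
  moreover have vA: "v * A \<in> carrier_mat 1 (length bs)" "v * B \<in> carrier_mat 1 (length bs)"
    using v AB by auto
  ultimately have "comb M bs (v * A) = comb M bs (v * B)"
    using f comb_in_carrier[OF M] by (auto simp: inj_on_def)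
  then show "v * A = v * B" using is_frame_bij[OF M] vA by (auto simp: bij_betw_def inj_on_def)
qed

text \<open>\<open>L\<close> sends the coordinates of an element of \<open>N\<close> to those of its
  preimage under \<open>f\<close>. Its linearity is checked after the injective \<open>h\<close>,
  where it follows from linearity of \<open>f\<close> and of \<open>comb\<close>.\<close>

lemma ex_is_matrix_of:
  fixes M N :: "('r::ring_1, 'm) module"
  assumes lm: "left_module M" "left_module N" and M: "is_frame M bs" and N: "is_frame N cs"
    and f: "f \<in> module_isos M N"
  shows "\<exists>A. is_matrix_of M bs N cs f A"
proof -
  interpret M: left_module M by fact
  interpret N: left_module N by fact
  let ?n = "length cs" and ?m = "length bs"
  have bs: "set bs \<subseteq> carrier M" and cs: "set cs \<subseteq> carrier N" using M N by (auto simp: is_frame_def)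
  note f = module_isosD[OF f]
  define h where "h = (\<lambda>w. f (comb M bs w))"
  have h: "bij_betw h (carrier_mat 1 ?m) (carrier N)"
    using bij_betw_trans[OF is_frame_bij[OF M] f(2)] by (simp add: h_def o_def)
  define L where "L v = inv_into (carrier_mat 1 ?m) h (comb N cs v)" for v
  have L: "L v \<in> carrier_mat 1 ?m" "h (L v) = comb N cs v" if "v \<in> carrier_mat 1 ?n" for v
    using h comb_in_carrier[OF N that] by (auto simp: L_def bij_betw_def inv_into_into f_inv_into_f)
  have eq: "v = w" if "v \<in> carrier_mat 1 ?m" "w \<in> carrier_mat 1 ?m" "h v = h w" for v w
    using h that by (auto simp: bij_betw_def inj_on_def)
  have "\<exists>A\<in>carrier_mat ?n ?m. \<forall>v\<in>carrier_mat 1 ?n. L v = v * A"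
  proof (rule linear_row_map_eq_mult)
    fix v w :: "'r mat" assume vw: "v \<in> carrier_mat 1 ?n" "w \<in> carrier_mat 1 ?n"
    have "h (L v + L w) = h (L v) \<oplus>\<^bsub>N\<^esub> h (L w)"
      using L(1)[OF vw(1)] L(1)[OF vw(2)] f(4) comb_in_carrier[OF M] M.comb_add[OF bs] by (simp add: h_def)
    also have "\<dots> = h (L (v + w))"
      using L(2)[of "v + w"] vw L(2) N.comb_add[OF cs] by simp
    finally show "L (v + w) = L v + L w" using L(1) vw by (intro eq) auto
  next
    fix r and v :: "'r mat" assume v: "v \<in> carrier_mat 1 ?n"
    have "h (r \<cdot>\<^sub>m L v) = r \<odot>\<^bsub>N\<^esub> h (L v)"
      using L(1)[OF v] f(5) comb_in_carrier[OF M] M.comb_smult[OF bs] by (simp add: h_def)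
    also have "\<dots> = h (L (r \<cdot>\<^sub>m v))"
      using L(2)[of "r \<cdot>\<^sub>m v"] v L(2) N.comb_smult[OF cs] by simp
    finally show "L (r \<cdot>\<^sub>m v) = r \<cdot>\<^sub>m L v" using L(1) v by (intro eq) auto
  qed (rule L)
  then obtain A where A: "A \<in> carrier_mat ?n ?m" "\<And>v. v \<in> carrier_mat 1 ?n \<Longrightarrow> L v = v * A" by blast
  then have "f (comb M bs (v * A)) = comb N cs v" if "v \<in> carrier_mat 1 ?n" for v
    using L(2)[OF that] that by (simp add: h_def)
  then show ?thesis using A by (auto simp: is_matrix_of_def)
qed

lemma is_matrix_of_id:
  "is_frame M bs \<Longrightarrow> is_matrix_of M bs M bs (\<lambda>m\<in>carrier M. m) (1\<^sub>m (length bs))"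
  using comb_in_carrier by (auto simp: is_matrix_of_def)

text \<open>On rows, \<open>v * (B * A)\<close> applies \<open>B\<close> before \<open>A\<close>;
  then \<open>f\<close> undoes \<open>A\<close> and \<open>g\<close> undoes \<open>B\<close>. So
  inverses acting from the right compose covariantly.\<close>

lemma is_matrix_of_comp:
  fixes M N P :: "('r::ring_1, 'm) module"
  assumes M: "is_frame M bs" and A: "is_matrix_of M bs N cs f A" and B: "is_matrix_of N cs P ds g B"
  shows "is_matrix_of M bs P ds (\<lambda>m\<in>carrier M. g (f m)) (B * A)"
  unfolding is_matrix_of_def
proof (intro conjI ballI)
  have AB: "A \<in> carrier_mat (length cs) (length bs)" "B \<in> carrier_mat (length ds) (length cs)"
    using A B by (auto simp: is_matrix_of_def)
  then show "B * A \<in> carrier_mat (length ds) (length bs)" by simp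
  fix v :: "'r mat" assume v: "v \<in> carrier_mat 1 (length ds)"
  then have vB: "v * B \<in> carrier_mat 1 (length cs)" using AB by simp
  have "v * (B * A) = v * B * A" using v AB by simp
  moreover have "comb M bs (v * B * A) \<in> carrier M"
    by (rule comb_in_carrier[OF M]) (use vB AB in simp)
  ultimately show "(\<lambda>m\<in>carrier M. g (f m)) (comb M bs (v * (B * A))) = comb P ds v"
    using A B v vB by (simp add: is_matrix_of_def)
qed

section \<open>Identities, composites and inverses of module isomorphisms\<close>

lemma module_isos_id: "(\<lambda>m\<in>carrier M. m) \<in> module_isos M M" if "left_module M"
proof -
  interpret left_module M by fact
  have "bij_betw (\<lambda>m\<in>carrier M. m) (carrier M) (carrier M)" by (simp add: bij_betw_def inj_on_def)
  then show ?thesis by (auto simp: module_isos_def smult_closed)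
qed

lemma module_isos_comp:
  assumes "left_module M" "f \<in> module_isos M N" "g \<in> module_isos N P"
  shows "(\<lambda>m\<in>carrier M. g (f m)) \<in> module_isos M P"
proof -
  interpret left_module M by fact
  note f = module_isosD[OF assms(2)] and g = module_isosD[OF assms(3)]
  have "bij_betw (\<lambda>m\<in>carrier M. g (f m)) (carrier M) (carrier P)"
    using bij_betw_trans[OF f(2) g(2)] by (rule bij_betw_cong[THEN iffD1, rotated]) simp
  then show ?thesis using f g by (simp add: module_isos_def smult_closed)
qed

lemma module_isos_inverse:
  assumes M: "left_module M" and N: "left_module N" and f: "f \<in> module_isos M N"
  defines "f' \<equiv> \<lambda>n\<in>carrier N. inv_into (carrier M) f n"
  shows "f' \<in> module_isos N M" "(\<lambda>m\<in>carrier M. f' (f m)) = (\<lambda>m\<in>carrier M. m)"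
    "(\<lambda>n\<in>carrier N. f (f' n)) = (\<lambda>n\<in>carrier N. n)"
proof -
  interpret M: left_module M by fact
  interpret N: left_module N by fact
  note fD = module_isosD[OF f]
  have b: "bij_betw f' (carrier N) (carrier M)"
    using bij_betw_inv_into[OF fD(2)] by (rule bij_betw_cong[THEN iffD1, rotated]) (simp add: f'_def)
  have f'f: "f' (f m) = m" if "m \<in> carrier M" for m
    using that fD(3)[OF that] bij_betw_inv_into_left[OF fD(2) that] by (simp add: f'_def)
  have ff': "f (f' n) = n" if "n \<in> carrier N" for n
    using that bij_betw_inv_into_right[OF fD(2) that] by (simp add: f'_def)
  have f': "f' n \<in> carrier M" if "n \<in> carrier N" for n using b that by (rule bij_betwE[THEN bspec])
  have "f' (n \<oplus>\<^bsub>N\<^esub> n') = f' n \<oplus>\<^bsub>M\<^esub> f' n'" if "n \<in> carrier N" "n' \<in> carrier N" for n n'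
    using f'f[of "f' n \<oplus>\<^bsub>M\<^esub> f' n'"] fD(4)[OF f' f'] ff' f' that by simp
  moreover have "f' (r \<odot>\<^bsub>N\<^esub> n) = r \<odot>\<^bsub>M\<^esub> f' n" if "n \<in> carrier N" for r n
    using f'f[of "r \<odot>\<^bsub>M\<^esub> f' n"] fD(5)[OF f'] ff' f' that M.smult_closed by simp
  ultimately show "f' \<in> module_isos N M" using b by (auto simp: module_isos_def f'_def)
  show "(\<lambda>m\<in>carrier M. f' (f m)) = (\<lambda>m\<in>carrier M. m)" using f'f by (intro restrict_ext)
  show "(\<lambda>n\<in>carrier N. f (f' n)) = (\<lambda>n\<in>carrier N. n)" using ff' by (intro restrict_ext)
qed

section \<open>Invertible matrices as matrices of isomorphisms\<close>

lemma invertible_matI: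
  assumes "A \<in> carrier_mat n n" "B \<in> carrier_mat n n" "A * B = 1\<^sub>m n" "B * A = 1\<^sub>m n"
  shows "invertible_mat A"
  using assms by (auto simp: invertible_mat_def inverts_mat_def square_mat.simps)

lemma invertible_matE:
  assumes "invertible_mat A"
  obtains n B where "A \<in> carrier_mat n n" "B \<in> carrier_mat n n" "A * B = 1\<^sub>m n" "B * A = 1\<^sub>m n"
proof -
  obtain n where n: "dim_row A = n" by simp
  obtain B where B: "A * B = 1\<^sub>m n" "B * A = 1\<^sub>m (dim_row B)" and sq: "dim_col A = n"
    using assms n by (auto simp: invertible_mat_def inverts_mat_def square_mat.simps)
  have dB: "dim_col B = n" "dim_row B = n"
    using arg_cong[OF B(1), of dim_col] arg_cong[OF B(2), of dim_col] sq by simp_all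
  show thesis
  proof (rule that[of n B])
    show "A \<in> carrier_mat n n" "B \<in> carrier_mat n n"
      using dB sq n by (auto intro!: carrier_matI)
    show "B * A = 1\<^sub>m n" using B(2) dB by simp
  qed (rule B(1))
qed

text \<open>The matrices of \<open>f\<close> and of its inverse are mutually inverse but a priori
  rectangular; invariant basis number makes them square.\<close>

lemma is_matrix_of_invertible:
  fixes M N :: "('r::ring_1, 'm) module"
  assumes ibn: "invariant_basis_number TYPE('r)"
    and lm: "left_module M" "left_module N" and M: "is_frame M bs" and N: "is_frame N cs"
    and f: "f \<in> module_isos M N" and A: "is_matrix_of M bs N cs f A"
  shows "length bs = length cs" "invertible_mat A"
proof -
  let ?f' = "\<lambda>n\<in>carrier N. inv_into (carrier M) f n"
  note f' = module_isos_inverse[OF lm f]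
  obtain B where B: "is_matrix_of N cs M bs ?f' B" using ex_is_matrix_of[OF lm(2,1) N M f'(1)] by blast
  have inj: "inj_on (\<lambda>m\<in>carrier P. m) (carrier P)" for P :: "('r, 'm) module" by (simp add: inj_on_def)
  have BA: "B * A = 1\<^sub>m (length bs)"
    using is_matrix_of_unique[OF M inj _ is_matrix_of_id[OF M]] is_matrix_of_comp[OF M A B] f'(2) by simp
  have AB: "A * B = 1\<^sub>m (length cs)"
    using is_matrix_of_unique[OF N inj _ is_matrix_of_id[OF N]] is_matrix_of_comp[OF N B A] f'(3) by simp
  have c: "A \<in> carrier_mat (length cs) (length bs)" "B \<in> carrier_mat (length bs) (length cs)"
    using A B by (auto simp: is_matrix_of_def)
  then show "length bs = length cs" using ibn AB BA unfolding invariant_basis_number_def by metis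
  then show "invertible_mat A" using c AB BA by (intro invertible_matI[of _ "length cs" B]) auto
qed

text \<open>The matrix condition prescribes \<open>f (k v) = comb N cs v\<close>. Invertibility of
  \<open>A\<close> makes \<open>k\<close> a bijection onto the carrier of \<open>M\<close>, so this
  both defines and determines \<open>f\<close>.\<close>

lemma ex_iso_of_matrix:
  fixes M N :: "('r::ring_1, 'm) module"
  assumes lm: "left_module M" "left_module N" and M: "is_frame M bs" and N: "is_frame N cs"
    and A: "A \<in> carrier_mat n n" "B \<in> carrier_mat n n" "A * B = 1\<^sub>m n" "B * A = 1\<^sub>m n"
    and n: "length bs = n" "length cs = n"
  shows "\<exists>!f. f \<in> module_isos M N \<and> is_matrix_of M bs N cs f A"
proof -
  interpret M: left_module M by fact
  interpret N: left_module N by fact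
  have bs: "set bs \<subseteq> carrier M" and cs: "set cs \<subseteq> carrier N" using M N by (auto simp: is_frame_def)
  let ?R = "carrier_mat 1 n :: 'r mat set"
  have bM: "bij_betw (comb M bs) ?R (carrier M)" and bN: "bij_betw (comb N cs) ?R (carrier N)"
    using is_frame_bij[OF M] is_frame_bij[OF N] n by auto
  have bA: "bij_betw (\<lambda>v. v * A) ?R ?R"
    by (rule bij_betw_byWitness[where f' = "\<lambda>v. v * B"])
      (use A in \<open>auto simp: assoc_mult_mat[of _ 1 n _ n _ n]\<close>)
  define k where "k = (\<lambda>v. comb M bs (v * A))"
  have k: "bij_betw k ?R (carrier M)"
    using bij_betw_trans[OF bA bM] by (simp add: k_def o_def)
  define f where "f = (\<lambda>m\<in>carrier M. comb N cs (inv_into ?R k m))"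
  have kR: "k v \<in> carrier M" if "v \<in> ?R" for v using k that bij_betwE by blast
  have fk: "f (k v) = comb N cs v" if "v \<in> ?R" for v
    using that kR[OF that] bij_betw_inv_into_left[OF k that] by (simp add: f_def)
  have k_ex: "\<exists>v\<in>?R. m = k v" if "m \<in> carrier M" for m using k that by (auto simp: bij_betw_def)
  have k_add: "k (v + w) = k v \<oplus>\<^bsub>M\<^esub> k w" if "v \<in> ?R" "w \<in> ?R" for v w
    using that A n M.comb_add[OF bs, of "v * A" "w * A"] add_mult_distrib_mat[OF that A(1)] by (simp add: k_def)
  have k_smult: "k (r \<cdot>\<^sub>m v) = r \<odot>\<^bsub>M\<^esub> k v" if "v \<in> ?R" for r v
    using that A n M.comb_smult[OF bs, of "v * A"] smult_mult_mat[OF that A(1)] by (simp add: k_def)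
  have iso: "f \<in> module_isos M N"
    unfolding module_isos_def mem_Collect_eq
  proof (intro conjI ballI allI)
    have "bij_betw (\<lambda>m. comb N cs (inv_into ?R k m)) (carrier M) (carrier N)"
      using bij_betw_trans[OF bij_betw_inv_into[OF k] bN] by (simp add: o_def)
    then show "bij_betw f (carrier M) (carrier N)"
      by (rule bij_betw_cong[THEN iffD1, rotated]) (simp add: f_def)
    show "f (m \<oplus>\<^bsub>M\<^esub> m') = f m \<oplus>\<^bsub>N\<^esub> f m'" if "m \<in> carrier M" "m' \<in> carrier M" for m m'
    proof -
      obtain v w where "v \<in> ?R" "w \<in> ?R" "m = k v" "m' = k w" using k_ex \<open>m \<in> carrier M\<close> \<open>m' \<in> carrier M\<close> by metis
      then show ?thesis using k_add[of v w, symmetric] fk N.comb_add[OF cs, of v w] n by simp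
    qed
    show "f (r \<odot>\<^bsub>M\<^esub> m) = r \<odot>\<^bsub>N\<^esub> f m" if m: "m \<in> carrier M" for r m
    proof -
      obtain v where "v \<in> ?R" "m = k v" using k_ex[OF m] by blast
      then show ?thesis using k_smult[of v r, symmetric] fk N.comb_smult[OF cs, of v] n by simp
    qed
  qed (simp add: f_def)
  show ?thesis
  proof (rule ex1I[of _ f])
    show "f \<in> module_isos M N \<and> is_matrix_of M bs N cs f A"
      using iso fk A n by (simp add: is_matrix_of_def k_def)
    fix f' assume f': "f' \<in> module_isos M N \<and> is_matrix_of M bs N cs f' A"
    show "f' = f"
    proof (rule extensionalityI[of _ "carrier M"])
      show "f' \<in> extensional (carrier M)" "f \<in> extensional (carrier M)"
        using f' iso module_isosD(1) by blast+
      fix m assume "m \<in> carrier M"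
      then obtain v where "v \<in> ?R" "m = k v" using k_ex by blast
      then show "f' m = f m" using fk f' n by (simp add: is_matrix_of_def k_def)
    qed
  qed
qed

section \<open>The action on modules and matrices\<close>

context g_ring
begin

lemma semiring_hom_act: assumes "g \<in> carrier G" shows "semiring_hom (act g)"
proof
  \<comment> \<open>Preservation of 0 is no axiom of the action; it follows from additivity by
    cancellation.\<close>
  have "act g 0 + act g 0 = act g 0 + 0" using act_add[OF assms, of 0 0] by simp
  then show "act g 0 = 0" by (simp only: add_left_cancel)
qed (use assms act_add act_times act_1 in auto)

lemma act_inv:
  assumes "g \<in> carrier G" shows "act (inv g) (act g r) = r" "act g (act (inv g) r) = r"
  using act_mult[of "inv g" g r] act_mult[of g "inv g" r] assms act_one by simp_all

lemma map_act_mult: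
  "\<lbrakk>g \<in> carrier G; A \<in> carrier_mat n k; B \<in> carrier_mat k m\<rbrakk>
     \<Longrightarrow> map_mat (act g) (A * B) = map_mat (act g) A * map_mat (act g) B"
  using semiring_hom.mat_hom_mult[OF semiring_hom_act] by blast

lemma map_act_one: "g \<in> carrier G \<Longrightarrow> map_mat (act g) (1\<^sub>m n) = 1\<^sub>m n"
  using semiring_hom.mat_hom_one[OF semiring_hom_act] by blast

lemma map_act_inv:
  "g \<in> carrier G \<Longrightarrow> map_mat (act (inv g)) (map_mat (act g) A) = A"
  "g \<in> carrier G \<Longrightarrow> map_mat (act g) (map_mat (act (inv g)) A) = A"
  by (auto intro!: eq_matI simp: act_inv)

lemma map_act_invertible:
  assumes g: "g \<in> carrier G" and A: "invertible_mat A"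
  shows "invertible_mat (map_mat (act g) A)"
proof -
  obtain n B where B: "A \<in> carrier_mat n n" "B \<in> carrier_mat n n" "A * B = 1\<^sub>m n" "B * A = 1\<^sub>m n"
    using A by (rule invertible_matE)
  show ?thesis
  proof (rule invertible_matI[of _ n "map_mat (act g) B"])
    show "map_mat (act g) A * map_mat (act g) B = 1\<^sub>m n"
      using map_act_mult[OF g B(1,2)] map_act_one[OF g] B(3) by simp
    show "map_mat (act g) B * map_mat (act g) A = 1\<^sub>m n"
      using map_act_mult[OF g B(2,1)] map_act_one[OF g] B(4) by simp
  qed (use B in simp_all)
qed

lemma twist_module_simps [simp]:
  "carrier (twist_module G act g M) = carrier M" "add (twist_module G act g M) = add M"
  "zero (twist_module G act g M) = zero M"
  "smult (twist_module G act g M) r m = smult M (act (inv g) r) m"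
  by (simp_all add: twist_module_def)

text \<open>Finite sums are formed in the additive monoid alone, so they agree in a module and its
  twist.\<close>

lemma add_monoid_twist: "add_monoid (twist_module G act g M) = add_monoid M"
  by simp

lemma comb_twist:
  assumes M: "left_module M" and bs: "set bs \<subseteq> carrier M" and v: "v \<in> carrier_mat 1 (length bs)"
  shows "comb (twist_module G act g M) bs v = comb M bs (map_mat (act (inv g)) v)"
proof -
  interpret M: left_module M by fact
  have "comb (twist_module G act g M) bs v = (\<Oplus>\<^bsub>M\<^esub>i\<in>{..<length bs}. act (inv g) (v $$ (0, i)) \<odot>\<^bsub>M\<^esub> bs ! i)"
    unfolding comb_def finsum_def add_monoid_twist by simp
  also have "\<dots> = comb M bs (map_mat (act (inv g)) v)"
    unfolding comb_def
  proof (rule M.finsum_cong')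
    have "bs ! i \<in> carrier M" if "i < length bs" for i using bs that by auto
    then show "(\<lambda>i. map_mat (act (inv g)) v $$ (0, i) \<odot>\<^bsub>M\<^esub> bs ! i) \<in> {..<length bs} \<rightarrow> carrier M"
      by (auto intro!: M.smult_closed)
  qed (use v in auto)
  finally show ?thesis .
qed

lemma left_module_twist:
  assumes g: "g \<in> carrier G" and M: "left_module M"
  shows "left_module (twist_module G act g M)"
proof -
  interpret M: left_module M by fact
  have "abelian_group (twist_module G act g M)"
    using M.abelian_group_axioms
    by (simp add: abelian_group_def abelian_monoid_def abelian_group_axioms_def)
  then show ?thesis
    unfolding left_module_def left_module_axioms_def
    using g act_add act_times act_1 M.smult_closed M.smult_l_distr M.smult_r_distr M.smult_assoc M.smult_one
    by simp
qed

text \<open>With the same list, combinations in the twist differ only by applying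
  \<open>act (inv g)\<close> to the entries of the row, a bijection on rows.\<close>

lemma is_frame_twist_imp:
  assumes g: "g \<in> carrier G" and M: "left_module M" and bs: "is_frame M bs"
  shows "is_frame (twist_module G act g M) bs"
proof -
  have "bij_betw (map_mat (act (inv g))) (carrier_mat 1 (length bs)) (carrier_mat 1 (length bs))"
    by (rule bij_betw_byWitness[where f' = "map_mat (act g)"]) (use g map_act_inv in auto)
  then have "bij_betw (comb M bs \<circ> map_mat (act (inv g))) (carrier_mat 1 (length bs)) (carrier M)"
    using is_frame_bij[OF bs] by (rule bij_betw_trans)
  then have "bij_betw (comb (twist_module G act g M) bs) (carrier_mat 1 (length bs)) (carrier M)"
    by (rule bij_betw_cong[THEN iffD1, rotated]) (use bs in \<open>simp add: comb_twist[OF M] is_frame_def\<close>)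
  then show ?thesis using bs by (simp add: is_frame_def)
qed

lemma twist_twist:
  assumes "g \<in> carrier G" "h \<in> carrier G"
  shows "twist_module G act (g \<otimes> h) M = twist_module G act g (twist_module G act h M)"
  using assms by (auto simp: twist_module_def inv_mult_group act_mult)

lemma twist_one: "twist_module G act \<one> M = M"
  by (simp add: twist_module_def act_one)

text \<open>The converse is the forward direction for \<open>inv g\<close>. Having an equivalence
  makes the choice of a frame by \<open>SOME\<close> give the same list for a module and its
  twist.\<close>

lemma is_frame_twist:
  assumes g: "g \<in> carrier G" and M: "left_module M"
  shows "is_frame (twist_module G act g M) bs \<longleftrightarrow> is_frame M bs"
proof
  assume "is_frame (twist_module G act g M) bs"
  then have "is_frame (twist_module G act (inv g) (twist_module G act g M)) bs"
    using is_frame_twist_imp[OF inv_closed[OF g] left_module_twist[OF g M]] by blast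
  moreover have "twist_module G act (inv g) (twist_module G act g M) = M"
    using g twist_twist[of "inv g" g M] by (simp add: twist_one)
  ultimately show "is_frame M bs" by simp
qed (rule is_frame_twist_imp[OF g M])

lemma twist_fg_free:
  assumes g: "g \<in> carrier G" and M: "M \<in> fg_free_modules"
  shows "twist_module G act g M \<in> fg_free_modules"
proof -
  obtain bs where bs: "left_module M" "strip_module M = M" "distinct bs" "is_frame M bs"
    using M by (auto elim!: fg_free_modulesE)
  have T: "left_module (twist_module G act g M)" using left_module_twist[OF g bs(1)] .
  have "is_basis (twist_module G act g M) (set bs)"
    using left_module.is_basis_iff_is_frame[OF T bs(3)] is_frame_twist_imp[OF g bs(1,4)] bs(4)
    by (simp add: is_frame_def)
  \<comment> \<open>Twisting keeps the carrier and only changes scalars, so it preserves the normal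
    form of records.\<close>
  moreover have "strip_module (twist_module G act g M) = twist_module G act g (strip_module M)"
    by (auto simp: strip_module_def twist_module_def fun_eq_iff restrict_def)
  ultimately show ?thesis using T bs(2) by (auto simp: fg_free_modules_def)
qed

lemma twist_module_isos:
  assumes g: "g \<in> carrier G" and f: "f \<in> module_isos M N"
  shows "f \<in> module_isos (twist_module G act g M) (twist_module G act g N)"
  using f by (simp add: module_isos_def)

text \<open>The map \<open>f\<close> stays the same while coordinates are twisted by
  \<open>inv g\<close>. Applying \<open>g\<close> to the entries of \<open>A\<close> compensates,
  since \<open>inv g\<close> takes \<open>v * g A\<close> to \<open>(inv g v) * A\<close>.\<close>

lemma is_matrix_of_twist:
  assumes g: "g \<in> carrier G" and lm: "left_module M" "left_module N"
    and bs: "set bs \<subseteq> carrier M" and cs: "set cs \<subseteq> carrier N" and A: "is_matrix_of M bs N cs f A"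
  shows "is_matrix_of (twist_module G act g M) bs (twist_module G act g N) cs f (map_mat (act g) A)"
  unfolding is_matrix_of_def
proof (intro conjI ballI)
  have A': "A \<in> carrier_mat (length cs) (length bs)" using A by (simp add: is_matrix_of_def)
  then show gA: "map_mat (act g) A \<in> carrier_mat (length cs) (length bs)" by simp
  fix v :: "'r mat" assume v: "v \<in> carrier_mat 1 (length cs)"
  have g': "inv g \<in> carrier G" using g by simp
  have v': "map_mat (act (inv g)) v \<in> carrier_mat 1 (length cs)" using v by simp
  have "map_mat (act (inv g)) (v * map_mat (act g) A) = map_mat (act (inv g)) v * A"
    using map_act_mult[OF g' v gA] map_act_inv(1)[OF g] by simp
  moreover have "v * map_mat (act g) A \<in> carrier_mat 1 (length bs)" using v gA by (rule mult_carrier_mat)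
  ultimately show "f (comb (twist_module G act g M) bs (v * map_mat (act g) A))
      = comb (twist_module G act g N) cs v"
    using A v v' by (simp only: comb_twist[OF lm(1) bs] comb_twist[OF lm(2) cs] is_matrix_of_def)
qed

end

section \<open>The categories of free modules and of matrices\<close>

lemma isoF_gcat_simps [simp]:
  "Obj (isoF_gcat G act) = fg_free_modules"
  "Arr (isoF_gcat G act) = {(M, N, f). M \<in> fg_free_modules \<and> N \<in> fg_free_modules \<and> f \<in> module_isos M N}"
  "Src (isoF_gcat G act) (M, N, f) = M" "Tgt (isoF_gcat G act) (M, N, f) = N"
  "Idt (isoF_gcat G act) M = (M, M, \<lambda>m\<in>carrier M. m)"
  "Cmp (isoF_gcat G act) (N', P, f') (M, N, f) = (M, P, \<lambda>m\<in>carrier M. f' (f m))"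
  "M \<in> fg_free_modules \<Longrightarrow> omap (gact (isoF_gcat G act) g) M = twist_module G act g M"
  "\<lbrakk>M \<in> fg_free_modules; N \<in> fg_free_modules; f \<in> module_isos M N\<rbrakk> \<Longrightarrow>
    amap (gact (isoF_gcat G act) g) (M, N, f) = (twist_module G act g M, twist_module G act g N, f)"
  by (simp_all add: isoF_gcat_def Let_def)

lemma isoF_gcat_gact_extensional:
  "omap (gact (isoF_gcat G act) g) \<in> extensional fg_free_modules"
  "amap (gact (isoF_gcat G act) g) \<in> extensional (Arr (isoF_gcat G act))"
  by (simp_all add: isoF_gcat_def Let_def)

lemma fg_free_left_module: "M \<in> fg_free_modules \<Longrightarrow> left_module M"
  by (simp add: fg_free_modules_def)

lemma groupoid_isoF: "groupoid (isoF_gcat G act)" (is "groupoid ?K")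
proof
  fix a assume "a \<in> Arr ?K"
  then obtain M N f where a: "a = (M, N, f)" "M \<in> fg_free_modules" "N \<in> fg_free_modules" "f \<in> module_isos M N"
    by auto
  note f = module_isosD[OF a(4)]
  show "Src ?K a \<in> Obj ?K" "Tgt ?K a \<in> Obj ?K"
    using a by auto
  have "(\<lambda>m\<in>carrier M. f ((\<lambda>m\<in>carrier M. m) m)) = f" "(\<lambda>m\<in>carrier M. (\<lambda>n\<in>carrier N. n) (f m)) = f"
    using f(1,3) by (auto intro!: extensionalityI[of _ "carrier M"])
  then show "Cmp ?K a (Idt ?K (Src ?K a)) = a"
    "Cmp ?K (Idt ?K (Tgt ?K a)) a = a"
    using a by auto
  show "\<exists>b\<in>Arr ?K. Src ?K b = Tgt ?K a \<and>
      Tgt ?K b = Src ?K a \<and>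
      Cmp ?K b a = Idt ?K (Src ?K a) \<and>
      Cmp ?K a b = Idt ?K (Tgt ?K a)"
    using a module_isos_inverse[OF fg_free_left_module[OF a(2)] fg_free_left_module[OF a(3)] a(4)]
    by (intro bexI[of _ "(N, M, \<lambda>n\<in>carrier N. inv_into (carrier M) f n)"]) simp_all
  fix b assume "b \<in> Arr ?K" "Tgt ?K a = Src ?K b"
  then obtain P f' where b: "b = (N, P, f')" "P \<in> fg_free_modules" "f' \<in> module_isos N P"
    using a by auto
  show "Cmp ?K b a \<in> Arr ?K \<and>
      Src ?K (Cmp ?K b a) = Src ?K a \<and>
      Tgt ?K (Cmp ?K b a) = Tgt ?K b"
    using a b module_isos_comp[OF fg_free_left_module[OF a(2)] a(4) b(3)] by simp
  fix c assume "c \<in> Arr ?K" "Tgt ?K b = Src ?K c"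
  then obtain Q f'' where c: "c = (P, Q, f'')" using b by auto
  show "Cmp ?K c (Cmp ?K b a) = Cmp ?K (Cmp ?K c b) a"
    using a b c f(3) by (auto intro!: restrict_ext)
next
  fix M assume "M \<in> Obj ?K"
  then show "Idt ?K M \<in> Arr ?K \<and>
      Src ?K (Idt ?K M) = M \<and> Tgt ?K (Idt ?K M) = M"
    using module_isos_id[OF fg_free_left_module] by simp
qed

lemma (in g_ring) gcategory_isoF: "gcategory G (isoF_gcat G act)"
proof -
  let ?K = "isoF_gcat G act"
  interpret K: groupoid ?K by (rule groupoid_isoF)
  have gfun: "is_functor ?K ?K (gact ?K g)" if g: "g \<in> carrier G" for g
    unfolding is_functor_def
  proof (intro conjI ballI impI)
    show "omap (gact ?K g) \<in> Obj ?K \<rightarrow>\<^sub>E Obj ?K"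
      using isoF_gcat_gact_extensional(1)[of G act g] twist_fg_free[OF g] by (auto simp: PiE_def)
    show "amap (gact ?K g) \<in> Arr ?K \<rightarrow>\<^sub>E Arr ?K"
      using isoF_gcat_gact_extensional(2)[of G act g] twist_fg_free[OF g] twist_module_isos[OF g]
      by (auto simp: PiE_def)
    show "amap (gact ?K g) (Idt ?K M) = Idt ?K (omap (gact ?K g) M)" if "M \<in> Obj ?K" for M
    proof -
      have M: "M \<in> fg_free_modules" using that by simp
      then show ?thesis
        using isoF_gcat_simps(8)[OF M M module_isos_id[OF fg_free_left_module[OF M]]] by simp
    qed
    fix a assume "a \<in> Arr ?K"
    then obtain M N f where a: "a = (M, N, f)" "M \<in> fg_free_modules" "N \<in> fg_free_modules" "f \<in> module_isos M N"
      by auto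
    then show "Src ?K (amap (gact ?K g) a) = omap (gact ?K g) (Src ?K a)"
      "Tgt ?K (amap (gact ?K g) a) = omap (gact ?K g) (Tgt ?K a)" by auto
    fix b assume "b \<in> Arr ?K" "Tgt ?K a = Src ?K b"
    then obtain P f' where b: "b = (N, P, f')" "P \<in> fg_free_modules" "f' \<in> module_isos N P"
      using a by auto
    show "amap (gact ?K g) (Cmp ?K b a) = Cmp ?K (amap (gact ?K g) b) (amap (gact ?K g) a)"
      using a b module_isos_comp[OF fg_free_left_module[OF a(2)] a(4) b(3)] by simp
  qed
  show ?thesis
  proof unfold_locales
    show "gact ?K \<one> = id_fctr ?K"
      using gfun[OF one_closed] K.is_functor_id by (rule functor_eqI) (auto simp: twist_one)
    show "gact ?K (g \<otimes> h) = comp_fctr ?K (gact ?K g) (gact ?K h)" if "g \<in> carrier G" "h \<in> carrier G" for g h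
      using gfun[OF m_closed[OF that]] K.is_functor_comp[OF gfun[OF that(2)] gfun[OF that(1)]]
      by (rule functor_eqI) (use that in \<open>auto simp: twist_twist twist_fg_free twist_module_isos\<close>)
  qed (rule gfun)
qed

lemma GL_gcat_simps [simp]:
  "Obj (GL_gcat act) = UNIV" "Arr (GL_gcat act) = {A. invertible_mat A}"
  "Src (GL_gcat act) = dim_row" "Tgt (GL_gcat act) = dim_row"
  "Idt (GL_gcat act) n = 1\<^sub>m n" "Cmp (GL_gcat act) A B = A * B"
  "omap (gact (GL_gcat act) g) n = n"
  "invertible_mat A \<Longrightarrow> amap (gact (GL_gcat act) g) A = map_mat (act g) A"
  by (simp_all add: GL_gcat_def)

lemma invertible_mat_carrier: "\<lbrakk>invertible_mat A; dim_row A = n\<rbrakk> \<Longrightarrow> A \<in> carrier_mat n n"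
  by (auto simp: invertible_mat_def square_mat.simps)

lemma invertible_mat_one: "invertible_mat (1\<^sub>m n :: 'r::ring_1 mat)"
  by (rule invertible_matI[of _ n "1\<^sub>m n"]) auto

lemma invertible_mat_mult:
  fixes A B :: "'r::ring_1 mat"
  assumes A: "invertible_mat A" and B: "invertible_mat B" and dim: "dim_row A = dim_row B"
  shows "invertible_mat (A * B)"
proof -
  obtain n A' where A': "A \<in> carrier_mat n n" "A' \<in> carrier_mat n n" "A * A' = 1\<^sub>m n" "A' * A = 1\<^sub>m n"
    using A by (rule invertible_matE)
  obtain m B' where "B \<in> carrier_mat m m" "B' \<in> carrier_mat m m" "B * B' = 1\<^sub>m m" "B' * B = 1\<^sub>m m"
    using B by (rule invertible_matE)
  moreover from this A' dim have "m = n" by simp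
  ultimately have B': "B \<in> carrier_mat n n" "B' \<in> carrier_mat n n" "B * B' = 1\<^sub>m n" "B' * B = 1\<^sub>m n"
    by simp_all
  show ?thesis
  proof (rule invertible_matI[of _ n "B' * A'"])
    have "A * B * (B' * A') = A * ((B * B') * A')"
      using A'(1,2) B'(1,2) by (simp add: assoc_mult_mat[of _ n n _ n _ n])
    then show "A * B * (B' * A') = 1\<^sub>m n" using A' B' by simp
    have "B' * A' * (A * B) = B' * ((A' * A) * B)"
      using A'(1,2) B'(1,2) by (simp add: assoc_mult_mat[of _ n n _ n _ n])
    then show "B' * A' * (A * B) = 1\<^sub>m n" using A' B' by simp
  qed (use A' B' in auto)
qed

lemma (in g_ring) gcategory_GL: "gcategory G (GL_gcat act)"
proof -
  let ?K = "GL_gcat act"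
  interpret K: category ?K
  proof
    fix A assume A: "A \<in> Arr ?K"
    obtain n where n: "dim_row A = n" by simp
    have An: "A \<in> carrier_mat n n" using A n by (simp add: invertible_mat_carrier)
    show "Cmp ?K A (Idt ?K (Src ?K A)) = A" "Cmp ?K (Idt ?K (Tgt ?K A)) A = A"
      using n right_mult_one_mat[OF An] left_mult_one_mat[OF An] by simp_all
    fix B C assume BC: "B \<in> Arr ?K" "C \<in> Arr ?K" "Tgt ?K A = Src ?K B" "Tgt ?K B = Src ?K C"
    then have "B \<in> carrier_mat n n" "C \<in> carrier_mat n n"
      using n by (simp_all add: invertible_mat_carrier)
    then show "Cmp ?K C (Cmp ?K B A) = Cmp ?K (Cmp ?K C B) A"
      using An by (simp add: assoc_mult_mat[of _ n n _ n _ n])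
  qed (simp_all add: invertible_mat_one invertible_mat_mult)
  have gfun: "is_functor ?K ?K (gact ?K g)" if g: "g \<in> carrier G" for g
    unfolding is_functor_def
  proof (intro conjI ballI impI)
    show "amap (gact ?K g) \<in> Arr ?K \<rightarrow>\<^sub>E Arr ?K"
      using map_act_invertible[OF g] by (auto simp: GL_gcat_def)
    show "amap (gact ?K g) (Cmp ?K B A) = Cmp ?K (amap (gact ?K g) B) (amap (gact ?K g) A)"
      if "A \<in> Arr ?K" "B \<in> Arr ?K" "Tgt ?K A = Src ?K B" for A B
    proof -
      obtain n where n: "dim_row A = n" by simp
      then have "A \<in> carrier_mat n n" "B \<in> carrier_mat n n"
        using that by (simp_all add: invertible_mat_carrier)
      from map_act_mult[OF g this(2,1)] show ?thesis
        using that invertible_mat_mult[of B A] by simp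
    qed
  qed (use g in \<open>auto simp: invertible_mat_one map_act_one\<close>)
  show ?thesis
  proof unfold_locales
    show "gact ?K \<one> = id_fctr ?K"
      using gfun[OF one_closed] K.is_functor_id by (rule functor_eqI) (auto intro!: eq_matI simp: act_one)
    show "gact ?K (g \<otimes> h) = comp_fctr ?K (gact ?K g) (gact ?K h)" if "g \<in> carrier G" "h \<in> carrier G" for g h
      using gfun[OF m_closed[OF that]] K.is_functor_comp[OF gfun[OF that(2)] gfun[OF that(1)]]
      by (rule functor_eqI) (use that in \<open>auto intro!: eq_matI simp: act_mult map_act_invertible\<close>)
  qed (rule gfun)
qed

section \<open>The functor from free modules to matrices\<close>

text \<open>A module and its twists have the same frames, hence the same chosen frame. This makes the
  functor below strictly equivariant.\<close>

definition frame_of :: "('r::ring_1, 'm) module \<Rightarrow> 'm list" where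
  "frame_of M = (SOME bs. is_frame M bs)"

definition matrix_fctr ::
  "(('r::ring_1, 'm) module, ('r, 'm) module \<times> ('r, 'm) module \<times> ('m \<Rightarrow> 'm), nat, 'r mat) fctr" where
  "matrix_fctr =
     \<lparr>omap = \<lambda>M\<in>fg_free_modules. length (frame_of M),
      amap = \<lambda>(M, N, f)\<in>{(M, N, f). M \<in> fg_free_modules \<and> N \<in> fg_free_modules \<and> f \<in> module_isos M N}.
        THE A. is_matrix_of M (frame_of M) N (frame_of N) f A\<rparr>"

lemma is_frame_frame_of: "M \<in> fg_free_modules \<Longrightarrow> is_frame M (frame_of M)"
  unfolding frame_of_def by (elim fg_free_modulesE) (blast intro: someI)

lemma matrix_fctr_obj [simp]: "M \<in> fg_free_modules \<Longrightarrow> omap matrix_fctr M = length (frame_of M)"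
  by (simp add: matrix_fctr_def)

text \<open>Unique existence turns the definite description into an equivalence, so functor laws are
  proved by exhibiting the right matrix.\<close>

lemma matrix_fctr_arr:
  assumes "M \<in> fg_free_modules" "N \<in> fg_free_modules" "f \<in> module_isos M N"
  shows "is_matrix_of M (frame_of M) N (frame_of N) f A \<longleftrightarrow> amap matrix_fctr (M, N, f) = A"
proof -
  have *: "\<exists>!A. is_matrix_of M (frame_of M) N (frame_of N) f A"
    using ex_is_matrix_of[OF fg_free_left_module[OF assms(1)] fg_free_left_module[OF assms(2)]
        is_frame_frame_of[OF assms(1)] is_frame_frame_of[OF assms(2)] assms(3)]
      is_matrix_of_unique[OF is_frame_frame_of[OF assms(1)], of f] module_isosD(2)[OF assms(3)]
    by (auto simp: bij_betw_def)
  have "amap matrix_fctr (M, N, f) = (THE A. is_matrix_of M (frame_of M) N (frame_of N) f A)"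
    using assms by (simp add: matrix_fctr_def)
  then show ?thesis using theI'[OF *] * by metis
qed

text \<open>Invariant basis number gives source and target of an isomorphism the same rank, as
  arrows of \<open>GL_gcat\<close> demand. Lifts exist uniquely because two frames and an invertible
  matrix determine an isomorphism.\<close>

lemma (in g_ring) fully_faithful_matrix_fctr:
  assumes ibn: "invariant_basis_number TYPE('r)"
  shows "fully_faithful_functor G (isoF_gcat G act
      :: ('g, ('r, 'm) module, ('r, 'm) module \<times> ('r, 'm) module \<times> ('m \<Rightarrow> 'm)) gcat) (GL_gcat act) matrix_fctr"
proof -
  let ?K = "isoF_gcat G act :: ('g, ('r, 'm) module, ('r, 'm) module \<times> ('r, 'm) module \<times> ('m \<Rightarrow> 'm)) gcat"
  let ?L = "GL_gcat act"
  let ?F = "matrix_fctr :: (('r, 'm) module, ('r, 'm) module \<times> ('r, 'm) module \<times> ('m \<Rightarrow> 'm), nat, 'r mat) fctr"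
  interpret K: gcategory G ?K by (rule gcategory_isoF)
  interpret L: gcategory G ?L by (rule gcategory_GL)
  have mat: "is_matrix_of M (frame_of M) N (frame_of N) f (amap ?F (M, N, f))"
    "invertible_mat (amap ?F (M, N, f))" "dim_row (amap ?F (M, N, f)) = length (frame_of M)"
    "length (frame_of N) = length (frame_of M)"
    if "M \<in> fg_free_modules" "N \<in> fg_free_modules" "f \<in> module_isos M N" for M N :: "('r, 'm) module" and f
  proof -
    show m: "is_matrix_of M (frame_of M) N (frame_of N) f (amap ?F (M, N, f))"
      using matrix_fctr_arr[OF that] by blast
    note inv = is_matrix_of_invertible[OF ibn fg_free_left_module[OF that(1)] fg_free_left_module[OF that(2)]
        is_frame_frame_of[OF that(1)] is_frame_frame_of[OF that(2)] that(3) m]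
    show "invertible_mat (amap ?F (M, N, f))" "length (frame_of N) = length (frame_of M)"
      using inv by simp_all
    then show "dim_row (amap ?F (M, N, f)) = length (frame_of M)"
      using m carrier_matD(1) unfolding is_matrix_of_def by metis
  qed
  have F: "is_functor ?K ?L ?F"
    unfolding is_functor_def
  proof (intro conjI ballI impI)
    show "omap ?F \<in> Obj ?K \<rightarrow>\<^sub>E Obj ?L" by (simp add: matrix_fctr_def)
    have "amap ?F \<in> extensional (Arr ?K)" by (simp add: matrix_fctr_def)
    then show "amap ?F \<in> Arr ?K \<rightarrow>\<^sub>E Arr ?L" using mat(2) by (auto simp: PiE_def)
    show "amap ?F (Idt ?K M) = Idt ?L (omap ?F M)" if "M \<in> Obj ?K" for M
      using that is_matrix_of_id[OF is_frame_frame_of[of M]]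
        matrix_fctr_arr[of M M "\<lambda>m\<in>carrier M. m"] module_isos_id[OF fg_free_left_module[of M]]
      by simp
    fix a assume "a \<in> Arr ?K"
    then obtain M N f where a: "a = (M, N, f)" "M \<in> fg_free_modules" "N \<in> fg_free_modules" "f \<in> module_isos M N"
      by auto
    then show "Src ?L (amap ?F a) = omap ?F (Src ?K a)" "Tgt ?L (amap ?F a) = omap ?F (Tgt ?K a)"
      using mat(3,4)[OF a(2-4)] by simp_all
    fix b assume "b \<in> Arr ?K" "Tgt ?K a = Src ?K b"
    then obtain P f' where b: "b = (N, P, f')" "P \<in> fg_free_modules" "f' \<in> module_isos N P"
      using a by auto
    show "amap ?F (Cmp ?K b a) = Cmp ?L (amap ?F b) (amap ?F a)"
      using is_matrix_of_comp[OF is_frame_frame_of[OF a(2)] mat(1)[OF a(2-4)] mat(1)[OF a(3) b(2,3)]]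
        matrix_fctr_arr[OF a(2) b(2) module_isos_comp[OF fg_free_left_module[OF a(2)] a(4) b(3)]]
      by (simp add: a(1) b(1))
  qed
  show ?thesis
  proof unfold_locales
    show "comp_fctr ?K ?F (gact ?K g) = comp_fctr ?K (gact ?L g) ?F" if g: "g \<in> carrier G" for g
    proof (rule functor_eqI[OF K.is_functor_comp[OF K.gact_functor[OF g] F] K.is_functor_comp[OF F L.gact_functor[OF g]]])
      have fr: "frame_of (twist_module G act g M) = frame_of M" if "M \<in> fg_free_modules" for M :: "('r, 'm) module"
        using that by (simp add: frame_of_def is_frame_twist[OF g fg_free_left_module])
      show "omap (comp_fctr ?K ?F (gact ?K g)) M = omap (comp_fctr ?K (gact ?L g) ?F) M" if "M \<in> Obj ?K" for M
        using that by (simp add: fr twist_fg_free[OF g])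
      show "amap (comp_fctr ?K ?F (gact ?K g)) a = amap (comp_fctr ?K (gact ?L g) ?F) a" if aK: "a \<in> Arr ?K" for a
      proof -
        from aK obtain M N f where a: "a = (M, N, f)" "M \<in> fg_free_modules" "N \<in> fg_free_modules" "f \<in> module_isos M N"
          by auto
        have "amap ?F (twist_module G act g M, twist_module G act g N, f) = map_mat (act g) (amap ?F (M, N, f))"
          using is_matrix_of_twist[OF g fg_free_left_module[OF a(2)] fg_free_left_module[OF a(3)] _ _ mat(1)[OF a(2-4)]]
            is_frame_frame_of[OF a(2)] is_frame_frame_of[OF a(3)]
            matrix_fctr_arr[OF twist_fg_free[OF g a(2)] twist_fg_free[OF g a(3)] twist_module_isos[OF g a(4)]]
          by (simp add: fr a(2,3) is_frame_def)
        then show ?thesis using aK a mat(2)[OF a(2-4)] by simp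
      qed
    qed
    show "\<exists>!a. a \<in> Arr ?K \<and> Src ?K a = M \<and> Tgt ?K a = N \<and> amap ?F a = A"
      if MN: "M \<in> Obj ?K" "N \<in> Obj ?K" and A: "A \<in> Arr ?L" "Src ?L A = omap ?F M" "Tgt ?L A = omap ?F N" for M N A
    proof -
      have M: "M \<in> fg_free_modules" and N: "N \<in> fg_free_modules" using MN by auto
      have "invertible_mat A" using A by simp
      then obtain n B where B: "A \<in> carrier_mat n n" "B \<in> carrier_mat n n" "A * B = 1\<^sub>m n" "B * A = 1\<^sub>m n"
        by (rule invertible_matE)
      have n: "length (frame_of M) = n" "length (frame_of N) = n" using A M N B(1) by auto
      have "\<exists>!f. f \<in> module_isos M N \<and> is_matrix_of M (frame_of M) N (frame_of N) f A"
        using ex_iso_of_matrix[OF fg_free_left_module[OF M] fg_free_left_module[OF N]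
            is_frame_frame_of[OF M] is_frame_frame_of[OF N] B n] .
      then have "\<exists>!f. f \<in> module_isos M N \<and> amap ?F (M, N, f) = A"
        using matrix_fctr_arr[OF M N] by (simp cong: conj_cong)
      then obtain f where f: "f \<in> module_isos M N" "amap ?F (M, N, f) = A"
        "\<And>f'. f' \<in> module_isos M N \<Longrightarrow> amap ?F (M, N, f') = A \<Longrightarrow> f' = f" by blast
      show ?thesis
      proof (rule ex1I[of _ "(M, N, f)"])
        show "(M, N, f) \<in> Arr ?K \<and> Src ?K (M, N, f) = M \<and> Tgt ?K (M, N, f) = N \<and> amap ?F (M, N, f) = A"
          using f(1,2) M N by simp
        fix a assume a: "a \<in> Arr ?K \<and> Src ?K a = M \<and> Tgt ?K a = N \<and> amap ?F a = A"
        then obtain f' where "a = (M, N, f')" "f' \<in> module_isos M N" by auto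
        with a f(3)[of f'] show "a = (M, N, f)" by simp
      qed
    qed
  qed (rule F)
qed

section \<open>Free modules of every rank\<close>

text \<open>The row module of rank \<open>n\<close>, carried over to the image of \<open>j\<close>
  so that its elements have type \<open>'m\<close>. The restrictions make the record equal to its
  stripped form.\<close>

definition transport_module :: "nat \<Rightarrow> ('r::ring_1 mat \<Rightarrow> 'm) \<Rightarrow> ('r, 'm) module" where
  "transport_module n j = (let X = j ` carrier_mat 1 n; k = inv_into (carrier_mat 1 n) j in
     \<lparr>carrier = X, mult = undefined, one = undefined, zero = j (0\<^sub>m 1 n),
      add = \<lambda>a\<in>X. \<lambda>b\<in>X. j (k a + k b), smult = \<lambda>r. \<lambda>a\<in>X. j (r \<cdot>\<^sub>m k a)\<rparr>)"

context
  fixes j :: "'r::ring_1 mat \<Rightarrow> 'm" and n :: nat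
  assumes j: "inj_on j (carrier_mat 1 n)"
begin

lemma transport_module_simps [simp]:
  "carrier (transport_module n j) = j ` carrier_mat 1 n"
  "zero (transport_module n j) = j (0\<^sub>m 1 n)"
  "\<lbrakk>v \<in> carrier_mat 1 n; w \<in> carrier_mat 1 n\<rbrakk> \<Longrightarrow> add (transport_module n j) (j v) (j w) = j (v + w)"
  "v \<in> carrier_mat 1 n \<Longrightarrow> smult (transport_module n j) r (j v) = j (r \<cdot>\<^sub>m v)"
  using j by (simp_all add: transport_module_def Let_def)

lemma left_module_transport: "left_module (transport_module n j)"
proof -
  let ?M = "transport_module n j"
  have "abelian_group ?M"
  proof (rule abelian_groupI)
    fix x assume "x \<in> carrier ?M"
    then obtain v where v: "v \<in> carrier_mat 1 n" "x = j v" by auto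
    then show "\<exists>y\<in>carrier ?M. y \<oplus>\<^bsub>?M\<^esub> x = \<zero>\<^bsub>?M\<^esub>"
      by (intro bexI[of _ "j (- v)"]) (auto simp: uminus_l_inv_mat)
  qed (auto simp: assoc_add_mat[of _ 1 n] intro!: arg_cong[of _ _ j] comm_add_mat[of _ 1 n])
  moreover have "left_module_axioms ?M"
    unfolding left_module_axioms_def
    by (auto intro!: arg_cong[of _ _ j] eq_matI simp: algebra_simps)
  ultimately show ?thesis by (simp add: left_module_def)
qed

text \<open>The first \<open>k\<close> terms sum to \<open>v\<close> cut off after \<open>k\<close>
  coordinates; for \<open>k = n\<close> nothing is cut off.\<close>

lemma comb_transport:
  assumes v: "v \<in> carrier_mat 1 n"
  shows "comb (transport_module n j) (map (\<lambda>i. j (unit_row n i)) [0..<n]) v = j v"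
proof -
  let ?M = "transport_module n j"
  interpret left_module ?M by (rule left_module_transport)
  have "(\<Oplus>\<^bsub>?M\<^esub>i\<in>{..<k}. v $$ (0, i) \<odot>\<^bsub>?M\<^esub> map (\<lambda>i. j (unit_row n i)) [0..<n] ! i)
      = j (mat 1 n (\<lambda>(_, i). if i < k then v $$ (0, i) else 0))" if "k \<le> n" for k
    using that
  proof (induction k)
    case 0
    have "mat 1 n (\<lambda>(_, i). if i < 0 then v $$ (0, i) else 0) = 0\<^sub>m 1 n" by (intro eq_matI) auto
    then show ?case by (simp only: lessThan_0 finsum_empty transport_module_simps(2))
  next
    case (Suc k)
    let ?f = "\<lambda>i. v $$ (0, i) \<odot>\<^bsub>?M\<^esub> map (\<lambda>i. j (unit_row n i)) [0..<n] ! i"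
    have f: "?f i = j (v $$ (0, i) \<cdot>\<^sub>m unit_row n i)" if "i < n" for i
      using that unit_row_carrier[of n i] by simp
    have c: "v $$ (0, i) \<cdot>\<^sub>m unit_row n i \<in> carrier_mat 1 n" for i
      using unit_row_carrier[of n i] by simp
    have "(\<Oplus>\<^bsub>?M\<^esub>i\<in>{..<Suc k}. ?f i) = ?f k \<oplus>\<^bsub>?M\<^esub> (\<Oplus>\<^bsub>?M\<^esub>i\<in>{..<k}. ?f i)"
      unfolding lessThan_Suc
      by (rule finsum_insert) (use Suc.prems f c in auto)
    also have "\<dots> = j (v $$ (0, k) \<cdot>\<^sub>m unit_row n k + mat 1 n (\<lambda>(_, i). if i < k then v $$ (0, i) else 0))"
      using Suc f[of k] c[of k] by simp
    also have "v $$ (0, k) \<cdot>\<^sub>m unit_row n k + mat 1 n (\<lambda>(_, i). if i < k then v $$ (0, i) else 0)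
        = mat 1 n (\<lambda>(_, i). if i < Suc k then v $$ (0, i) else 0)"
      by (intro eq_matI) (auto simp: unit_row_def less_Suc_eq)
    finally show ?case .
  qed
  from this[of n] have "comb ?M (map (\<lambda>i. j (unit_row n i)) [0..<n]) v
      = j (mat 1 n (\<lambda>(_, i). if i < n then v $$ (0, i) else 0))"
    by (simp add: comb_def)
  also have "mat 1 n (\<lambda>(_, i). if i < n then v $$ (0, i) else 0) = v" using v by (intro eq_matI) auto
  finally show ?thesis .
qed

lemma transport_module_free:
  shows "transport_module n j \<in> fg_free_modules"
    and "is_frame (transport_module n j) (map (\<lambda>i. j (unit_row n i)) [0..<n])"
proof -
  let ?M = "transport_module n j" and ?bs = "map (\<lambda>i. j (unit_row n i)) [0..<n]"
  have "bij_betw j (carrier_mat 1 n) (carrier ?M)" using j by (simp add: bij_betw_def)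
  then have "bij_betw (comb ?M ?bs) (carrier_mat 1 n) (carrier ?M)"
    by (rule bij_betw_cong[THEN iffD1, rotated]) (simp add: comb_transport)
  moreover have sub: "set ?bs \<subseteq> carrier ?M" using unit_row_carrier by auto
  ultimately show frame: "is_frame ?M ?bs" by (simp add: is_frame_def)
  have "inj_on (\<lambda>i. j (unit_row n i)) {0..<n}"
  proof (rule inj_onI)
    fix i i' assume i: "i \<in> {0..<n}" "i' \<in> {0..<n}" "j (unit_row n i) = j (unit_row n i')"
    then have "unit_row n i = (unit_row n i' :: 'r mat)" using j unit_row_carrier by (auto dest!: inj_onD)
    then have "unit_row n i $$ (0, i) = (unit_row n i' $$ (0, i) :: 'r)" by simp
    then show "i = i'" using i by (simp add: unit_row_def split: if_splits)
  qed
  then have "distinct ?bs" by (simp add: distinct_map)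
  then have "is_basis ?M (set ?bs)"
    using left_module.is_basis_iff_is_frame[OF left_module_transport _ sub] frame by blast
  moreover have "strip_module ?M = ?M"
    by (simp add: strip_module_def) (simp add: transport_module_def Let_def fun_eq_iff restrict_def)
  ultimately show "?M \<in> fg_free_modules" using left_module_transport by (auto simp: fg_free_modules_def)
qed

end

text \<open>Lists let a single \<iota> embed the rows of every length. The frame chosen by
  \<open>frame_of\<close> may differ from the standard one; comparing the two along the identity
  map, invariant basis number gives both length \<open>n\<close>.\<close>

lemma matrix_fctr_surj:
  fixes \<iota> :: "'r::ring_1 list \<Rightarrow> 'm"
  assumes ibn: "invariant_basis_number TYPE('r)" and \<iota>: "inj \<iota>"
  shows "\<exists>M :: ('r, 'm) module. M \<in> fg_free_modules \<and> omap matrix_fctr M = n"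
proof -
  define j where "j v = \<iota> (map (\<lambda>i. v $$ (0, i)) [0..<n])" for v :: "'r mat"
  have "inj_on j (carrier_mat 1 n)"
  proof (rule inj_onI)
    fix v w :: "'r mat" assume vw: "v \<in> carrier_mat 1 n" "w \<in> carrier_mat 1 n" "j v = j w"
    then have "\<forall>i<n. v $$ (0, i) = w $$ (0, i)" using \<iota> by (simp add: j_def inj_eq)
    then show "v = w" using vw by (intro eq_matI) auto
  qed
  note M = transport_module_free[OF this]
  let ?M = "transport_module n j"
  have lm: "left_module ?M" using M(1) by (rule fg_free_left_module)
  obtain A where "is_matrix_of ?M (frame_of ?M) ?M (map (\<lambda>i. j (unit_row n i)) [0..<n]) (\<lambda>m\<in>carrier ?M. m) A"
    using ex_is_matrix_of[OF lm lm is_frame_frame_of[OF M(1)] M(2) module_isos_id[OF lm]] by blast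
  then have "length (frame_of ?M) = n"
    using is_matrix_of_invertible(1)[OF ibn lm lm is_frame_frame_of[OF M(1)] M(2) module_isos_id[OF lm]] by simp
  then show ?thesis using M(1) by auto
qed

text \<open>The third assumption gives the carrier type room for a free module of each finite rank,
  so the matrix functor is onto objects; the second keeps ranks apart. The witness is
  postcomposition with \<open>matrix_fctr\<close>.\<close>

theorem proposition4p13:
  fixes G :: "('g, 'x) monoid_scheme" and act :: "'g \<Rightarrow> 'r::ring_1 \<Rightarrow> 'r"
  assumes "g_ring G act"
    and "invariant_basis_number TYPE('r)"
    and "\<exists>\<iota> :: 'r list \<Rightarrow> 'm. inj \<iota>"
  shows "\<exists>F. weak_G_equivalence G
           (Cat_gcat G (translation_gcat G)
             (isoF_gcat G act
               :: ('g, ('r, 'm) module, ('r, 'm) module \<times> ('r, 'm) module \<times> ('m \<Rightarrow> 'm)) gcat))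
           (Cat_gcat G (translation_gcat G) (GL_gcat act))
           F"
proof -
  let ?F = "matrix_fctr :: (('r, 'm) module, ('r, 'm) module \<times> ('r, 'm) module \<times> ('m \<Rightarrow> 'm), nat, 'r mat) fctr"
  obtain \<iota> :: "'r list \<Rightarrow> 'm" where "inj \<iota>" using assms(3) by blast
  have "\<exists>M\<in>fg_free_modules. omap ?F M = n" for n
    using matrix_fctr_surj[OF assms(2) \<open>inj \<iota>\<close>, of n] by blast
  then have "omap ?F ` Obj (isoF_gcat G act) = Obj (GL_gcat act)"
    unfolding isoF_gcat_simps GL_gcat_simps by (metis UNIV_eq_I image_eqI)
  then show ?thesis
    using fully_faithful_functor.weak_G_equivalence_Cat_translation[OF
        g_ring.fully_faithful_matrix_fctr[OF assms(1,2)] groupoid_isoF] by blast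
qed

end
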